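(* Let $n\ge3$, let $M>0$ be a dyadic number and let $q>\frac{4n-2}{2n-3}$ (with $q\le\infty$). There is a constant $C=C(n,q)$, independent of $M$, such that for every $u_0\in L^2(\mathbb R^{n-1})$ whose Fourier transform $\hat u_0$ is radial and supported in $\{\xi\in\mathbb R^{n-1}:M\le|\xi|\le2M\}$, $$\|e^{it\triangle}u_0\|_{L^q_{t,x}(\mathbb R\times\mathbb R^{n-1})}\le C\,M^{\frac{n-1}2-\frac{n+1}q}\|u_0\|_{L^2(\mathbb R^{n-1})}.$$
   Context: A dyadic number is a number $2^j$, $j\in\mathbb Z$. The Fourier transform is $\hat f(\xi)=\int_{\mathbb R^{n-1}}f(x)e^{-ix\cdot\xi}\,dx$, and $e^{it\triangle}u_0(x)=\int_{\mathbb R^{n-1}}e^{i(x\cdot\xi+t|\xi|^2)}\hat u_0(\xi)\,d\xi$ (multiplicative constants and the sign of $t$ are immaterial). *)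

theory Defs
  imports "HOL-Analysis.Analysis" "HOL-Probability.Essential_Supremum"
begin

text \<open>Only used for exponents \<open>0 < p \<le> \<infinity>\<close> and measurable \<open>f\<close>.\<close>

definition Lp_norm :: "ennreal \<Rightarrow> 'a measure \<Rightarrow> ('a \<Rightarrow> 'b::real_normed_vector) \<Rightarrow> ennreal" where
  "Lp_norm p \<mu> f =
    (if p = \<infinity> then esssup \<mu> (\<lambda>x. ennreal (norm (f x)))
     else (let I = (\<integral>\<^sup>+ x. ennreal (norm (f x) powr enn2real p) \<partial>\<mu>)
           in if I = \<infinity> then \<infinity> else ennreal (enn2real I powr (1 / enn2real p))))"

definition mem_Lp :: "ennreal \<Rightarrow> 'a measure \<Rightarrow> ('a \<Rightarrow> 'b::real_normed_vector) \<Rightarrow> bool" where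
  "mem_Lp p \<mu> f \<longleftrightarrow> f \<in> borel_measurable \<mu> \<and> Lp_norm p \<mu> f < \<infinity>"

definition dyadic :: "real \<Rightarrow> bool" where
  "dyadic M \<longleftrightarrow> (\<exists>j::int. M = 2 powi j)"

definition fourier_integral :: "('a::euclidean_space \<Rightarrow> complex) \<Rightarrow> 'a \<Rightarrow> complex" where
  "fourier_integral f \<xi> = (\<integral>x. f x * exp (- \<i> * of_real (x \<bullet> \<xi>)) \<partial>lebesgue)"

text \<open>
  A function in \<open>L\<^sup>2\<close> need not be integrable, so its Fourier transform is the limit in \<open>L\<^sup>2\<close>
  of the Fourier integrals of its (integrable) truncations to balls. As this limit is determined
  only up to null sets, \<open>has_fourier_L2 f g\<close> says that \<open>g\<close> is a representative of it.
\<close>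

definition has_fourier_L2 ::
    "('a::euclidean_space \<Rightarrow> complex) \<Rightarrow> ('a \<Rightarrow> complex) \<Rightarrow> bool" where
  "has_fourier_L2 f g \<longleftrightarrow>
     mem_Lp 2 lebesgue f \<and> mem_Lp 2 lebesgue g \<and>
     ((\<lambda>R::real. Lp_norm 2 lebesgue
         (\<lambda>\<xi>. fourier_integral (\<lambda>x. indicator (cball 0 R) x * f x) \<xi> - g \<xi>)) \<longlongrightarrow> 0) at_top"

text \<open>
  Radiality and support are properties of the class of \<open>g\<close> modulo null sets; for the closed
  annulus, the support condition amounts to vanishing almost everywhere outside it.
\<close>

definition radial_ae :: "('a::euclidean_space \<Rightarrow> complex) \<Rightarrow> bool" where
  "radial_ae g \<longleftrightarrow> (\<exists>h. AE \<xi> in lebesgue. g \<xi> = h (norm \<xi>))"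

definition supported_in_ae :: "('a::euclidean_space \<Rightarrow> complex) \<Rightarrow> 'a set \<Rightarrow> bool" where
  "supported_in_ae g S \<longleftrightarrow> (AE \<xi> in lebesgue. \<xi> \<notin> S \<longrightarrow> g \<xi> = 0)"

text \<open>
  \<open>schroedinger g (t, x)\<close> is \<open>(e\<^bsup>it\<Delta>\<^esup> u) (x)\<close> for the function \<open>u\<close> with Fourier transform \<open>g\<close>;
  the value does not depend on the representative \<open>g\<close>. No constant \<open>(2\<pi>)\<close> is inserted.
\<close>

definition schroedinger :: "('a::euclidean_space \<Rightarrow> complex) \<Rightarrow> real \<times> 'a \<Rightarrow> complex" where
  "schroedinger g = (\<lambda>(t, x).
     \<integral>\<xi>. exp (\<i> * of_real (x \<bullet> \<xi> + t * (norm \<xi>)\<^sup>2)) * g \<xi> \<partial>lebesgue)"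

end

theory Submission
  imports Defs "HOL-Probability.Characteristic_Functions"
begin

text \<open>
  All oscillatory estimates come from one principle (Schur's test against a Gaussian weight): if the
  pushforward of a measure \<open>\<mu>\<close> under \<open>\<Theta>\<close> is dominated by Lebesgue measure, then
  \<open>F \<mapsto> \<integral> F e\<^bsup>iz\<cdot>\<Theta>\<^esup> d\<mu>\<close> is bounded from \<open>L\<^sup>2(\<mu>)\<close> to \<open>L\<^sup>2\<close>. With \<open>\<Theta> = id\<close> this is Plancherel's inequality, with
  \<open>\<Theta>(\<rho>) = \<rho>\<^sup>2\<close> it bounds the evolution in \<open>L\<^sup>2\<close> of time at a fixed radius, and with
  \<open>\<Theta>(\<rho>) = (\<bar>\<rho>\<bar>\<^sup>2, \<rho>\<^sub>1 + \<rho>\<^sub>2 + \<rho>\<^sub>3)\<close> on \<open>\<real>\<^sup>3\<close>, applied to a tensor cube, it is the one-dimensional \<open>L\<^sup>6\<close>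
  Strichartz estimate.

  In dimension \<open>m + 1\<close> the evolution of radial data depends only on \<open>t\<close> and \<open>r = \<bar>x\<bar>\<close> and is a
  one-dimensional integral against a Bessel kernel, which by its differential equation equals
  \<open>s\<^bsup>-m/2\<^esup>\<close> times a combination of \<open>e\<^bsup>is\<^esup>\<close> and \<open>e\<^bsup>-is\<^esup>\<close>, up to a relative error \<open>O(1/s)\<close>. Hence
  \<open>r\<^bsup>m/2\<^esup> u\<close> is bounded in \<open>L\<^sup>2\<close> of time for each \<open>r\<close>, and in \<open>L\<^sup>6(dt dr)\<close>. Interpolating pointwise,
  \<open>\<bar>u\<bar>\<^sup>q \<le> r\<^bsup>-\<alpha>\<^esup> \<bar>u\<bar>\<^sup>2 + r\<^bsup>2m\<^esup> \<bar>u\<bar>\<^sup>6\<close> with \<open>\<alpha> = 2m(q - 2)/(6 - q)\<close>, and the integral over \<open>r > 1\<close>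
  converges exactly when \<open>\<alpha> > 1\<close>, which is the condition on \<open>q\<close>. Larger \<open>q\<close> follow from the uniform
  bound on \<open>u\<close>, and general \<open>M\<close> by scaling.
\<close>

subsection \<open>Schur's test for Fourier extension operators\<close>

text \<open>The Gaussian weight makes the expanded square absolutely integrable in \<open>z\<close>.
  Fubini then gives a double integral against a Gaussian kernel at
  \<open>\<Theta> x - \<Theta> y\<close>, whose mass is the same for every \<epsilon>, so the weight
  can be removed at the end. The exponent 6 appears because the cube of a one-dimensional integral
  lives on R^3. There a plane cuts a ball in a disc, and the density of the norm on parallel planes
  has no singular factor; this keeps the pushforward bounded. The weighted bounds are proved for
  radii r >= 1, where the argument of the Bessel kernel stays at least 1 on the unit band; for r < 1
  boundedness of the kernel suffices. The exponent \<alpha> is the one at which the two terms of the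
  interpolation balance. After multiplication by the volume factor r^m the second term is exactly
  the sixth power of r^(m/2) |u|, so the entire loss sits in the integral of r^(-\<alpha>). A
  separate obstacle is that the data are classes modulo null sets: the radial profile is an
  arbitrary function and the transform is an L^2 limit. A Borel profile and an L^2 inequality must
  be extracted before any formula can be used.\<close>

lemma
  fixes f :: "'a::euclidean_space \<Rightarrow> real \<Rightarrow> complex"
  assumes "\<And>b. b \<in> Basis \<Longrightarrow> integrable lborel (f b)"
  shows integrable_lborel_prod_Basis: "integrable lborel (\<lambda>z::'a. \<Prod>b\<in>Basis. f b (z \<bullet> b))"
    and integral_lborel_prod_Basis:
      "(\<integral>z. (\<Prod>b\<in>Basis. f b (z \<bullet> b)) \<partial>(lborel :: 'a measure)) = (\<Prod>b\<in>Basis. integral\<^sup>L lborel (f b))"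
proof -
  interpret product_sigma_finite "\<lambda>b::'a. lborel :: real measure" by standard
  have [measurable]: "f b \<in> borel_measurable borel" if "b \<in> Basis" for b
    using assms[OF that] by (auto dest: borel_measurable_integrable)
  have T: "(\<lambda>g. \<Sum>b\<in>Basis. g b *\<^sub>R b) \<in> (\<Pi>\<^sub>M b\<in>Basis. lborel) \<rightarrow>\<^sub>M (borel :: 'a measure)"
    by measurable
  have M: "(\<lambda>z::'a. \<Prod>b\<in>Basis. f b (z \<bullet> b)) \<in> borel_measurable borel"
    by measurable
  have eq: "(\<Prod>b\<in>Basis. f b ((\<Sum>c\<in>Basis. g c *\<^sub>R c) \<bullet> b)) = (\<Prod>b\<in>Basis. f b (g b))" for g :: "'a \<Rightarrow> real"
    by (intro prod.cong refl) simp
  show "integrable lborel (\<lambda>z::'a. \<Prod>b\<in>Basis. f b (z \<bullet> b))"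
    by (subst lborel_eq, subst integrable_distr_eq[OF T M], unfold eq)
       (intro product_integrable_prod assms finite_Basis)
  show "(\<integral>z. (\<Prod>b\<in>Basis. f b (z \<bullet> b)) \<partial>(lborel :: 'a measure)) = (\<Prod>b\<in>Basis. integral\<^sup>L lborel (f b))"
    by (subst lborel_eq, subst integral_distr[OF T M], unfold eq)
       (intro product_integral_prod assms finite_Basis)
qed

section \<open>Fourier transforms and masses of Gaussians\<close>

lemma
  fixes y \<epsilon> :: real
  assumes "\<epsilon> > 0"
  shows integrable_iexp_gaussian:
      "integrable lborel (\<lambda>z. iexp (z * y) * complex_of_real (exp (- \<epsilon> * z\<^sup>2 / 2)))"
    and integral_iexp_gaussian:
      "(\<integral>z. iexp (z * y) * complex_of_real (exp (- \<epsilon> * z\<^sup>2 / 2)) \<partial>lborel)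
        = complex_of_real (sqrt (2 * pi / \<epsilon>) * exp (- y\<^sup>2 / (2 * \<epsilon>)))"
proof -
  \<comment> \<open>The substitution x = k z turns the weight into the standard normal density, so
    the integral is its characteristic function at y / k.\<close>
  define k where "k = sqrt \<epsilon>"
  have k: "k > 0" "k\<^sup>2 = \<epsilon>" using assms by (auto simp: k_def)
  define F where "F = (\<lambda>x::real. complex_of_real (std_normal_density x) * iexp (y / k * x))"
  have Fi: "integrable lborel F"
    unfolding F_def
    by (rule Bochner_Integration.integrable_bound[where f = std_normal_density])
       (auto simp: norm_mult)
  have "char std_normal_distribution (y / k) = integral\<^sup>L lborel F"
    unfolding char_def F_def
    by (subst integral_density) (auto simp: scaleR_conv_of_real)
  then have Fv: "integral\<^sup>L lborel F = complex_of_real (exp (- (y / k)\<^sup>2 / 2))"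
    by (simp add: char_std_normal_distribution)
  have eq: "iexp (z * y) * complex_of_real (exp (- \<epsilon> * z\<^sup>2 / 2)) = complex_of_real (sqrt (2 * pi)) * F (0 + k * z)" for z
    using k unfolding F_def normal_density_def
    by (simp add: power_mult_distrib mult_ac real_sqrt_mult)
  show "integrable lborel (\<lambda>z. iexp (z * y) * complex_of_real (exp (- \<epsilon> * z\<^sup>2 / 2)))"
    unfolding eq by (intro integrable_mult_right lborel_integrable_real_affine[OF Fi]) (use k in auto)
  have "integral\<^sup>L lborel F = k *\<^sub>R (\<integral>z. F (0 + k * z) \<partial>lborel)"
    using lborel_integral_real_affine[of k F 0] k by simp
  then have "(\<integral>z. F (0 + k * z) \<partial>lborel) = complex_of_real (exp (- (y / k)\<^sup>2 / 2) / k)"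
    using k Fv by (simp add: scaleR_conv_of_real field_simps)
  moreover have "sqrt (2 * pi) * (exp (- (y / k)\<^sup>2 / 2) / k) = sqrt (2 * pi / \<epsilon>) * exp (- y\<^sup>2 / (2 * \<epsilon>))"
    using k by (simp add: power_divide real_sqrt_divide k_def mult.commute)
  ultimately show "(\<integral>z. iexp (z * y) * complex_of_real (exp (- \<epsilon> * z\<^sup>2 / 2)) \<partial>lborel)
        = complex_of_real (sqrt (2 * pi / \<epsilon>) * exp (- y\<^sup>2 / (2 * \<epsilon>)))"
    unfolding eq by (metis integral_mult_right_zero of_real_mult)
qed

lemma
  fixes y :: "'a::euclidean_space" and \<epsilon> :: real
  assumes "\<epsilon> > 0"
  shows integrable_iexp_gaussian_euclidean:
      "integrable lborel (\<lambda>z. iexp (z \<bullet> y) * complex_of_real (exp (- \<epsilon> * (norm z)\<^sup>2 / 2)))"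
    and integral_iexp_gaussian_euclidean:
      "(\<integral>z. iexp (z \<bullet> y) * complex_of_real (exp (- \<epsilon> * (norm z)\<^sup>2 / 2)) \<partial>lborel)
        = complex_of_real (sqrt (2 * pi / \<epsilon>) ^ DIM('a) * exp (- (norm y)\<^sup>2 / (2 * \<epsilon>)))"
proof -
  let ?G = "\<lambda>z. iexp (z \<bullet> y) * complex_of_real (exp (- \<epsilon> * (norm z)\<^sup>2 / 2))"
  let ?g = "\<lambda>b x. iexp (x * (y \<bullet> b)) * complex_of_real (exp (- \<epsilon> * x\<^sup>2 / 2))"
  let ?v = "complex_of_real (sqrt (2 * pi / \<epsilon>) ^ DIM('a) * exp (- (norm y)\<^sup>2 / (2 * \<epsilon>)))"
  have n2: "(norm z)\<^sup>2 = (\<Sum>b\<in>Basis. (z \<bullet> b)\<^sup>2)" for z :: 'a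
    unfolding power2_norm_eq_inner by (subst euclidean_inner) (simp add: power2_eq_square)
  have eq: "?G z =
    (\<Prod>b\<in>Basis. iexp ((z \<bullet> b) * (y \<bullet> b)) * complex_of_real (exp (- \<epsilon> * (z \<bullet> b)\<^sup>2 / 2)))" for z
  proof -
    have "exp (- \<epsilon> * (norm z)\<^sup>2 / 2) = (\<Prod>b\<in>Basis. exp (- \<epsilon> * (z \<bullet> b)\<^sup>2 / 2))"
      unfolding n2 by (simp add: exp_sum[symmetric] sum_distrib_left sum_negf sum_divide_distrib)
    moreover have "iexp (z \<bullet> y) = (\<Prod>b\<in>Basis. iexp ((z \<bullet> b) * (y \<bullet> b)))"
      by (subst euclidean_inner) (simp add: exp_sum[symmetric] sum_distrib_left)
    ultimately show ?thesis by (simp add: prod.distrib)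
  qed
  note I = integrable_iexp_gaussian[OF assms]
  show "integrable lborel ?G"
    unfolding eq
    using integrable_lborel_prod_Basis[of ?g] I
    by simp
  have "(\<integral>z. ?G z \<partial>lborel) =
     (\<Prod>b\<in>Basis. complex_of_real (sqrt (2 * pi / \<epsilon>) * exp (- (y \<bullet> b)\<^sup>2 / (2 * \<epsilon>))))"
    unfolding eq
    using integral_lborel_prod_Basis[of ?g] I
    by (simp only: integral_iexp_gaussian[OF assms])
  also have "\<dots> = ?v"
    unfolding n2 of_real_prod[symmetric] prod.distrib
    by (simp add: exp_sum[symmetric] sum_negf sum_divide_distrib)
  finally show "(\<integral>z. ?G z \<partial>lborel)
        = ?v" .
qed

lemma nn_integral_lborel_translate:
  fixes f :: "'a::euclidean_space \<Rightarrow> ennreal"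
  assumes [measurable]: "f \<in> borel_measurable borel"
  shows "(\<integral>\<^sup>+x. f (a + x) \<partial>lborel) = (\<integral>\<^sup>+x. f x \<partial>lborel)"
  by (subst (2) lborel_distr_plus[symmetric, of a]) (simp add: nn_integral_distr)

text \<open>The integrand is the transform of the weight with parameter \<epsilon>. It is itself a
  Gaussian with parameter 1 / \<epsilon>, and in each coordinate the factors sqrt (2 pi /
  \<epsilon>) and sqrt (2 pi \<epsilon>) multiply to 2 pi. Independence of \<epsilon> is the
  point.\<close>

lemma nn_integral_gaussian_euclidean:
  fixes a :: "'a::euclidean_space"
  assumes "\<epsilon> > 0"
  shows "(\<integral>\<^sup>+z. ennreal (sqrt (2 * pi / \<epsilon>) ^ DIM('a) * exp (- (norm (a - z))\<^sup>2 / (2 * \<epsilon>))) \<partial>lborel)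
    = ennreal ((2 * pi) ^ DIM('a))"
proof -
  have e: "1 / \<epsilon> > 0" using assms by simp
  define g where "g = (\<lambda>z::'a. exp (- (1 / \<epsilon>) * (norm z)\<^sup>2 / 2))"
  have gi: "integrable lborel (\<lambda>z. complex_of_real (g z))"
    using integrable_iexp_gaussian_euclidean[OF e, of "0::'a"] by (simp add: g_def)
  then have gi': "integrable lborel g" by (subst (asm) complex_of_real_integrable_eq)
  have "complex_of_real (integral\<^sup>L lborel g) = complex_of_real (sqrt (2 * pi * \<epsilon>) ^ DIM('a))"
    using integral_iexp_gaussian_euclidean[OF e, of "0::'a"] by (simp add: g_def del: of_real_power)
  then have v: "integral\<^sup>L lborel g = sqrt (2 * pi * \<epsilon>) ^ DIM('a)"
    unfolding of_real_eq_iff .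
  have "(\<integral>\<^sup>+z. ennreal (sqrt (2 * pi / \<epsilon>) ^ DIM('a) * exp (- (norm (a - z))\<^sup>2 / (2 * \<epsilon>))) \<partial>lborel)
     = (\<integral>\<^sup>+z. ennreal (sqrt (2 * pi / \<epsilon>) ^ DIM('a)) * ennreal (g (- a + z)) \<partial>lborel)"
    using assms by (intro nn_integral_cong) (simp add: g_def ennreal_mult norm_minus_commute mult.commute[of 2 \<epsilon>])
  also have "\<dots> = ennreal (sqrt (2 * pi / \<epsilon>) ^ DIM('a)) * (\<integral>\<^sup>+z. ennreal (g (- a + z)) \<partial>lborel)"
    by (rule nn_integral_cmult) (simp add: g_def)
  also have "(\<integral>\<^sup>+z. ennreal (g (- a + z)) \<partial>lborel) = (\<integral>\<^sup>+z. ennreal (g z) \<partial>lborel)"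
    by (rule nn_integral_lborel_translate) (simp add: g_def)
  also have "\<dots> = ennreal (sqrt (2 * pi * \<epsilon>) ^ DIM('a))"
    using gi' v by (subst nn_integral_eq_integral) (auto simp: g_def)
  also have "ennreal (sqrt (2 * pi / \<epsilon>) ^ DIM('a)) * \<dots> = ennreal ((sqrt (2 * pi / \<epsilon>) * sqrt (2 * pi * \<epsilon>)) ^ DIM('a))"
    using assms by (simp add: ennreal_mult'[symmetric] power_mult_distrib)
  also have "sqrt (2 * pi / \<epsilon>) * sqrt (2 * pi * \<epsilon>) = sqrt ((2 * pi)\<^sup>2)"
    using assms by (simp only: real_sqrt_mult[symmetric]) (simp add: power2_eq_square)
  also have "\<dots> = 2 * pi" by (simp only: real_sqrt_abs) simp
  finally show ?thesis .
qed


text \<open>Expanding the square gives a double integral of F(x) times the conjugate of F(y), in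
  which the \<open>z\<close>-integral of the weighted phase is the Gaussian kernel \<open>g\<close>
  at \<open>\<Theta> x - \<Theta> y\<close>. Schur's test for this symmetric kernel needs a bound on
  its integral over one variable, and \<open>push\<close> transfers that bound from Lebesgue measure
  to \<mu>.\<close>

lemma fourier_extension_gaussian:
  fixes \<Theta> :: "'x \<Rightarrow> 'a::euclidean_space" and F :: "'x \<Rightarrow> complex"
  assumes sf: "sigma_finite_measure \<mu>" and [measurable]: "\<Theta> \<in> borel_measurable \<mu>" "S \<in> sets \<mu>"
    and F: "integrable \<mu> F" and supp: "\<And>x. x \<notin> S \<Longrightarrow> F x = 0"
    and push: "\<And>\<phi>. \<phi> \<in> borel_measurable borel \<Longrightarrow>
      (\<integral>\<^sup>+x. \<phi> (\<Theta> x) * indicator S x \<partial>\<mu>) \<le> C * (\<integral>\<^sup>+y. \<phi> y \<partial>lborel)"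
    and \<epsilon>: "\<epsilon> > (0::real)"
  shows "(\<integral>\<^sup>+z. ennreal ((cmod (\<integral>x. F x * iexp (z \<bullet> \<Theta> x) \<partial>\<mu>))\<^sup>2 * exp (- \<epsilon> * (norm z)\<^sup>2 / 2)) \<partial>lborel)
    \<le> ennreal ((2 * pi) ^ DIM('a)) * C * (\<integral>\<^sup>+x. ennreal ((cmod (F x))\<^sup>2) \<partial>\<mu>)"
proof -
  let ?P = "\<mu> \<Otimes>\<^sub>M \<mu>"
  interpret \<mu>: sigma_finite_measure \<mu> by fact
  interpret PM: pair_sigma_finite \<mu> \<mu> ..
  interpret P: sigma_finite_measure ?P by (rule PM.sigma_finite_measure_axioms)
  interpret L: sigma_finite_measure "lborel :: 'a measure" ..
  interpret Q: pair_sigma_finite "lborel :: 'a measure" ?P ..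
  have [measurable]: "F \<in> borel_measurable \<mu>" using F by auto
  define E where "E = (\<lambda>z. \<integral>x. F x * iexp (z \<bullet> \<Theta> x) \<partial>\<mu>)"
  define H where "H = (\<lambda>p. F (fst p) * cnj (F (snd p)))"
  define D where "D = (\<lambda>p. \<Theta> (fst p) - \<Theta> (snd p))"
  define w where "w = (\<lambda>z::'a. exp (- \<epsilon> * (norm z)\<^sup>2 / 2))"
  define g where "g = (\<lambda>y::'a. sqrt (2 * pi / \<epsilon>) ^ DIM('a) * exp (- (norm y)\<^sup>2 / (2 * \<epsilon>)))"
  have g0: "g y \<ge> 0" for y using \<epsilon> by (simp add: g_def)
  have [measurable]: "g \<in> borel_measurable borel" "w \<in> borel_measurable borel" by (simp_all add: g_def w_def)
  have [measurable]: "cnj \<in> borel_measurable borel"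
    by (intro borel_measurable_continuous_onI continuous_intros)
  have [measurable]: "H \<in> borel_measurable ?P" "D \<in> borel_measurable ?P"
    unfolding H_def D_def by measurable
  have cF: "integrable \<mu> (\<lambda>x. cmod (F x))" using F by auto
  have prodint: "integrable ?P (\<lambda>p. G (fst p) * cnj (G (snd p)))" if G: "integrable \<mu> G" for G :: "'x \<Rightarrow> complex"
  proof (rule PM.Fubini_integrable)
    have [measurable]: "G \<in> borel_measurable \<mu>" using G by auto
    show "(\<lambda>p. G (fst p) * cnj (G (snd p))) \<in> borel_measurable ?P" by measurable
    show "integrable \<mu> (\<lambda>x. \<integral>y. cmod (G (fst (x, y)) * cnj (G (snd (x, y)))) \<partial>\<mu>)"
      using G by (simp add: norm_mult)
    show "AE x in \<mu>. integrable \<mu> (\<lambda>y. G (fst (x, y)) * cnj (G (snd (x, y))))"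
      using G by simp
  qed
  have Hint: "integrable ?P H"
    unfolding H_def by (rule prodint[OF F])
  have Emult: "complex_of_real ((cmod (E z))\<^sup>2) = (\<integral>p. H p * iexp (z \<bullet> D p) \<partial>?P)" for z
  proof -
    define G where "G = (\<lambda>x. F x * iexp (z \<bullet> \<Theta> x))"
    have G: "integrable \<mu> G"
      unfolding G_def by (rule Bochner_Integration.integrable_bound[OF F]) (auto simp: norm_mult)
    have "complex_of_real ((cmod (E z))\<^sup>2) = integral\<^sup>L \<mu> G * cnj (integral\<^sup>L \<mu> G)"
      unfolding E_def G_def by (rule complex_norm_square)
    also have "\<dots> = (\<integral>x. \<integral>y. G (fst (x, y)) * cnj (G (snd (x, y))) \<partial>\<mu> \<partial>\<mu>)"
      using G by simp
    also have "\<dots> = (\<integral>p. G (fst p) * cnj (G (snd p)) \<partial>?P)"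
      by (rule PM.integral_fst'[OF prodint[OF G]])
    also have "\<dots> = (\<integral>p. H p * iexp (z \<bullet> D p) \<partial>?P)"
      by (intro Bochner_Integration.integral_cong refl)
         (simp add: G_def H_def D_def inner_diff_right exp_diff exp_cnj exp_minus field_simps)
    finally show ?thesis .
  qed
  \<comment> \<open>Here the weight is indispensable: the product of \<open>H\<close> and the phase
    has modulus independent of \<open>z\<close>, so without \<open>w\<close> Fubini would not
    apply.\<close>
  have Q: "integrable (lborel \<Otimes>\<^sub>M ?P) (\<lambda>(z, p). H p * iexp (z \<bullet> D p) * complex_of_real (w z))"
  proof (rule Q.Fubini_integrable)
    have wi: "integrable lborel w"
      using integrable_norm[OF integrable_iexp_gaussian_euclidean[OF \<epsilon>, of "0::'a"]] by (simp add: w_def)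
    show "(\<lambda>(z, p). H p * iexp (z \<bullet> D p) * complex_of_real (w z)) \<in> borel_measurable (lborel \<Otimes>\<^sub>M ?P)"
      by measurable
    have "(\<integral>p. cmod (case (z, p) of (z, p) \<Rightarrow> H p * iexp (z \<bullet> D p) * complex_of_real (w z)) \<partial>?P)
      = (\<integral>p. cmod (H p) \<partial>?P) * w z" for z
      by (simp add: norm_mult w_def)
    then show "integrable lborel (\<lambda>z. \<integral>p. cmod (case (z, p) of (z, p) \<Rightarrow> H p * iexp (z \<bullet> D p) * complex_of_real (w z)) \<partial>?P)"
      using wi by simp
    show "AE z in lborel. integrable ?P (\<lambda>p. case (z, p) of (z, p) \<Rightarrow> H p * iexp (z \<bullet> D p) * complex_of_real (w z))"
    proof (intro AE_I2)
      fix z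
      have "integrable ?P (\<lambda>p. H p * iexp (z \<bullet> D p))"
        by (rule Bochner_Integration.integrable_bound[OF Hint]) (auto simp: norm_mult)
      then show "integrable ?P (\<lambda>p. case (z, p) of (z, p) \<Rightarrow> H p * iexp (z \<bullet> D p) * complex_of_real (w z))"
        by simp
    qed
  qed
  define I where "I = (\<integral>z. (cmod (E z))\<^sup>2 * w z \<partial>lborel)"
  have fstQ: "(\<integral>p. H p * iexp (z \<bullet> D p) * complex_of_real (w z) \<partial>?P) = complex_of_real ((cmod (E z))\<^sup>2 * w z)" for z
    by (simp add: Emult[symmetric])
  have Iint: "integrable lborel (\<lambda>z. (cmod (E z))\<^sup>2 * w z)"
    using Q.integrable_fst[OF Q] unfolding fstQ complex_of_real_integrable_eq .
  have "complex_of_real I = (\<integral>z. complex_of_real ((cmod (E z))\<^sup>2 * w z) \<partial>lborel)"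
    unfolding I_def by (simp only: integral_complex_of_real)
  also have "\<dots> = (\<integral>z. \<integral>p. H p * iexp (z \<bullet> D p) * complex_of_real (w z) \<partial>?P \<partial>lborel)"
    unfolding fstQ ..
  also have "\<dots> = (\<integral>p. \<integral>z. H p * iexp (z \<bullet> D p) * complex_of_real (w z) \<partial>lborel \<partial>?P)"
    by (rule Q.Fubini_integral[OF Q, symmetric])
  also have "\<dots> = (\<integral>p. H p * complex_of_real (g (D p)) \<partial>?P)"
    using integral_iexp_gaussian_euclidean[OF \<epsilon>, where 'a = 'a] by (simp add: mult.assoc w_def g_def del: of_real_power)
  finally have "ennreal I \<le> (\<integral>\<^sup>+p. ennreal (cmod (H p * complex_of_real (g (D p)))) \<partial>?P)"
  proof -
    assume e: "complex_of_real I = (\<integral>p. H p * complex_of_real (g (D p)) \<partial>?P)"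
    have "I \<ge> 0" unfolding I_def by (simp add: w_def)
    then have "ennreal I = ennreal (cmod (\<integral>p. H p * complex_of_real (g (D p)) \<partial>?P))"
      by (simp flip: e)
    also have "\<dots> \<le> (\<integral>\<^sup>+p. ennreal (cmod (H p * complex_of_real (g (D p)))) \<partial>?P)"
      \<comment> \<open>If the integrand is not integrable, its Bochner integral is 0 and the bound
        is trivial.\<close>
      by (cases "integrable ?P (\<lambda>p. H p * complex_of_real (g (D p)))")
         (auto simp: integral_norm_bound_ennreal not_integrable_integral_eq)
    finally show ?thesis .
  qed
  also have "\<dots> = (\<integral>\<^sup>+x. \<integral>\<^sup>+y. ennreal (cmod (F x) * cmod (F y) * g (\<Theta> x - \<Theta> y)) \<partial>\<mu> \<partial>\<mu>)"
    by (subst \<mu>.nn_integral_fst[symmetric]) (auto simp: H_def D_def norm_mult g0)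
  \<comment> \<open>The inequality 2ab <= a^2 + b^2 separates the two copies of \<open>F\<close>. In
    each term the indicator of \<open>S\<close> is kept on the variable that will be integrated
    against the kernel, since \<open>push\<close> speaks about \<open>S\<close> alone.\<close>
  also have "\<dots> \<le> (\<integral>\<^sup>+x. \<integral>\<^sup>+y. ennreal ((cmod (F x))\<^sup>2 / 2) * (ennreal (g (\<Theta> x - \<Theta> y)) * indicator S y)
      + ennreal ((cmod (F y))\<^sup>2 / 2) * (ennreal (g (\<Theta> y - \<Theta> x)) * indicator S x) \<partial>\<mu> \<partial>\<mu>)"
  proof (intro nn_integral_mono)
    fix x y
    show "ennreal (cmod (F x) * cmod (F y) * g (\<Theta> x - \<Theta> y)) \<le> ennreal ((cmod (F x))\<^sup>2 / 2) * (ennreal (g (\<Theta> x - \<Theta> y)) * indicator S y)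
      + ennreal ((cmod (F y))\<^sup>2 / 2) * (ennreal (g (\<Theta> y - \<Theta> x)) * indicator S x)"
    proof (cases "x \<in> S \<and> y \<in> S")
      case True
      have gg: "g (\<Theta> y - \<Theta> x) = g (\<Theta> x - \<Theta> y)" by (simp add: g_def norm_minus_commute)
      have "2 * (cmod (F x) * cmod (F y)) \<le> (cmod (F x))\<^sup>2 + (cmod (F y))\<^sup>2"
        using sum_squares_bound[of "cmod (F x)" "cmod (F y)"] by simp
      then have "cmod (F x) * cmod (F y) * g (\<Theta> x - \<Theta> y) \<le> ((cmod (F x))\<^sup>2 / 2 + (cmod (F y))\<^sup>2 / 2) * g (\<Theta> x - \<Theta> y)"
        by (intro mult_right_mono g0) simp
      then show ?thesis using True
        by (simp add: gg g0 ennreal_mult'[symmetric] ennreal_plus[symmetric] distrib_right del: ennreal_plus)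
    qed (use supp in auto)
  qed
  also have "\<dots> = (\<integral>\<^sup>+x. \<integral>\<^sup>+y. ennreal ((cmod (F x))\<^sup>2 / 2) * (ennreal (g (\<Theta> x - \<Theta> y)) * indicator S y) \<partial>\<mu> \<partial>\<mu>)
     + (\<integral>\<^sup>+x. \<integral>\<^sup>+y. ennreal ((cmod (F y))\<^sup>2 / 2) * (ennreal (g (\<Theta> y - \<Theta> x)) * indicator S x) \<partial>\<mu> \<partial>\<mu>)"
    by (simp add: nn_integral_add)
  also have "(\<integral>\<^sup>+x. \<integral>\<^sup>+y. ennreal ((cmod (F y))\<^sup>2 / 2) * (ennreal (g (\<Theta> y - \<Theta> x)) * indicator S x) \<partial>\<mu> \<partial>\<mu>)
     = (\<integral>\<^sup>+x. \<integral>\<^sup>+y. ennreal ((cmod (F x))\<^sup>2 / 2) * (ennreal (g (\<Theta> x - \<Theta> y)) * indicator S y) \<partial>\<mu> \<partial>\<mu>)"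
    by (rule PM.Fubini') measurable
  also have "(\<integral>\<^sup>+x. \<integral>\<^sup>+y. ennreal ((cmod (F x))\<^sup>2 / 2) * (ennreal (g (\<Theta> x - \<Theta> y)) * indicator S y) \<partial>\<mu> \<partial>\<mu>)
     = (\<integral>\<^sup>+x. ennreal ((cmod (F x))\<^sup>2 / 2) * (\<integral>\<^sup>+y. (ennreal (g (\<Theta> x - \<Theta> y)) * indicator S y) \<partial>\<mu>) \<partial>\<mu>)"
    by (intro nn_integral_cong nn_integral_cmult) measurable
  \<comment> \<open>\<open>push\<close> is applied to the translated and reflected kernel, whose
    Lebesgue mass is (2 pi)^d for every centre.\<close>
  also have "\<dots> \<le> (\<integral>\<^sup>+x. ennreal ((cmod (F x))\<^sup>2 / 2) * (C * ennreal ((2 * pi) ^ DIM('a))) \<partial>\<mu>)"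
  proof (intro nn_integral_mono mult_left_mono)
    fix x
    have "(\<integral>\<^sup>+y. ennreal (g (\<Theta> x - \<Theta> y)) * indicator S y \<partial>\<mu>) \<le> C * (\<integral>\<^sup>+y. ennreal (g (\<Theta> x - y)) \<partial>lborel)"
      by (rule push) measurable
    then show "(\<integral>\<^sup>+y. ennreal (g (\<Theta> x - \<Theta> y)) * indicator S y \<partial>\<mu>) \<le> C * ennreal ((2 * pi) ^ DIM('a))"
      unfolding g_def nn_integral_gaussian_euclidean[OF \<epsilon>] .
  qed auto
  also have "\<dots> = (\<integral>\<^sup>+x. ennreal ((cmod (F x))\<^sup>2 / 2) \<partial>\<mu>) * (C * ennreal ((2 * pi) ^ DIM('a)))"
    by (rule nn_integral_multc) measurable
  finally have "ennreal I \<le> (\<integral>\<^sup>+x. ennreal ((cmod (F x))\<^sup>2 / 2) \<partial>\<mu>) * (C * ennreal ((2 * pi) ^ DIM('a)))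
     + (\<integral>\<^sup>+x. ennreal ((cmod (F x))\<^sup>2 / 2) \<partial>\<mu>) * (C * ennreal ((2 * pi) ^ DIM('a)))"
    by (meson add_mono order_trans)
  also have "\<dots> = ((\<integral>\<^sup>+x. ennreal ((cmod (F x))\<^sup>2 / 2) \<partial>\<mu>) + (\<integral>\<^sup>+x. ennreal ((cmod (F x))\<^sup>2 / 2) \<partial>\<mu>)) * (C * ennreal ((2 * pi) ^ DIM('a)))"
    by (simp add: distrib_right)
  also have "(\<integral>\<^sup>+x. ennreal ((cmod (F x))\<^sup>2 / 2) \<partial>\<mu>) + (\<integral>\<^sup>+x. ennreal ((cmod (F x))\<^sup>2 / 2) \<partial>\<mu>) = (\<integral>\<^sup>+x. ennreal ((cmod (F x))\<^sup>2) \<partial>\<mu>)"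
    by (subst nn_integral_add[symmetric]) (auto simp: ennreal_plus[symmetric] simp del: ennreal_plus)
  finally have "ennreal I \<le> ennreal ((2 * pi) ^ DIM('a)) * C * (\<integral>\<^sup>+x. ennreal ((cmod (F x))\<^sup>2) \<partial>\<mu>)"
    by (simp add: mult_ac)
  moreover have "(\<integral>\<^sup>+z. ennreal ((cmod (E z))\<^sup>2 * w z) \<partial>lborel) = ennreal I"
    unfolding I_def by (rule nn_integral_eq_integral[OF Iint]) (simp add: w_def)
  ultimately show ?thesis unfolding E_def w_def by simp
qed

text \<open>The weighted bound has a constant free of \<epsilon>, so Fatou's lemma along \<epsilon>
  = 1 / (n + 1) removes the weight.\<close>

theorem fourier_extension_L2:
  fixes \<Theta> :: "'x \<Rightarrow> 'a::euclidean_space" and F :: "'x \<Rightarrow> complex"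
  assumes sf: "sigma_finite_measure \<mu>" and [measurable]: "\<Theta> \<in> borel_measurable \<mu>" "S \<in> sets \<mu>"
    and F: "integrable \<mu> F" and supp: "\<And>x. x \<notin> S \<Longrightarrow> F x = 0"
    and push: "\<And>\<phi>. \<phi> \<in> borel_measurable borel \<Longrightarrow>
      (\<integral>\<^sup>+x. \<phi> (\<Theta> x) * indicator S x \<partial>\<mu>) \<le> C * (\<integral>\<^sup>+y. \<phi> y \<partial>lborel)"
  shows "(\<integral>\<^sup>+z. ennreal ((cmod (\<integral>x. F x * iexp (z \<bullet> \<Theta> x) \<partial>\<mu>))\<^sup>2) \<partial>lborel)
    \<le> ennreal ((2 * pi) ^ DIM('a)) * C * (\<integral>\<^sup>+x. ennreal ((cmod (F x))\<^sup>2) \<partial>\<mu>)" (is "_ \<le> ?K")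
proof -
  interpret \<mu>: sigma_finite_measure \<mu> by fact
  have [measurable]: "F \<in> borel_measurable \<mu>" using F by auto
  define E where "E = (\<lambda>z. \<integral>x. F x * iexp (z \<bullet> \<Theta> x) \<partial>\<mu>)"
  have [measurable]: "E \<in> borel_measurable borel" unfolding E_def by measurable
  define u where "u = (\<lambda>(n::nat) z::'a. ennreal ((cmod (E z))\<^sup>2 * exp (- (1 / real (Suc n)) * (norm z)\<^sup>2 / 2)))"
  have lim: "(\<lambda>n. u n z) \<longlonglongrightarrow> ennreal ((cmod (E z))\<^sup>2)" for z
  proof -
    have "(\<lambda>n. (cmod (E z))\<^sup>2 * exp (- (1 / real (Suc n)) * (norm z)\<^sup>2 / 2)) \<longlonglongrightarrow> (cmod (E z))\<^sup>2 * exp (- 0 * (norm z)\<^sup>2 / 2)"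
      by (intro tendsto_intros LIMSEQ_Suc[OF lim_1_over_n]) auto
    then show ?thesis unfolding u_def by (intro tendsto_ennrealI) simp
  qed
  have "(\<integral>\<^sup>+z. ennreal ((cmod (E z))\<^sup>2) \<partial>lborel) = (\<integral>\<^sup>+z. liminf (\<lambda>n. u n z) \<partial>lborel)"
    by (intro nn_integral_cong) (simp add: lim_imp_Liminf[OF _ lim])
  also have "\<dots> \<le> liminf (\<lambda>n. \<integral>\<^sup>+z. u n z \<partial>lborel)"
    by (rule nn_integral_liminf) (simp add: u_def)
  also have "\<dots> \<le> ?K"
  proof (rule order_trans[OF Liminf_mono[of _ "\<lambda>_. ?K"]])
    show "\<forall>\<^sub>F n in sequentially. (\<integral>\<^sup>+z. u n z \<partial>lborel) \<le> ?K"
      unfolding u_def E_def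
      by (intro always_eventually allI fourier_extension_gaussian[OF assms]) auto
  qed (simp add: Liminf_const)
  finally show ?thesis unfolding E_def .
qed

subsection \<open>Radial integration\<close>

text \<open>Uniqueness of Haar measure up to a constant, which is read off from the unit ball.\<close>

lemma distr_lborel_orthogonal:
  fixes T :: "'a::euclidean_space \<Rightarrow> 'a"
  assumes T: "orthogonal_transformation T"
  shows "distr lborel borel T = lborel"
proof -
  have lin: "linear T" using T by (simp add: orthogonal_transformation)
  then have [measurable]: "T \<in> borel_measurable borel"
    by (intro borel_measurable_continuous_onI linear_continuous_on linear_conv_bounded_linear[THEN iffD1])
  define \<mu> where "\<mu> = distr lborel borel T"
  have [measurable_cong, simp]: "sets \<mu> = sets borel" and [simp]: "space \<mu> = UNIV" by (simp_all add: \<mu>_def)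
  define S where "S = inv T"
  have S: "orthogonal_transformation S" unfolding S_def by (rule orthogonal_transformation_inv[OF T])
  have TS: "T (S x) = x" for x
    unfolding S_def using orthogonal_transformation_surj[OF T] by (simp add: surj_f_inv_f)
  have \<mu>_ball: "emeasure \<mu> (ball 0 1) = emeasure lborel (ball (0::'a) 1)"
  proof -
    have "T -` ball 0 1 = ball 0 1"
      using orthogonal_transformation_norm[OF T] by auto
    then show ?thesis by (simp add: \<mu>_def emeasure_distr)
  qed
  have \<mu>_trans: "(\<integral>\<^sup>+x. f (a + x) \<partial>\<mu>) = (\<integral>\<^sup>+x. f x \<partial>\<mu>)" if [measurable]: "f \<in> borel_measurable borel"
    for f :: "'a \<Rightarrow> ennreal" and a
  proof -
    have "(\<integral>\<^sup>+x. f (a + x) \<partial>\<mu>) = (\<integral>\<^sup>+x. f (T (S a + x)) \<partial>lborel)"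
      by (simp add: \<mu>_def nn_integral_distr linear_add[OF lin] TS)
    also have "\<dots> = (\<integral>\<^sup>+x. f (T x) \<partial>lborel)"
      by (rule nn_integral_lborel_translate) simp
    finally show ?thesis by (simp add: \<mu>_def nn_integral_distr)
  qed
  interpret \<mu>: sigma_finite_measure \<mu>
  proof
    show "\<exists>A. countable A \<and> A \<subseteq> sets \<mu> \<and> \<Union> A = space \<mu> \<and> (\<forall>a\<in>A. emeasure \<mu> a \<noteq> \<infinity>)"
    proof (intro exI[of _ "range (\<lambda>n::nat. ball 0 (real n))"] conjI ballI)
      show "\<Union> (range (\<lambda>n::nat. ball 0 (real n))) = space \<mu>"
        using reals_Archimedean2 by auto
      fix a assume "a \<in> range (\<lambda>n::nat. ball (0::'a) (real n))"
      then obtain n where a: "a = ball 0 (real n)" by auto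
      have "T -` ball 0 (real n) = ball 0 (real n)"
        using orthogonal_transformation_norm[OF T] by auto
      then show "emeasure \<mu> a \<noteq> \<infinity>" using emeasure_lborel_ball_finite[of "0::'a" "real n"]
        by (simp add: a \<mu>_def emeasure_distr)
    qed auto
  qed
  interpret P: pair_sigma_finite lborel \<mu> ..
  have "emeasure \<mu> A = emeasure lborel A" if [measurable]: "A \<in> sets borel" for A
  proof -
    define B where "B = ball (0::'a) 1"
    have [measurable]: "B \<in> sets borel" by (simp add: B_def)
    \<comment> \<open>The double integral of 1_A(y + x) 1_B(y) over lborel and \<mu> is evaluated in
      both orders, using the translation invariance of each measure and B = -B. One order gives
      \<mu>(A) |B|, the other |A| \<mu>(B), and \<mu>(B) = |B| because \<open>T\<close> preserves
      the ball.\<close>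
    have "emeasure \<mu> A * emeasure lborel B = (\<integral>\<^sup>+y. (\<integral>\<^sup>+x. indicator A x \<partial>\<mu>) * indicator B y \<partial>lborel)"
      by (simp add: nn_integral_cmult_indicator)
    also have "\<dots> = (\<integral>\<^sup>+y. (\<integral>\<^sup>+x. indicator A (y + x) * indicator B y \<partial>\<mu>) \<partial>lborel)"
      by (intro nn_integral_cong, subst nn_integral_multc) (auto simp: \<mu>_trans[of "indicator A"])
    also have "\<dots> = (\<integral>\<^sup>+x. (\<integral>\<^sup>+y. indicator A (y + x) * indicator B y \<partial>lborel) \<partial>\<mu>)"
      by (rule P.Fubini'[symmetric]) measurable
    also have "\<dots> = (\<integral>\<^sup>+x. (\<integral>\<^sup>+y. indicator A y * indicator B (y - x) \<partial>lborel) \<partial>\<mu>)"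
    proof (rule nn_integral_cong)
      fix x
      show "(\<integral>\<^sup>+y. indicator A (y + x) * indicator B y \<partial>lborel) = (\<integral>\<^sup>+y. indicator A y * indicator B (y - x) \<partial>lborel)"
        using nn_integral_lborel_translate[of "\<lambda>y. indicator A y * indicator B (y - x)" x] by (simp add: add.commute)
    qed
    also have "\<dots> = (\<integral>\<^sup>+y. (\<integral>\<^sup>+x. indicator A y * indicator B (y - x) \<partial>\<mu>) \<partial>lborel)"
      by (rule P.Fubini') measurable
    also have "\<dots> = (\<integral>\<^sup>+y. indicator A y * (\<integral>\<^sup>+x. indicator B (- y + x) \<partial>\<mu>) \<partial>lborel)"
      by (intro nn_integral_cong, subst nn_integral_cmult)
         (auto simp: B_def indicator_def norm_minus_commute intro!: arg_cong[where f = "\<lambda>z. _ * z"] nn_integral_cong)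
    also have "\<dots> = (\<integral>\<^sup>+y. indicator A y * emeasure lborel B \<partial>lborel)"
      by (subst \<mu>_trans) (use \<mu>_ball in \<open>simp_all add: B_def[symmetric]\<close>)
    also have "\<dots> = emeasure lborel A * emeasure lborel B"
      by (simp add: nn_integral_multc)
    finally have "emeasure lborel B * emeasure \<mu> A = emeasure lborel B * emeasure lborel A" by (simp add: mult.commute)
    moreover have "emeasure lborel B \<noteq> 0" "emeasure lborel B \<noteq> top"
      using emeasure_lborel_ball_finite[of "0::'a" 1] by (auto simp: emeasure_ball B_def dest!: unit_ball_vol_pos[of "real DIM('a)", THEN less_imp_neq, THEN not_sym, THEN notE, rotated])
    ultimately show ?thesis by (simp add: ennreal_mult_cancel_left)
  qed
  then show ?thesis unfolding \<mu>_def[symmetric] by (intro measure_eqI) auto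
qed

text \<open>It suffices to compare the two measures on the half-lines up to R. The condition sqrt
  (a^2 + |\<eta>|^2) <= R describes the ball of radius sqrt (R^2 - a^2), whose volume, as a function
  of R, is a primitive of the stated weight. The offset \<open>a\<close> will be the coordinate
  along a fixed axis.\<close>

lemma distr_norm_offset_PiM:
  fixes A :: "'i set" and a :: real
  assumes A: "finite A" "A \<noteq> {}"
  defines "m \<equiv> card A"
  shows "distr (\<Pi>\<^sub>M i\<in>A. lborel) borel (\<lambda>\<eta>. sqrt (a\<^sup>2 + (\<Sum>i\<in>A. (\<eta> i)\<^sup>2))) =
    density lborel (\<lambda>s. ennreal (unit_ball_vol m * m * s * (s\<^sup>2 - a\<^sup>2) powr (m / 2 - 1)) * indicator {\<bar>a\<bar><..} s)"
    (is "?N = density lborel ?w")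
proof -
  let ?n = "\<lambda>\<eta>. sqrt (a\<^sup>2 + (\<Sum>i\<in>A. (\<eta> i)\<^sup>2))"
  interpret product_sigma_finite "\<lambda>b::'i. lborel :: real measure" by standard
  have m: "m > 0" using A by (simp add: m_def card_gt_0_iff)
  define V where "V = unit_ball_vol (real m)"
  have V: "V \<ge> 0" unfolding V_def by simp
  have g[measurable]: "?n \<in> (\<Pi>\<^sub>M i\<in>A. lborel) \<rightarrow>\<^sub>M borel" by measurable
  have N: "emeasure ?N {..R} = (if \<bar>a\<bar> < R then ennreal (V * (R\<^sup>2 - a\<^sup>2) powr (m / 2)) else 0)" for R
  proof (cases "\<bar>a\<bar> < R")
    case True
    define r where "r = sqrt (R\<^sup>2 - a\<^sup>2)"
    have aR: "a\<^sup>2 < R\<^sup>2" using True using power_strict_mono[of "\<bar>a\<bar>" R 2] by simp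
    then have r: "r > 0" "r\<^sup>2 = R\<^sup>2 - a\<^sup>2" by (auto simp: r_def)
    have R: "R > 0" using True by linarith
    have "?n -` {..R} = {f. sqrt (\<Sum>i\<in>A. (f i)\<^sup>2) \<le> r}"
    proof -
      have "sqrt (a\<^sup>2 + S) \<le> R \<longleftrightarrow> sqrt S \<le> r" for S
      proof -
        have "sqrt (a\<^sup>2 + S) \<le> R \<longleftrightarrow> a\<^sup>2 + S \<le> R\<^sup>2"
          using R real_sqrt_le_iff[of "a\<^sup>2 + S" "R\<^sup>2"] by simp
        also have "\<dots> \<longleftrightarrow> S \<le> r\<^sup>2" using r by linarith
        also have "\<dots> \<longleftrightarrow> sqrt S \<le> r"
          using r(1) real_sqrt_le_iff[of S "r\<^sup>2"] by simp
        finally show ?thesis .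
      qed
      then show ?thesis by auto
    qed
    then have "emeasure ?N {..R} = ennreal (V * r ^ m)"
      using emeasure_cball_aux[OF A(1) r(1)] by (simp add: emeasure_distr V_def m_def)
    also have "r ^ m = (R\<^sup>2 - a\<^sup>2) powr (m / 2)"
      using r(1) aR by (simp add: r_def powr_half_sqrt[symmetric] powr_realpow[symmetric] powr_powr del: powr_half_sqrt)
    finally show ?thesis using True by simp
  next
    case False
    \<comment> \<open>For R <= |a| the sublevel set contains at most the origin, which is null since
      \<open>A\<close> is nonempty.\<close>
    have "?n -` {..R} \<inter> space (\<Pi>\<^sub>M i\<in>A. lborel) \<subseteq> (\<Pi>\<^sub>E i\<in>A. {0})"
    proof
      fix \<eta> assume \<eta>: "\<eta> \<in> ?n -` {..R} \<inter> space (\<Pi>\<^sub>M i\<in>A. lborel)"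
      then have "sqrt (a\<^sup>2 + (\<Sum>i\<in>A. (\<eta> i)\<^sup>2)) \<le> sqrt (a\<^sup>2)" using False by auto
      then have "(\<Sum>i\<in>A. (\<eta> i)\<^sup>2) \<le> 0" unfolding real_sqrt_le_iff by simp
      then have "(\<Sum>i\<in>A. (\<eta> i)\<^sup>2) = 0" by (meson order_antisym sum_nonneg zero_le_power2)
      then have "\<forall>i\<in>A. \<eta> i = 0" using A by (simp add: sum_nonneg_eq_0_iff)
      then show "\<eta> \<in> (\<Pi>\<^sub>E i\<in>A. {0})" using \<eta> by (auto simp: space_PiM PiE_def extensional_def fun_eq_iff)
    qed
    moreover have "emeasure (\<Pi>\<^sub>M i\<in>A. lborel) (\<Pi>\<^sub>E i\<in>A. {0::real}) = 0"
      using A by (subst emeasure_PiM) (auto simp: card_gt_0_iff)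
    moreover have "(\<Pi>\<^sub>E i\<in>A. {0::real}) \<in> sets (\<Pi>\<^sub>M i\<in>A. lborel)"
      using A by (intro sets_PiM_I_finite) auto
    ultimately show ?thesis using False
      by (simp add: emeasure_distr) (metis emeasure_mono le_zero_eq)
  qed
  have W: "emeasure (density lborel ?w) {..R} = (if \<bar>a\<bar> < R then ennreal (V * (R\<^sup>2 - a\<^sup>2) powr (m / 2)) else 0)" for R
  proof (cases "\<bar>a\<bar> < R")
    case True
    define G where "G = (\<lambda>s. V * (s\<^sup>2 - a\<^sup>2) powr (m / 2))"
    define g where "g = (\<lambda>s. V * m * s * (s\<^sup>2 - a\<^sup>2) powr (m / 2 - 1))"
    \<comment> \<open>For m = 1 the weight has the exponent -1/2 and blows up at |a|, so the
      fundamental theorem is used with differentiability in the open interval only.\<close>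
    have "(g has_integral (G R - G \<bar>a\<bar>)) {\<bar>a\<bar>..R}"
    proof (rule fundamental_theorem_of_calculus_interior)
      show "continuous_on {\<bar>a\<bar>..R} G" unfolding G_def
        by (intro continuous_intros continuous_on_powr') (use m in \<open>auto simp: abs_le_square_iff[symmetric]\<close>)
      fix s assume s: "s \<in> {\<bar>a\<bar><..<R}"
      then have "s\<^sup>2 - a\<^sup>2 > 0" using power_strict_mono[of "\<bar>a\<bar>" s 2] by simp
      then show "(G has_vector_derivative g s) (at s)"
        unfolding G_def g_def has_real_derivative_iff_has_vector_derivative[symmetric]
        by (auto intro!: derivative_eq_intros)
    qed (use True in simp)
    moreover have "G \<bar>a\<bar> = 0" by (simp add: G_def)
    ultimately have "(\<integral>\<^sup>+s. ennreal (g s) * indicator {\<bar>a\<bar>..R} s \<partial>lborel) = ennreal (G R)"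
      using V by (intro nn_integral_has_integral_lebesgue') (auto simp: g_def)
    moreover have "emeasure (density lborel ?w) {..R} = (\<integral>\<^sup>+s. ennreal (g s) * indicator {\<bar>a\<bar>..R} s \<partial>lborel)"
    proof (subst emeasure_density; (intro nn_integral_cong)?)
      \<comment> \<open>At s = |a| the indicator of the open half-line is 0, and \<open>g\<close> is
        0 as well because 0 powr x = 0.\<close>
      fix s show "?w s * indicator {..R} s = ennreal (g s) * indicator {\<bar>a\<bar>..R} s"
        by (cases "s = \<bar>a\<bar>") (auto simp: g_def V_def indicator_def)
    qed auto
    ultimately show ?thesis using True by (simp add: G_def)
  next
    case False
    then have "?w s * indicator {..R} s = 0" for s by (auto simp: indicator_def)
    then have "(\<integral>\<^sup>+s. ?w s * indicator {..R} s \<partial>lborel) = (\<integral>\<^sup>+s. 0 \<partial>(lborel :: real measure))"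
      by (simp only:)
    then show ?thesis using False by (subst emeasure_density) auto
  qed
  show ?thesis
  proof (rule measure_eqI_generator_eq[where \<Omega> = UNIV and E = "range atMost" and A = "\<lambda>n. {..real n}"])
    show "Int_stable (range (atMost :: real \<Rightarrow> _))"
      by (auto simp: Int_stable_def)
    show "sets ?N = sigma_sets UNIV (range atMost)" "sets (density lborel ?w) = sigma_sets UNIV (range atMost)"
      by (simp_all add: borel_eq_atMost)
    show "(\<Union>i. {..real i}) = UNIV" using real_arch_simple by auto
  qed (auto simp: N W)
qed

lemma nn_integral_norm_offset_PiM:
  fixes A :: "'i set" and a :: real
  assumes A: "finite A" "A \<noteq> {}" and [measurable]: "f \<in> borel_measurable borel"
  defines "m \<equiv> card A"
  shows "(\<integral>\<^sup>+\<eta>. f (sqrt (a\<^sup>2 + (\<Sum>i\<in>A. (\<eta> i)\<^sup>2))) \<partial>(\<Pi>\<^sub>M i\<in>A. lborel)) =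
    (\<integral>\<^sup>+s. f s * (ennreal (unit_ball_vol m * m * s * (s\<^sup>2 - a\<^sup>2) powr (m / 2 - 1)) * indicator {\<bar>a\<bar><..} s) \<partial>lborel)"
proof -
  have "(\<integral>\<^sup>+\<eta>. f (sqrt (a\<^sup>2 + (\<Sum>i\<in>A. (\<eta> i)\<^sup>2))) \<partial>(\<Pi>\<^sub>M i\<in>A. lborel)) =
     integral\<^sup>N (distr (\<Pi>\<^sub>M i\<in>A. lborel) borel (\<lambda>\<eta>. sqrt (a\<^sup>2 + (\<Sum>i\<in>A. (\<eta> i)\<^sup>2)))) f"
    by (subst nn_integral_distr) auto
  also have "\<dots> = (\<integral>\<^sup>+s. (ennreal (unit_ball_vol m * m * s * (s\<^sup>2 - a\<^sup>2) powr (m / 2 - 1)) * indicator {\<bar>a\<bar><..} s) * f s \<partial>lborel)"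
    unfolding m_def distr_norm_offset_PiM[OF A] by (rule nn_integral_density) measurable
  finally show ?thesis by (simp only: mult.commute)
qed

section \<open>Polar coordinates, and slicing along an axis\<close>

lemma power2_powr:
  fixes x y :: real
  shows "x > 0 \<Longrightarrow> (x\<^sup>2) powr y = x powr (2 * y)"
  using powr_powr[of x 2 y] by simp

lemma norm_PiM_embed:
  "norm (\<Sum>b\<in>Basis. \<eta> b *\<^sub>R (b::'a::euclidean_space)) = sqrt (\<Sum>b\<in>Basis. (\<eta> b)\<^sup>2)"
  unfolding norm_eq_sqrt_inner by (subst euclidean_inner) (intro arg_cong[where f = sqrt] sum.cong refl, simp add: power2_eq_square)

lemma nn_integral_lborel_PiM:
  fixes g :: "'a::euclidean_space \<Rightarrow> ennreal"
  assumes g: "g \<in> borel_measurable borel"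
  shows "(\<integral>\<^sup>+\<xi>. g \<xi> \<partial>lborel) = (\<integral>\<^sup>+\<eta>. g (\<Sum>b\<in>Basis. \<eta> b *\<^sub>R b) \<partial>(\<Pi>\<^sub>M b\<in>(Basis::'a set). lborel))"
proof -
  have T: "(\<lambda>\<eta>. \<Sum>b\<in>Basis. \<eta> b *\<^sub>R b) \<in> (\<Pi>\<^sub>M b\<in>(Basis::'a set). lborel) \<rightarrow>\<^sub>M (borel :: 'a measure)"
    by measurable
  show ?thesis using g by (subst lborel_eq, subst nn_integral_distr[OF T]) simp_all
qed

lemma nn_integral_polar:
  fixes f :: "real \<Rightarrow> ennreal"
  assumes [measurable]: "f \<in> borel_measurable borel"
  shows "(\<integral>\<^sup>+\<xi>. f (norm \<xi>) \<partial>(lborel :: 'a::euclidean_space measure)) =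
    (\<integral>\<^sup>+s. f s * (ennreal (unit_ball_vol DIM('a) * DIM('a) * s ^ (DIM('a) - 1)) * indicator {0<..} s) \<partial>lborel)"
proof -
  have "(\<integral>\<^sup>+\<xi>. f (norm \<xi>) \<partial>(lborel :: 'a measure)) = (\<integral>\<^sup>+\<eta>. f (sqrt (0\<^sup>2 + (\<Sum>b\<in>(Basis::'a set). (\<eta> b)\<^sup>2))) \<partial>(\<Pi>\<^sub>M b\<in>(Basis::'a set). lborel))"
    by (subst nn_integral_lborel_PiM) (simp_all add: norm_PiM_embed)
  also have "\<dots> = (\<integral>\<^sup>+s. f s * (ennreal (unit_ball_vol DIM('a) * DIM('a) * s * (s\<^sup>2 - 0\<^sup>2) powr (DIM('a) / 2 - 1)) * indicator {\<bar>0\<bar><..} s) \<partial>lborel)"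
    by (rule nn_integral_norm_offset_PiM) auto
  also have "\<dots> = (\<integral>\<^sup>+s. f s * (ennreal (unit_ball_vol DIM('a) * DIM('a) * s ^ (DIM('a) - 1)) * indicator {0<..} s) \<partial>lborel)"
  proof (intro nn_integral_cong)
    fix s :: real
    have "s * (s\<^sup>2) powr (DIM('a) / 2 - 1) = s ^ (DIM('a) - 1)" if "s > 0"
    proof -
      have "(s\<^sup>2) powr (DIM('a) / 2 - 1) = s powr (real DIM('a) - 2)"
        using power2_powr[OF that, of "DIM('a) / 2 - 1"] by (simp add: algebra_simps)
      then have "s * (s\<^sup>2) powr (DIM('a) / 2 - 1) = s powr (real (DIM('a) - 1))"
        using that by (simp add: powr_mult_base DIM_positive of_nat_diff Suc_leI)
      then show ?thesis using powr_realpow[OF that] by metis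
    qed
    then show "f s * (ennreal (unit_ball_vol DIM('a) * DIM('a) * s * (s\<^sup>2 - 0\<^sup>2) powr (DIM('a) / 2 - 1)) * indicator {\<bar>0\<bar><..} s)
      = f s * (ennreal (unit_ball_vol DIM('a) * DIM('a) * s ^ (DIM('a) - 1)) * indicator {0<..} s)"
      by (auto simp: indicator_def mult.assoc)
  qed
  finally show ?thesis .
qed

text \<open>Once the coordinate u along \<open>e\<close> is split off, the norm is sqrt (u^2 + ...)
  with m coordinates remaining, so the offset formula applies with a = u.\<close>

lemma nn_integral_slice:
  fixes f :: "real \<times> real \<Rightarrow> ennreal" and e :: "'a::euclidean_space"
  assumes [measurable]: "f \<in> borel_measurable borel" and e: "e \<in> Basis" and d: "DIM('a) = Suc m" "m > 0"
  shows "(\<integral>\<^sup>+\<xi>. f (\<xi> \<bullet> e, norm \<xi>) \<partial>lborel) =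
    (\<integral>\<^sup>+u. \<integral>\<^sup>+s. f (u, s) * (ennreal (unit_ball_vol m * m * s * (s\<^sup>2 - u\<^sup>2) powr (m / 2 - 1)) * indicator {\<bar>u\<bar><..} s) \<partial>lborel \<partial>lborel)"
proof -
  interpret product_sigma_finite "\<lambda>b::'a. lborel :: real measure" by standard
  define A where "A = Basis - {e}"
  have A: "finite A" "e \<notin> A" "Basis = insert e A" using e by (auto simp: A_def)
  have cA: "card A = m" using d e by (simp add: A_def card_Diff_singleton)
  have An: "A \<noteq> {}" using cA d by auto
  have "(\<integral>\<^sup>+\<xi>. f (\<xi> \<bullet> e, norm \<xi>) \<partial>lborel) =
     (\<integral>\<^sup>+\<eta>. f (\<eta> e, sqrt (\<Sum>b\<in>(Basis::'a set). (\<eta> b)\<^sup>2)) \<partial>(\<Pi>\<^sub>M b\<in>(Basis::'a set). lborel))"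
    using e by (subst nn_integral_lborel_PiM) (simp_all add: norm_PiM_embed)
  also have "\<dots> = (\<integral>\<^sup>+u. \<integral>\<^sup>+\<eta>. f (u, sqrt (u\<^sup>2 + (\<Sum>b\<in>A. (\<eta> b)\<^sup>2))) \<partial>(\<Pi>\<^sub>M b\<in>A. lborel) \<partial>lborel)"
    unfolding A(3)
  proof (subst product_nn_integral_insert_rev[OF A(1,2)])
    show "(\<lambda>\<eta>. f (\<eta> e, sqrt (\<Sum>b\<in>insert e A. (\<eta> b)\<^sup>2))) \<in> borel_measurable (\<Pi>\<^sub>M b\<in>insert e A. lborel)"
      by measurable
    have "(\<Sum>b\<in>A. ((\<eta>(e := u)) b)\<^sup>2) = (\<Sum>b\<in>A. (\<eta> b)\<^sup>2)" for \<eta> :: "'a \<Rightarrow> real" and u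
      using A(2) by (intro sum.cong) auto
    then show "(\<integral>\<^sup>+u. \<integral>\<^sup>+\<eta>. f ((\<eta>(e := u)) e, sqrt (\<Sum>b\<in>insert e A. ((\<eta>(e := u)) b)\<^sup>2)) \<partial>(\<Pi>\<^sub>M b\<in>A. lborel) \<partial>lborel) =
      (\<integral>\<^sup>+u. \<integral>\<^sup>+\<eta>. f (u, sqrt (u\<^sup>2 + (\<Sum>b\<in>A. (\<eta> b)\<^sup>2))) \<partial>(\<Pi>\<^sub>M b\<in>A. lborel) \<partial>lborel)"
      using A(1,2) by simp
  qed
  finally show ?thesis
    by (simp add: nn_integral_norm_offset_PiM[OF A(1) An, where f = "\<lambda>s. f (_, s)"] cA)
qed

text \<open>The sign in u = - s cos \<theta> makes u increasing on [0, pi], as the substitution rule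
  requires. The Jacobian s sin \<theta> combines with s (s sin \<theta>)^(m-2) to s^m sin^(m-1)
  \<theta>.\<close>

lemma nn_integral_slice_angle:
  fixes f :: "real \<times> real \<Rightarrow> ennreal" and e :: "'a::euclidean_space"
  assumes [measurable]: "f \<in> borel_measurable borel" and e: "e \<in> Basis" and d: "DIM('a) = Suc m" "m > 0"
  shows "(\<integral>\<^sup>+\<xi>. f (\<xi> \<bullet> e, norm \<xi>) \<partial>lborel) =
    (\<integral>\<^sup>+s. \<integral>\<^sup>+\<theta>. f (- s * cos \<theta>, s) * (ennreal (unit_ball_vol m * m * s ^ m * sin \<theta> ^ (m - 1)) * indicator {0..pi} \<theta> * indicator {0<..} s) \<partial>lborel \<partial>lborel)"
proof -
  let ?w = "\<lambda>s \<theta>. ennreal (unit_ball_vol m * m * s ^ m * sin \<theta> ^ (m - 1)) * indicator {0..pi} \<theta> * indicator {0<..} s"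
  define w where "w = (\<lambda>(u, s). ennreal (unit_ball_vol m * m * s * (s\<^sup>2 - u\<^sup>2) powr (m / 2 - 1)) * indicator {p. \<bar>fst p\<bar> < snd p} (u, s))"
  have [measurable]: "w \<in> borel_measurable borel" unfolding w_def borel_prod[symmetric]
    by measurable
  have "(\<integral>\<^sup>+\<xi>. f (\<xi> \<bullet> e, norm \<xi>) \<partial>lborel) = (\<integral>\<^sup>+u. \<integral>\<^sup>+s. f (u, s) * w (u, s) \<partial>lborel \<partial>lborel)"
    unfolding nn_integral_slice[OF assms] w_def by (intro nn_integral_cong) (auto simp: indicator_def)
  also have "\<dots> = (\<integral>\<^sup>+s. \<integral>\<^sup>+u. f (u, s) * w (u, s) \<partial>lborel \<partial>lborel)"
    by (rule lborel_pair.Fubini'[symmetric]) measurable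
  also have "\<dots> = (\<integral>\<^sup>+s. \<integral>\<^sup>+\<theta>. f (- s * cos \<theta>, s) * ?w s \<theta> \<partial>lborel \<partial>lborel)"
  proof (rule nn_integral_cong)
    fix s :: real
    show "(\<integral>\<^sup>+u. f (u, s) * w (u, s) \<partial>lborel) = (\<integral>\<^sup>+\<theta>. f (- s * cos \<theta>, s) * ?w s \<theta> \<partial>lborel)"
    proof (cases "s > 0")
      case False
      then have "\<not> \<bar>u\<bar> < s" for u by linarith
      then show ?thesis using False by (simp add: w_def)
    next
      case s: True
      have "(\<integral>\<^sup>+u. f (u, s) * w (u, s) \<partial>lborel) = (\<integral>\<^sup>+u. f (u, s) * w (u, s) * indicator {- s * cos 0..- s * cos pi} u \<partial>lborel)"
        by (intro nn_integral_cong) (auto simp: w_def indicator_def)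
      also have "\<dots> = (\<integral>\<^sup>+\<theta>. f (- s * cos \<theta>, s) * w (- s * cos \<theta>, s) * ennreal (s * sin \<theta>) * indicator {0..pi} \<theta> \<partial>lborel)"
        by (rule nn_integral_substitution_aux[where g' = "\<lambda>\<theta>. s * sin \<theta>"])
           (use s in \<open>auto intro!: derivative_eq_intros continuous_intros mult_nonneg_nonneg sin_ge_zero\<close>)
      also have "\<dots> = (\<integral>\<^sup>+\<theta>. f (- s * cos \<theta>, s) * ?w s \<theta> \<partial>lborel)"
      proof (rule nn_integral_cong_AE)
        \<comment> \<open>The endpoints are discarded: there |u| < s fails and the left side is 0,
          whereas for m = 1 the factor sin \<theta> ^ 0 on the right is 1.\<close>
        have "AE \<theta> in lborel. \<theta> \<noteq> 0 \<and> \<theta> \<noteq> pi" by (intro AE_conjI AE_lborel_singleton)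
        then show "AE \<theta> in lborel. f (- s * cos \<theta>, s) * w (- s * cos \<theta>, s) * ennreal (s * sin \<theta>) * indicator {0..pi} \<theta>
           = f (- s * cos \<theta>, s) * ?w s \<theta>"
        proof eventually_elim
          fix \<theta> assume \<theta>: "\<theta> \<noteq> 0 \<and> \<theta> \<noteq> pi"
          show "f (- s * cos \<theta>, s) * w (- s * cos \<theta>, s) * ennreal (s * sin \<theta>) * indicator {0..pi} \<theta>
           = f (- s * cos \<theta>, s) * ?w s \<theta>"
          proof (cases "\<theta> \<in> {0..pi}")
            case True
            then have \<theta>': "0 < \<theta>" "\<theta> < pi" using \<theta> by auto
            have sn: "sin \<theta> > 0" using \<theta>' by (rule sin_gt_zero)
            have c1: "\<bar>cos \<theta>\<bar> < 1"
            proof -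
              have "(cos \<theta>)\<^sup>2 < 1" using zero_less_power[OF sn, of 2] by (simp add: cos_squared_eq)
              then show ?thesis by (simp add: abs_square_less_1)
            qed
            have sc: "s\<^sup>2 - (- s * cos \<theta>)\<^sup>2 = (s * sin \<theta>)\<^sup>2"
              by (simp add: power_mult_distrib sin_squared_eq algebra_simps)
            have p: "((s * sin \<theta>)\<^sup>2) powr (m / 2 - 1) = (s * sin \<theta>) powr (real m - 2)"
              using power2_powr[of "s * sin \<theta>" "m / 2 - 1"] s sn by (simp add: algebra_simps)
            have p2: "s * (s * sin \<theta>) powr (real m - 2) * (s * sin \<theta>) = s ^ m * sin \<theta> ^ (m - 1)"
            proof -
              have "(s * sin \<theta>) * (s * sin \<theta>) powr (real m - 2) = (s * sin \<theta>) powr (real (m - 1))"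
                using s sn d by (subst powr_mult_base) (auto simp: of_nat_diff)
              also have "\<dots> = s ^ (m - 1) * sin \<theta> ^ (m - 1)"
                using s sn by (simp add: powr_realpow power_mult_distrib)
              finally have "s * ((s * sin \<theta>) * (s * sin \<theta>) powr (real m - 2)) = s ^ m * sin \<theta> ^ (m - 1)"
                using d by (simp add: power_eq_if)
              then show ?thesis by (simp add: mult_ac)
            qed
            have "w (- s * cos \<theta>, s) = ennreal (unit_ball_vol m * m * s * (s * sin \<theta>) powr (real m - 2))"
              using c1 s unfolding w_def by (simp add: sc[simplified] p[simplified] abs_mult)
            then have "w (- s * cos \<theta>, s) * ennreal (s * sin \<theta>) = ennreal (unit_ball_vol m * m * s * (s * sin \<theta>) powr (real m - 2) * (s * sin \<theta>))"
              using s sn by (subst ennreal_mult') auto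
            also have "unit_ball_vol m * m * s * (s * sin \<theta>) powr (real m - 2) * (s * sin \<theta>) = unit_ball_vol m * m * (s ^ m * sin \<theta> ^ (m - 1))"
              unfolding p2[symmetric] by (simp add: mult_ac)
            finally show ?thesis using True s by (simp add: mult.assoc)
          qed simp
        qed
      qed
      finally show ?thesis .
    qed
  qed
  finally show ?thesis .
qed

subsection \<open>Bessel kernels\<close>

text \<open>The energy bounds \<open>\<phi>\<close>, so the derivative of \<open>e\<^bsup>-is\<^esup>(\<phi>' + i\<phi>)\<close> is \<open>O(1/s\<^sup>2)\<close>; \<open>A\<close> is its limit.\<close>

lemma ODE_inverse_square_perturbation:
  fixes \<phi> \<phi>' :: "real \<Rightarrow> real" and c :: real
  assumes d1: "\<And>s. s > 0 \<Longrightarrow> (\<phi> has_real_derivative \<phi>' s) (at s)"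
    and d2: "\<And>s. s > 0 \<Longrightarrow> (\<phi>' has_real_derivative (c / s\<^sup>2 - 1) * \<phi> s) (at s)"
  obtains A :: complex and B :: real where
    "B \<ge> 0" "\<And>s. s \<ge> 1 \<Longrightarrow> \<bar>\<phi> s\<bar> \<le> B" "\<And>s. s \<ge> 1 \<Longrightarrow> \<bar>\<phi> s - Im (cis s * A)\<bar> \<le> B / s"
proof -
  \<comment> \<open>The energy \<phi>^2 + \<phi>'^2 has derivative 2 c \<phi> \<phi>' / s^2, at most
    |c| / s^2 times the energy. The exponential factor has logarithmic derivative -2 |c| / s^2,
    which outweighs this, so \<open>N\<close> decreases.\<close>
  define N where "N = (\<lambda>s. ((\<phi> s)\<^sup>2 + (\<phi>' s)\<^sup>2) * exp (2 * \<bar>c\<bar> / s))"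
  have N: "N s \<le> N 1" if "s \<ge> 1" for s
  proof (rule DERIV_nonpos_imp_nonincreasing[OF that])
    fix x :: real assume x: "1 \<le> x" "x \<le> s"
    then have x0: "x > 0" by simp
    let ?D = "(2 * c * \<phi> x * \<phi>' x / x\<^sup>2 - 2 * \<bar>c\<bar> / x\<^sup>2 * ((\<phi> x)\<^sup>2 + (\<phi>' x)\<^sup>2)) * exp (2 * \<bar>c\<bar> / x)"
    have "(N has_real_derivative ?D) (at x)"
      unfolding N_def using x0
      by (auto intro!: derivative_eq_intros d1 d2 simp: field_simps power2_eq_square)
    moreover have "?D \<le> 0"
    proof -
      have "2 * \<bar>\<phi> x * \<phi>' x\<bar> \<le> (\<phi> x)\<^sup>2 + (\<phi>' x)\<^sup>2"
        using sum_squares_bound[of "\<bar>\<phi> x\<bar>" "\<bar>\<phi>' x\<bar>"] by (simp add: abs_mult)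
      also have "\<dots> \<le> 2 * ((\<phi> x)\<^sup>2 + (\<phi>' x)\<^sup>2)" by simp
      finally have "2 * \<bar>\<phi> x * \<phi>' x\<bar> \<le> 2 * ((\<phi> x)\<^sup>2 + (\<phi>' x)\<^sup>2)" .
      then have "\<bar>c\<bar> * (2 * \<bar>\<phi> x * \<phi>' x\<bar>) \<le> \<bar>c\<bar> * (2 * ((\<phi> x)\<^sup>2 + (\<phi>' x)\<^sup>2))"
        by (intro mult_left_mono) auto
      moreover have "c * (2 * (\<phi> x * \<phi>' x)) \<le> \<bar>c\<bar> * (2 * \<bar>\<phi> x * \<phi>' x\<bar>)"
        by (metis abs_ge_self abs_mult abs_numeral)
      ultimately have "2 * c * \<phi> x * \<phi>' x \<le> 2 * \<bar>c\<bar> * ((\<phi> x)\<^sup>2 + (\<phi>' x)\<^sup>2)" by (simp add: mult_ac)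
      then have "2 * c * \<phi> x * \<phi>' x / x\<^sup>2 \<le> 2 * \<bar>c\<bar> * ((\<phi> x)\<^sup>2 + (\<phi>' x)\<^sup>2) / x\<^sup>2"
        by (intro divide_right_mono) auto
      then show ?thesis by (simp add: mult_le_0_iff)
    qed
    ultimately show "\<exists>y. (N has_real_derivative y) (at x) \<and> y \<le> 0" by blast
  qed
  define K where "K = sqrt (N 1)"
  have K: "\<bar>\<phi> s\<bar> \<le> K" if "s \<ge> 1" for s
  proof -
    have "(\<phi> s)\<^sup>2 * 1 \<le> ((\<phi> s)\<^sup>2 + (\<phi>' s)\<^sup>2) * exp (2 * \<bar>c\<bar> / s)"
      using that by (intro mult_mono) auto
    then have "(\<phi> s)\<^sup>2 \<le> N 1" using N[OF that] unfolding N_def[symmetric] by (simp add: N_def)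
    then show ?thesis unfolding K_def by (metis real_sqrt_abs real_sqrt_le_mono)
  qed
  have K0: "K \<ge> 0" using K[of 1] by linarith
  define P where "P = (\<lambda>s. cis (- s) * (complex_of_real (\<phi>' s) + \<i> * complex_of_real (\<phi> s)))"
  define P' where "P' = (\<lambda>s. cis (- s) * complex_of_real (c / s\<^sup>2 * \<phi> s))"
  have P: "(P has_vector_derivative P' s) (at s within S)" if "s > 0" for s S
  proof -
    note 1 = has_field_derivative_at_within[OF d1[OF that]] has_field_derivative_at_within[OF d2[OF that]]
    have 2: "((\<lambda>s. cis (- s)) has_vector_derivative - \<i> * cis (- s)) (at s within S)"
      unfolding cis_conv_exp by (auto intro!: derivative_eq_intros has_vector_derivative_real_field simp: scaleR_conv_of_real)
    have 3: "((\<lambda>s. complex_of_real (\<phi>' s) + \<i> * complex_of_real (\<phi> s)) has_vector_derivative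
       complex_of_real ((c / s\<^sup>2 - 1) * \<phi> s) + \<i> * complex_of_real (\<phi>' s)) (at s within S)"
      by (intro has_vector_derivative_add has_vector_derivative_mult_right has_vector_derivative_of_real 1)
    have "(P has_vector_derivative cis (- s) * (complex_of_real ((c / s\<^sup>2 - 1) * \<phi> s) + \<i> * complex_of_real (\<phi>' s))
       + (- \<i> * cis (- s)) * (complex_of_real (\<phi>' s) + \<i> * complex_of_real (\<phi> s))) (at s within S)"
      unfolding P_def by (rule has_vector_derivative_mult[OF 2 3])
    moreover have "cis (- s) * (complex_of_real ((c / s\<^sup>2 - 1) * \<phi> s) + \<i> * complex_of_real (\<phi>' s))
       + (- \<i> * cis (- s)) * (complex_of_real (\<phi>' s) + \<i> * complex_of_real (\<phi> s)) = P' s"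
      unfolding P'_def by (simp add: algebra_simps)
    ultimately show ?thesis by simp
  qed
  define L where "L = \<bar>c\<bar> * K"
  have L0: "L \<ge> 0" using K0 by (simp add: L_def)
  have Pdiff: "cmod (P y - P x) \<le> L / x - L / y" if xy: "1 \<le> x" "x \<le> y" for x y
  proof -
    have i1: "(P' has_integral (P y - P x)) {x..y}"
      by (rule fundamental_theorem_of_calculus) (use xy P in auto)
    have i2: "((\<lambda>s. L / s\<^sup>2) has_integral (- L / y - - L / x)) {x..y}"
      by (rule fundamental_theorem_of_calculus)
         (use xy in \<open>auto intro!: derivative_eq_intros simp: has_real_derivative_iff_has_vector_derivative[symmetric] power2_eq_square\<close>)
    have "norm (integral {x..y} P') \<le> integral {x..y} (\<lambda>s. L / s\<^sup>2)"
    proof (rule integral_norm_bound_integral)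
      fix s assume s: "s \<in> {x..y}"
      have "cmod (P' s) = \<bar>c\<bar> * \<bar>\<phi> s\<bar> / s\<^sup>2"
        unfolding P'_def by (simp add: norm_mult norm_divide norm_power)
      also have "\<dots> \<le> L / s\<^sup>2" unfolding L_def
        using s xy K[of s] by (intro divide_right_mono mult_left_mono) auto
      finally show "cmod (P' s) \<le> L / s\<^sup>2" .
    qed (use i1 i2 in auto)
    then show ?thesis using i1 i2 by (simp add: integral_unique)
  qed
  \<comment> \<open>The difference bound telescopes L / s, so a sequence of points determines the
    limit; the shift by 1 keeps every point in the range s >= 1 where the bound holds.\<close>
  have "Cauchy (\<lambda>n. P (real n + 1))"
  proof (rule CauchyI)
    fix e :: real assume e: "e > 0"
    obtain M where M: "L / e < real M" using reals_Archimedean2 by blast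
    show "\<exists>M. \<forall>m\<ge>M. \<forall>n\<ge>M. norm (P (real m + 1) - P (real n + 1)) < e"
    proof (intro exI[of _ M] allI impI)
      have *: "norm (P (real m + 1) - P (real n + 1)) < e" if "m \<ge> M" "n \<ge> M" "n \<le> m" for m n
      proof -
        have "norm (P (real m + 1) - P (real n + 1)) \<le> L / (real n + 1) - L / (real m + 1)"
          using that by (intro Pdiff) auto
        also have "\<dots> \<le> L / (real n + 1)" using L0 by simp
        also have "L < e * (real n + 1)"
        proof -
          have "L < e * real M" using M e by (simp add: field_simps)
          also have "\<dots> \<le> e * (real n + 1)" using e that by simp
          finally show ?thesis .
        qed
        then have "L / (real n + 1) < e" by (simp add: field_simps)
        finally show ?thesis .
      qed
      fix m n assume "m \<ge> M" "n \<ge> M"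
      then show "norm (P (real m + 1) - P (real n + 1)) < e"
        using *[of m n] *[of n m] by (cases "n \<le> m") (auto simp: norm_minus_commute)
    qed
  qed
  then obtain A where A: "(\<lambda>n. P (real n + 1)) \<longlonglongrightarrow> A" using Cauchy_convergent convergent_def by blast
  have PA: "cmod (P s - A) \<le> L / s" if s: "s \<ge> 1" for s
  proof -
    have "(\<lambda>n. norm (P s - P (real n + 1))) \<longlonglongrightarrow> norm (P s - A)" by (intro tendsto_intros A)
    moreover have "\<forall>\<^sub>F n in sequentially. norm (P s - P (real n + 1)) \<le> L / s"
    proof (rule eventually_sequentiallyI)
      fix n assume n: "n \<ge> nat \<lceil>s\<rceil>"
      then have "norm (P (real n + 1) - P s) \<le> L / s - L / (real n + 1)" using s by (intro Pdiff) linarith+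
      also have "\<dots> \<le> L / s" using L0 by simp
      finally show "norm (P s - P (real n + 1)) \<le> L / s" by (simp add: norm_minus_commute)
    qed
    ultimately show ?thesis by (rule tendsto_upperbound) simp
  qed
  have "\<bar>\<phi> s - Im (cis s * A)\<bar> \<le> L / s" if s: "s \<ge> 1" for s
  proof -
    have "\<phi> s = Im (cis s * P s)" by (simp add: P_def mult.assoc[symmetric] cis_mult)
    then have "\<phi> s - Im (cis s * A) = Im (cis s * (P s - A))" by (simp add: algebra_simps)
    then have "\<bar>\<phi> s - Im (cis s * A)\<bar> \<le> cmod (cis s * (P s - A))" using abs_Im_le_cmod by metis
    then show ?thesis using PA[OF s] by (simp add: norm_mult)
  qed
  then have "\<bar>\<phi> s - Im (cis s * A)\<bar> \<le> max K L / s" if "s \<ge> 1" for s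
    using that by (meson divide_right_mono dual_order.trans less_le_trans max.cobounded2 order_less_imp_le zero_less_one)
  then show thesis using that[of "max K L" A] K K0 by fastforce
qed

text \<open>Up to a constant, \<open>bessel_kernel m r\<close> is the Fourier transform of the surface measure of the
  unit sphere of \<open>\<real>\<^bsup>m+1\<^esup>\<close> at distance \<open>r\<close> from the origin.\<close>

definition bessel_kernel :: "nat \<Rightarrow> real \<Rightarrow> real" where
  "bessel_kernel m r = integral {0..pi} (\<lambda>\<theta>. cos (r * cos \<theta>) * sin \<theta> ^ (m - 1))"

lemma bessel_kernel_bound: "\<bar>bessel_kernel m r\<bar> \<le> pi"
proof -
  have "norm (integral {0..pi} (\<lambda>\<theta>. cos (r * cos \<theta>) * sin \<theta> ^ (m - 1))) \<le> integral {0..pi} (\<lambda>\<theta>. 1)"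
  proof (rule integral_norm_bound_integral)
    fix \<theta> :: real
    show "norm (cos (r * cos \<theta>) * sin \<theta> ^ (m - 1)) \<le> 1"
      by (simp add: abs_mult power_abs mult_le_one power_le_one)
  qed (auto intro!: integrable_continuous_interval continuous_intros)
  then show ?thesis by (simp add: bessel_kernel_def)
qed

text \<open>Both derivatives are taken under the integral sign. The equation J'' + (m / r) J' + J =
  0 is an integration by parts: r (J'' + J) + m J' is minus the integral of the derivative of sin^m
  \<theta> sin (r cos \<theta>), which vanishes at both endpoints because m > 0.\<close>

lemma
  assumes m: "m > 0"
  defines "J' \<equiv> \<lambda>r. integral {0..pi} (\<lambda>\<theta>. - cos \<theta> * sin (r * cos \<theta>) * sin \<theta> ^ (m - 1))"
  shows has_derivative_bessel_kernel: "(bessel_kernel m has_real_derivative J' r) (at r)"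
    and bessel_kernel_ODE: "r > 0 \<Longrightarrow> (J' has_real_derivative - bessel_kernel m r - m / r * J' r) (at r)"
proof -
  show "(bessel_kernel m has_real_derivative J' r) (at r)" for r
    unfolding bessel_kernel_def[abs_def] J'_def cbox_interval[symmetric]
    by (rule leibniz_rule_field_derivative[where U = UNIV, simplified])
       (auto intro!: derivative_eq_intros integrable_continuous_interval continuous_intros simp: case_prod_beta)
  define J'' where "J'' = (\<lambda>r. integral {0..pi} (\<lambda>\<theta>. - (cos \<theta>)\<^sup>2 * cos (r * cos \<theta>) * sin \<theta> ^ (m - 1)))"
  have J'': "(J' has_real_derivative J'' r) (at r)" for r
    unfolding J'_def J''_def cbox_interval[symmetric]
    by (rule leibniz_rule_field_derivative[where U = UNIV, simplified])
       (auto intro!: derivative_eq_intros integrable_continuous_interval continuous_intros simp: case_prod_beta power2_eq_square)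
  have "J'' r = - bessel_kernel m r - m / r * J' r" if r: "r > 0" for r
  proof -
    let ?g = "\<lambda>\<theta>. m * (sin \<theta> ^ (m - 1) * cos \<theta> * sin (r * cos \<theta>)) - r * (sin \<theta> ^ (m + 1) * cos (r * cos \<theta>))"
    have "(?g has_integral (sin pi ^ m * sin (r * cos pi) - sin 0 ^ m * sin (r * cos 0))) {0..pi}"
      by (rule fundamental_theorem_of_calculus)
         (auto intro!: derivative_eq_intros simp: has_real_derivative_iff_has_vector_derivative[symmetric] algebra_simps)
    then have g: "integral {0..pi} ?g = 0" using m by (simp add: integral_unique)
    have "r * (J'' r + bessel_kernel m r) + m * J' r = 
       r * (integral {0..pi} (\<lambda>\<theta>. - (cos \<theta>)\<^sup>2 * cos (r * cos \<theta>) * sin \<theta> ^ (m - 1) + cos (r * cos \<theta>) * sin \<theta> ^ (m - 1)))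
       + integral {0..pi} (\<lambda>\<theta>. m * (- cos \<theta> * sin (r * cos \<theta>) * sin \<theta> ^ (m - 1)))"
      unfolding J''_def J'_def bessel_kernel_def
      by (subst Henstock_Kurzweil_Integration.integral_add)
         (auto intro!: integrable_continuous_interval continuous_intros)
    also have "\<dots> = integral {0..pi} (\<lambda>\<theta>. r * (- (cos \<theta>)\<^sup>2 * cos (r * cos \<theta>) * sin \<theta> ^ (m - 1) + cos (r * cos \<theta>) * sin \<theta> ^ (m - 1))
       + m * (- cos \<theta> * sin (r * cos \<theta>) * sin \<theta> ^ (m - 1)))"
      by (subst Henstock_Kurzweil_Integration.integral_add)
         (auto intro!: integrable_continuous_interval continuous_intros)
    also have "\<dots> = integral {0..pi} (\<lambda>\<theta>. - ?g \<theta>)"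
    proof (rule Henstock_Kurzweil_Integration.integral_cong)
      fix \<theta> :: real
      have *: "sin \<theta> ^ (m + 1) = sin \<theta> ^ (m - 1) * (1 - (cos \<theta>)\<^sup>2)"
        using m by (simp add: power_add[symmetric] flip: sin_squared_eq)
      show "r * (- (cos \<theta>)\<^sup>2 * cos (r * cos \<theta>) * sin \<theta> ^ (m - 1) + cos (r * cos \<theta>) * sin \<theta> ^ (m - 1))
       + m * (- cos \<theta> * sin (r * cos \<theta>) * sin \<theta> ^ (m - 1)) = - ?g \<theta>"
        unfolding * by (simp add: algebra_simps)
    qed
    also have "\<dots> = - integral {0..pi} ?g"
      by (rule Henstock_Kurzweil_Integration.integral_neg)
    also have "\<dots> = 0" unfolding g by simp
    finally show ?thesis using r by (simp add: field_simps)
  qed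
  then show "(J' has_real_derivative - bessel_kernel m r - m / r * J' r) (at r)" if "r > 0"
    using J'' that by metis
qed

text \<open>Multiplication by s^a with a = m / 2 removes the first-order term of the Bessel
  equation: \<phi> = s^a J satisfies \<phi>'' = (a (a - 1) / s^2 - 1) \<phi>, an inverse square
  perturbation of the harmonic oscillator. For s < 1 the bound pi on the kernel and s^a <= 1
  suffice, hence the constant \<open>max B pi\<close>.\<close>

lemma bessel_kernel_asymptotics:
  assumes m: "m > 0"
  obtains A :: complex and B :: real where "B \<ge> 0"
    "\<And>s. s > 0 \<Longrightarrow> \<bar>bessel_kernel m s\<bar> * s powr (m / 2) \<le> B"
    "\<And>s. s \<ge> 1 \<Longrightarrow> \<bar>s powr (m / 2) * bessel_kernel m s - Im (cis s * A)\<bar> \<le> B / s"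
proof -
  define a where "a = real m / 2"
  define J where "J = bessel_kernel m"
  define J' where "J' = (\<lambda>r. integral {0..pi} (\<lambda>\<theta>. - cos \<theta> * sin (r * cos \<theta>) * sin \<theta> ^ (m - 1)))"
  have J: "(J has_real_derivative J' s) (at s)" for s
    unfolding J_def J'_def by (rule has_derivative_bessel_kernel[OF m])
  have J2: "(J' has_real_derivative - J s - 2 * a / s * J' s) (at s)" if "s > 0" for s
    using bessel_kernel_ODE[OF m that] unfolding J_def J'_def a_def by simp
  define \<phi> where "\<phi> = (\<lambda>s. s powr a * J s)"
  define \<phi>' where "\<phi>' = (\<lambda>s. a * s powr (a - 1) * J s + s powr a * J' s)"
  have d1: "(\<phi> has_real_derivative \<phi>' s) (at s)" if "s > 0" for s
    unfolding \<phi>_def \<phi>'_def using that by (auto intro!: derivative_eq_intros J)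
  have d2: "(\<phi>' has_real_derivative (a * (a - 1) / s\<^sup>2 - 1) * \<phi> s) (at s)" if s: "s > 0" for s
  proof -
    have "(\<phi>' has_real_derivative a * ((a - 1) * s powr (a - 1 - 1)) * J s + a * s powr (a - 1) * J' s
       + (a * s powr (a - 1) * J' s + s powr a * (- J s - 2 * a / s * J' s))) (at s)"
      unfolding \<phi>'_def using s by (auto intro!: derivative_eq_intros J J2)
    moreover have "s powr (a - 1) = s powr a / s" "s powr (a - 1 - 1) = s powr a / s\<^sup>2"
      using s by (simp_all add: powr_diff power2_eq_square)
    then have "a * ((a - 1) * s powr (a - 1 - 1)) * J s + a * s powr (a - 1) * J' s
       + (a * s powr (a - 1) * J' s + s powr a * (- J s - 2 * a / s * J' s)) = (a * (a - 1) / s\<^sup>2 - 1) * \<phi> s"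
      unfolding \<phi>_def by (simp add: algebra_simps)
    ultimately show ?thesis by simp
  qed
  obtain A B where B: "B \<ge> 0" and b1: "\<And>s. s \<ge> 1 \<Longrightarrow> \<bar>\<phi> s\<bar> \<le> B"
    and b2: "\<And>s. s \<ge> 1 \<Longrightarrow> \<bar>\<phi> s - Im (cis s * A)\<bar> \<le> B / s"
    by (rule ODE_inverse_square_perturbation[OF d1 d2]) (assumption, assumption, rule that)
  show thesis
  proof (rule that[of "max B pi" A])
    fix s :: real assume s: "s > 0"
    show "\<bar>bessel_kernel m s\<bar> * s powr (m / 2) \<le> max B pi"
    proof (cases "s \<ge> 1")
      case True
      have "\<bar>bessel_kernel m s\<bar> * s powr (m / 2) = \<bar>\<phi> s\<bar>" by (simp add: \<phi>_def J_def a_def abs_mult mult.commute)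
      then show ?thesis using b1[OF True] by simp
    next
      case False
      have "\<bar>bessel_kernel m s\<bar> * s powr (m / 2) \<le> pi * 1"
        using False s m by (intro mult_mono bessel_kernel_bound powr_le1) auto
      then show ?thesis by simp
    qed
  next
    fix s :: real assume s: "s \<ge> 1"
    have "B / s \<le> max B pi / s" using s by (intro divide_right_mono) auto
    then show "\<bar>s powr (m / 2) * bessel_kernel m s - Im (cis s * A)\<bar> \<le> max B pi / s"
      using b2[OF s] by (simp add: \<phi>_def J_def a_def)
  qed (use B in auto)
qed

subsection \<open>The square and the parabola\<close>

text \<open>On [1, 2] the substitution \<tau> = \<rho>^2 has Jacobian 2 \<rho> >= 1, so the
  pushforward is dominated by Lebesgue measure with constant 1.\<close>

lemma fourier_extension_square_L2:
  fixes k :: "real \<Rightarrow> complex"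
  assumes k: "integrable lborel k" and supp: "\<And>\<rho>. \<rho> \<notin> {1..2} \<Longrightarrow> k \<rho> = 0"
  shows "(\<integral>\<^sup>+t. ennreal ((cmod (\<integral>\<rho>. k \<rho> * iexp (t * \<rho>\<^sup>2) \<partial>lborel))\<^sup>2) \<partial>lborel)
    \<le> ennreal (2 * pi) * (\<integral>\<^sup>+\<rho>. ennreal ((cmod (k \<rho>))\<^sup>2) \<partial>lborel)"
proof -
  have "(\<integral>\<^sup>+z. ennreal ((cmod (\<integral>\<rho>. k \<rho> * iexp (z \<bullet> \<rho>\<^sup>2) \<partial>lborel))\<^sup>2) \<partial>lborel)
    \<le> ennreal ((2 * pi) ^ DIM(real)) * 1 * (\<integral>\<^sup>+\<rho>. ennreal ((cmod (k \<rho>))\<^sup>2) \<partial>lborel)"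
  proof (rule fourier_extension_L2[where S = "{1..2}"])
    fix \<phi> :: "real \<Rightarrow> ennreal" assume [measurable]: "\<phi> \<in> borel_measurable borel"
    have "(\<integral>\<^sup>+\<rho>. \<phi> (\<rho>\<^sup>2) * indicator {1..2} \<rho> \<partial>lborel) \<le> (\<integral>\<^sup>+\<rho>. \<phi> (\<rho>\<^sup>2) * ennreal (2 * \<rho>) * indicator {1..2} \<rho> \<partial>lborel)"
    proof (intro nn_integral_mono)
      fix \<rho> :: real
      have "\<phi> (\<rho>\<^sup>2) * 1 \<le> \<phi> (\<rho>\<^sup>2) * ennreal (2 * \<rho>)" if "\<rho> \<ge> 1"
        using that by (intro mult_left_mono) (auto simp flip: ennreal_1 intro!: ennreal_leI)
      then show "\<phi> (\<rho>\<^sup>2) * indicator {1..2} \<rho> \<le> \<phi> (\<rho>\<^sup>2) * ennreal (2 * \<rho>) * indicator {1..2} \<rho>"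
        by (auto simp: indicator_def)
    qed
    also have "\<dots> = (\<integral>\<^sup>+\<tau>. \<phi> \<tau> * indicator {1\<^sup>2..2\<^sup>2} \<tau> \<partial>lborel)"
      by (rule nn_integral_substitution_aux[where g = "\<lambda>\<rho>. \<rho>\<^sup>2", symmetric])
         (auto intro!: derivative_eq_intros continuous_intros)
    also have "\<dots> \<le> (\<integral>\<^sup>+\<tau>. \<phi> \<tau> \<partial>lborel)"
      by (intro nn_integral_mono) (auto simp: indicator_def)
    finally show "(\<integral>\<^sup>+\<rho>. \<phi> (\<rho>\<^sup>2) * indicator {1..2} \<rho> \<partial>lborel) \<le> 1 * (\<integral>\<^sup>+\<tau>. \<phi> \<tau> \<partial>lborel)" by simp
  qed (use k supp in \<open>auto intro: lborel.sigma_finite_measure_axioms\<close>)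
  then show ?thesis by simp
qed

text \<open>The pushforward of Lebesgue measure on \<open>\<real>\<^sup>3\<close> under \<open>\<rho> \<mapsto> (\<bar>\<rho>\<bar>\<^sup>2, \<rho>\<^sub>1 + \<rho>\<^sub>2 + \<rho>\<^sub>3)\<close> has a bounded
  density, which is why the sixth power of the extension operator of the parabola is under control.\<close>

lemma nn_integral_square_sum_le:
  fixes \<phi> :: "real \<times> real \<Rightarrow> ennreal" and v :: "real ^ 3"
  assumes [measurable]: "\<phi> \<in> borel_measurable borel" and v: "norm v \<ge> 1"
  shows "(\<integral>\<^sup>+\<rho>. \<phi> ((norm \<rho>)\<^sup>2, \<rho> \<bullet> v) * indicator {\<rho>. norm \<rho> \<le> 4} \<rho> \<partial>lborel) \<le> ennreal pi * (\<integral>\<^sup>+y. \<phi> y \<partial>lborel)"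
proof -
  define e :: "real ^ 3" where "e = axis 1 1"
  define l where "l = norm v"
  have l: "l \<ge> 1" using v by (simp add: l_def)
  have e: "e \<in> Basis" "norm e = 1" by (auto simp: e_def axis_in_Basis_iff norm_axis_1)
  \<comment> \<open>A rotation takes \<open>v\<close> to the direction of \<open>e\<close>. The two
    components become functions of \<open>\<xi> \<bullet> e\<close> and the norm, as the slicing
    formula requires.\<close>
  obtain T where T: "orthogonal_transformation T" "T (l *\<^sub>R e) = v"
    by (rule orthogonal_transformation_exists[of "l *\<^sub>R e" v]) (use l e in \<open>auto simp: l_def\<close>)
  have [measurable]: "T \<in> borel_measurable borel"
    using T(1) by (intro borel_measurable_continuous_onI linear_continuous_on linear_conv_bounded_linear[THEN iffD1] orthogonal_transformation_linear)
  have Tv: "T \<xi> \<bullet> v = l * (\<xi> \<bullet> e)" for \<xi>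
  proof -
    have "T \<xi> \<bullet> v = T \<xi> \<bullet> T (l *\<^sub>R e)" by (simp add: T)
    also have "\<dots> = \<xi> \<bullet> (l *\<^sub>R e)" using T(1) by (auto simp: orthogonal_transformation_def)
    finally show ?thesis by simp
  qed
  define f where "f = (\<lambda>(u, s). \<phi> (s\<^sup>2, l * u) * indicator {..4} s)"
  have [measurable]: "f \<in> borel_measurable borel" unfolding f_def borel_prod[symmetric] by measurable
  let ?I = "\<integral>\<^sup>+u. \<integral>\<^sup>+\<tau>. \<phi> (\<tau>, l * u) \<partial>lborel \<partial>lborel" and ?J = "\<integral>\<^sup>+u. \<integral>\<^sup>+\<tau>. \<phi> (\<tau>, u) \<partial>lborel \<partial>lborel"
  have "(\<integral>\<^sup>+\<rho>. \<phi> ((norm \<rho>)\<^sup>2, \<rho> \<bullet> v) * indicator {\<rho>. norm \<rho> \<le> 4} \<rho> \<partial>lborel) = (\<integral>\<^sup>+\<xi>. f (\<xi> \<bullet> e, norm \<xi>) \<partial>lborel)"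
    by (subst distr_lborel_orthogonal[OF T(1), symmetric], subst nn_integral_distr)
       (auto simp: f_def Tv orthogonal_transformation_norm[OF T(1)] indicator_def intro!: nn_integral_cong)
  also have "\<dots> = (\<integral>\<^sup>+u. \<integral>\<^sup>+s. f (u, s) * (ennreal (unit_ball_vol (real 2) * real 2 * s * (s\<^sup>2 - u\<^sup>2) powr (real 2 / 2 - 1)) * indicator {\<bar>u\<bar><..} s) \<partial>lborel \<partial>lborel)"
    by (rule nn_integral_slice) (use e in auto)
  \<comment> \<open>In R^3 two coordinates remain, so the exponent m / 2 - 1 is 0 and the weight on
    |u| < s is 2 pi s. The condition |u| < s is then relaxed to s >= 0, and 2 s is the Jacobian of
    \<tau> = s^2.\<close>
  also have "\<dots> \<le> (\<integral>\<^sup>+u. \<integral>\<^sup>+s. ennreal pi * (\<phi> (s\<^sup>2, l * u) * ennreal (2 * s) * indicator {0..4} s) \<partial>lborel \<partial>lborel)"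
  proof (intro nn_integral_mono)
    fix u s :: real
    have "ennreal (pi * 2 * s) \<le> ennreal pi * ennreal (2 * s)" if "s > 0"
      using that by (simp add: ennreal_mult'[symmetric] mult.assoc)
    then have "\<phi> (s\<^sup>2, l * u) * ennreal (pi * 2 * s) \<le> \<phi> (s\<^sup>2, l * u) * (ennreal pi * ennreal (2 * s))" if "s > 0"
      using that by (intro mult_left_mono) auto
    then show "f (u, s) * (ennreal (unit_ball_vol (real 2) * real 2 * s * (s\<^sup>2 - u\<^sup>2) powr (real 2 / 2 - 1)) * indicator {\<bar>u\<bar><..} s)
        \<le> ennreal pi * (\<phi> (s\<^sup>2, l * u) * ennreal (2 * s) * indicator {0..4} s)"
      by (auto simp: f_def indicator_def unit_ball_vol_2 mult_ac)
  qed
  also have "\<dots> = (\<integral>\<^sup>+u. ennreal pi * (\<integral>\<^sup>+s. \<phi> (s\<^sup>2, l * u) * ennreal (2 * s) * indicator {0..4} s \<partial>lborel) \<partial>lborel)"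
    by (intro nn_integral_cong nn_integral_cmult) measurable
  also have "\<dots> = ennreal pi * (\<integral>\<^sup>+u. \<integral>\<^sup>+s. \<phi> (s\<^sup>2, l * u) * ennreal (2 * s) * indicator {0..4} s \<partial>lborel \<partial>lborel)"
    by (rule nn_integral_cmult) measurable
  also have "\<dots> = ennreal pi * (\<integral>\<^sup>+u. \<integral>\<^sup>+\<tau>. \<phi> (\<tau>, l * u) * indicator {0\<^sup>2..4\<^sup>2} \<tau> \<partial>lborel \<partial>lborel)"
    by (intro arg_cong[where f = "\<lambda>x. ennreal pi * x"] nn_integral_cong nn_integral_substitution_aux[symmetric])
       (auto intro!: derivative_eq_intros continuous_intros)
  also have "\<dots> \<le> ennreal pi * ?I"
    by (intro mult_left_mono nn_integral_mono) (auto simp: indicator_def)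
  \<comment> \<open>Replacing l u by u costs the factor 1 / l, which is at most 1 as the norm of
    \<open>v\<close> is at least 1.\<close>
  also have "?I \<le> ?J"
  proof -
    have "?J = ennreal l * ?I"
      using l by (subst nn_integral_real_affine[of _ l 0]) auto
    moreover have "1 * ?I \<le> ennreal l * ?I"
      using l by (intro mult_right_mono) (auto simp flip: ennreal_1 intro!: ennreal_leI)
    ultimately show ?thesis by simp
  qed
  also have "?J = (\<integral>\<^sup>+y. \<phi> y \<partial>lborel)"
    by (subst lborel_prod[symmetric], rule lborel_pair.nn_integral_snd) (simp add: lborel_prod)
  finally show ?thesis by (simp add: mult_left_mono)
qed

definition parabola_extension :: "(real \<Rightarrow> complex) \<Rightarrow> real \<times> real \<Rightarrow> complex" where
  "parabola_extension f = (\<lambda>(t, r). \<integral>\<rho>. f \<rho> * iexp (t * \<rho>\<^sup>2 + r * \<rho>) \<partial>lborel)"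

text \<open>The product of three copies of the integral is an integral over R^3 of F(\<rho>) =
  f(\<rho>1) f(\<rho>2) f(\<rho>3) with phase t |\<rho>|^2 + r (\<rho> \<bullet> v), where
  \<open>v\<close> is the sum of the basis vectors. The sixth power of the modulus is thus the
  square of an extension operator covered by the L^2 principle, and the squared norm of F is the
  cube of that of f.\<close>

lemma parabola_extension_L6:
  fixes f :: "real \<Rightarrow> complex"
  assumes f: "integrable lborel f" and f2: "integrable lborel (\<lambda>\<rho>. (cmod (f \<rho>))\<^sup>2)"
    and supp: "\<And>\<rho>. \<rho> \<notin> {1..2} \<Longrightarrow> f \<rho> = 0"
  shows "(\<integral>\<^sup>+z. ennreal (cmod (parabola_extension f z) ^ 6) \<partial>lborel)
    \<le> ennreal ((2 * pi)\<^sup>2 * pi * (\<integral>\<rho>. (cmod (f \<rho>))\<^sup>2 \<partial>lborel) ^ 3)"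
proof -
  have [measurable]: "f \<in> borel_measurable borel" using f by auto
  define F where "F = (\<lambda>\<rho>::real^3. \<Prod>b\<in>Basis. f (\<rho> \<bullet> b))"
  define v where "v = (\<Sum>b\<in>(Basis::(real^3) set). b)"
  define \<Theta> where "\<Theta> = (\<lambda>\<rho>::real^3. ((norm \<rho>)\<^sup>2, \<rho> \<bullet> v))"
  have [measurable]: "\<Theta> \<in> borel_measurable borel" unfolding \<Theta>_def borel_prod[symmetric] by measurable
  have Fi: "integrable lborel F" unfolding F_def
    by (rule integrable_lborel_prod_Basis) (rule f)
  have n2: "(norm \<rho>)\<^sup>2 = (\<Sum>b\<in>Basis. (\<rho> \<bullet> b)\<^sup>2)" for \<rho> :: "real^3"
    unfolding power2_norm_eq_inner by (subst euclidean_inner) (simp add: power2_eq_square)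
  have E3: "(\<integral>\<rho>. F \<rho> * iexp (z \<bullet> \<Theta> \<rho>) \<partial>lborel) = parabola_extension f z ^ 3" for z
  proof -
    obtain t r where z: "z = (t, r)" by (cases z)
    have zT: "z \<bullet> \<Theta> \<rho> = (\<Sum>b\<in>Basis. t * (\<rho> \<bullet> b)\<^sup>2 + r * (\<rho> \<bullet> b))" for \<rho>
      by (simp add: z \<Theta>_def n2 v_def inner_sum_right sum.distrib sum_distrib_left)
    have "F \<rho> * iexp (z \<bullet> \<Theta> \<rho>) = (\<Prod>b\<in>Basis. f (\<rho> \<bullet> b) * iexp (t * (\<rho> \<bullet> b)\<^sup>2 + r * (\<rho> \<bullet> b)))" for \<rho>
      unfolding F_def zT prod.distrib by (simp add: exp_sum[symmetric] sum_distrib_left)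
    moreover have "integrable lborel (\<lambda>x. f x * iexp (t * x\<^sup>2 + r * x))"
      by (rule Bochner_Integration.integrable_bound[OF f]) (auto simp: norm_mult)
    ultimately show ?thesis
      using integral_lborel_prod_Basis[of "\<lambda>b::real^3. \<lambda>x. f x * iexp (t * x\<^sup>2 + r * x)"]
      by (simp add: parabola_extension_def z)
  qed
  have F2: "(\<integral>\<^sup>+\<rho>. ennreal ((cmod (F \<rho>))\<^sup>2) \<partial>lborel) = ennreal ((\<integral>\<rho>. (cmod (f \<rho>))\<^sup>2 \<partial>lborel) ^ 3)"
  proof -
    have eq: "complex_of_real ((cmod (F \<rho>))\<^sup>2) = (\<Prod>b\<in>Basis. complex_of_real ((cmod (f (\<rho> \<bullet> b)))\<^sup>2))" for \<rho>
      unfolding F_def prod_norm[symmetric] prod_power_distrib of_real_prod ..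
    have i: "integrable lborel (\<lambda>\<rho>. complex_of_real ((cmod (f \<rho>))\<^sup>2))"
      using f2 by (simp only: complex_of_real_integrable_eq)
    have "integrable lborel (\<lambda>\<rho>. complex_of_real ((cmod (F \<rho>))\<^sup>2))"
      unfolding eq by (rule integrable_lborel_prod_Basis) (rule i)
    then have 1: "integrable lborel (\<lambda>\<rho>. (cmod (F \<rho>))\<^sup>2)" by (simp only: complex_of_real_integrable_eq)
    have "(\<integral>\<rho>. complex_of_real ((cmod (F \<rho>))\<^sup>2) \<partial>lborel) = (\<integral>\<rho>. complex_of_real ((cmod (f \<rho>))\<^sup>2) \<partial>lborel) ^ 3"
      unfolding eq using integral_lborel_prod_Basis[of "\<lambda>b::real^3. \<lambda>x. complex_of_real ((cmod (f x))\<^sup>2)"] i by simp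
    then have "(\<integral>\<rho>. (cmod (F \<rho>))\<^sup>2 \<partial>lborel) = (\<integral>\<rho>. (cmod (f \<rho>))\<^sup>2 \<partial>lborel) ^ 3"
      unfolding integral_complex_of_real by (metis of_real_eq_iff of_real_power)
    then show ?thesis using nn_integral_eq_integral[OF 1] by simp
  qed
  \<comment> \<open>The cube [1, 2]^3 lies in the ball of radius sqrt 12 < 4.\<close>
  have supF: "F \<rho> = 0" if "\<rho> \<notin> {\<rho>. norm \<rho> \<le> 4}" for \<rho>
  proof (rule ccontr)
    assume "F \<rho> \<noteq> 0"
    then have "\<rho> \<bullet> b \<in> {1..2}" if "b \<in> Basis" for b using supp that unfolding F_def by (metis finite_Basis prod_zero_iff)
    then have "(\<rho> \<bullet> b)\<^sup>2 \<le> 2\<^sup>2" if "b \<in> Basis" for b using that by (intro power_mono) force+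
    then have "(\<Sum>b\<in>Basis. (\<rho> \<bullet> b)\<^sup>2) \<le> of_nat (card (Basis :: (real^3) set)) * 2\<^sup>2"
      by (rule sum_bounded_above)
    then have "(norm \<rho>)\<^sup>2 \<le> 4\<^sup>2" unfolding n2 by simp
    then show False using that power2_le_imp_le[of "norm \<rho>" 4] by simp
  qed
  have "(\<integral>\<^sup>+z. ennreal ((cmod (\<integral>\<rho>. F \<rho> * iexp (z \<bullet> \<Theta> \<rho>) \<partial>lborel))\<^sup>2) \<partial>lborel)
    \<le> ennreal ((2 * pi) ^ DIM(real \<times> real)) * ennreal pi * (\<integral>\<^sup>+\<rho>. ennreal ((cmod (F \<rho>))\<^sup>2) \<partial>lborel)"
  proof (rule fourier_extension_L2[where S = "{\<rho>. norm \<rho> \<le> 4}"])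
    have "v \<bullet> axis 1 1 = 1" unfolding v_def
      using inner_sum_left_Basis[of "axis 1 1 :: real^3" "\<lambda>_. 1"] by (simp add: axis_in_Basis_iff)
    then have "1 \<le> norm v * norm (axis 1 1 :: real^3)" by (metis norm_cauchy_schwarz)
    then have v: "norm v \<ge> 1" by (simp add: norm_axis_1)
    show "(\<integral>\<^sup>+\<rho>. \<phi> (\<Theta> \<rho>) * indicator {\<rho>. norm \<rho> \<le> 4} \<rho> \<partial>lborel) \<le> ennreal pi * (\<integral>\<^sup>+y. \<phi> y \<partial>lborel)"
      if "\<phi> \<in> borel_measurable borel" for \<phi>
      unfolding \<Theta>_def by (rule nn_integral_square_sum_le[OF that v])
  qed (use Fi supF in \<open>auto intro: lborel.sigma_finite_measure_axioms\<close>)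
  also have "\<dots> = ennreal ((2 * pi)\<^sup>2 * pi * (\<integral>\<rho>. (cmod (f \<rho>))\<^sup>2 \<partial>lborel) ^ 3)"
    unfolding F2 by (simp add: power2_eq_square ennreal_mult''[symmetric] mult_ac)
  finally show ?thesis unfolding E3 by (simp add: norm_power power_mult[symmetric])
qed

subsection \<open>Radial propagators at unit frequency\<close>

text \<open>By linearity and scaling every nonzero radial datum is a multiple of a rescaled one of
  this kind, so the norm is normalised to at most 1 and later bounds become plain constants.\<close>

definition band_profile :: "(real \<Rightarrow> complex) \<Rightarrow> bool" where
  "band_profile f \<longleftrightarrow> f \<in> borel_measurable borel \<and> (\<forall>\<rho>. \<rho> \<notin> {1..2} \<longrightarrow> f \<rho> = 0) \<and>
     (\<integral>\<^sup>+\<rho>. ennreal ((cmod (f \<rho>))\<^sup>2) \<partial>lborel) \<le> 1"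

lemma band_profileD:
  assumes "band_profile f"
  shows "f \<in> borel_measurable borel" "\<rho> \<notin> {1..2} \<Longrightarrow> f \<rho> = 0"
    and "integrable lborel (\<lambda>\<rho>. (cmod (f \<rho>))\<^sup>2)" "(\<integral>\<rho>. (cmod (f \<rho>))\<^sup>2 \<partial>lborel) \<le> 1"
    and "integrable lborel f" "(\<integral>\<^sup>+\<rho>. ennreal (cmod (f \<rho>)) \<partial>lborel) \<le> 1"
proof -
  show [measurable]: "f \<in> borel_measurable borel" and z: "\<rho> \<notin> {1..2} \<Longrightarrow> f \<rho> = 0" for \<rho>
    using assms by (auto simp: band_profile_def)
  have le: "(\<integral>\<^sup>+\<rho>. ennreal ((cmod (f \<rho>))\<^sup>2) \<partial>lborel) \<le> 1" using assms by (simp add: band_profile_def)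
  show i: "integrable lborel (\<lambda>\<rho>. (cmod (f \<rho>))\<^sup>2)"
    by (rule integrableI_bounded) (use le in \<open>auto intro: le_less_trans\<close>)
  show "(\<integral>\<rho>. (cmod (f \<rho>))\<^sup>2 \<partial>lborel) \<le> 1"
    using le nn_integral_eq_integral[OF i] by simp
  \<comment> \<open>From x <= 1/2 + x^2/2 and the length 1 of the band, the L^1 norm is at most 1/2
    + 1/2.\<close>
  define h :: real where "h = 1 / 2"
  have h: "h \<ge> 0" "h + h = 1" by (simp_all add: h_def)
  have "(\<integral>\<^sup>+\<rho>. ennreal (cmod (f \<rho>)) \<partial>lborel) \<le> (\<integral>\<^sup>+\<rho>. ennreal h * indicator {1..2} \<rho> + ennreal h * ennreal ((cmod (f \<rho>))\<^sup>2) \<partial>lborel)"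
  proof (intro nn_integral_mono)
    fix \<rho> :: real
    have "cmod (f \<rho>) \<le> h + h * (cmod (f \<rho>))\<^sup>2"
      using sum_squares_bound[of "cmod (f \<rho>)" 1] by (simp add: h_def)
    then have "ennreal (cmod (f \<rho>)) \<le> ennreal (h + h * (cmod (f \<rho>))\<^sup>2)" by (rule ennreal_leI)
    also have "\<dots> = ennreal h + ennreal h * ennreal ((cmod (f \<rho>))\<^sup>2)"
      using h(1) by (simp add: ennreal_mult)
    finally show "ennreal (cmod (f \<rho>)) \<le> ennreal h * indicator {1..2} \<rho> + ennreal h * ennreal ((cmod (f \<rho>))\<^sup>2)"
      using z[of \<rho>] by (cases "\<rho> \<in> {1..2}") auto
  qed
  also have "\<dots> = ennreal h * 1 + ennreal h * (\<integral>\<^sup>+\<rho>. ennreal ((cmod (f \<rho>))\<^sup>2) \<partial>lborel)"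
    by (subst nn_integral_add) (auto simp: nn_integral_cmult nn_integral_cmult_indicator)
  also have "\<dots> \<le> ennreal h * 1 + ennreal h * 1"
    by (intro add_left_mono mult_left_mono le) auto
  also have "\<dots> = 1" using h by (simp flip: ennreal_plus)
  finally show le1: "(\<integral>\<^sup>+\<rho>. ennreal (cmod (f \<rho>)) \<partial>lborel) \<le> 1" .
  then show "integrable lborel f"
    by (intro integrableI_bounded) (auto intro: le_less_trans)
qed

text \<open>The weighted profile has L^1 and L^2 norm at most b. The first gives the uniform bound,
  the second the bound in L^2 of time through the square substitution. It is applied at fixed radius
  with \<open>w\<close> the Bessel kernel, its normalised form, and the remainder of its
  asymptotics.\<close>

lemma weighted_profile_bounds:
  fixes w :: "real \<Rightarrow> real"
  assumes f: "band_profile f" and [measurable]: "w \<in> borel_measurable borel"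
    and w: "\<And>\<rho>. \<rho> \<in> {1..2} \<Longrightarrow> \<bar>w \<rho>\<bar> \<le> b"
  defines "I \<equiv> \<lambda>t. \<integral>\<rho>. f \<rho> * complex_of_real (w \<rho>) * iexp (t * \<rho>\<^sup>2) \<partial>lborel"
  shows "cmod (I t) \<le> b" and "(\<integral>\<^sup>+t. ennreal ((cmod (I t))\<^sup>2) \<partial>lborel) \<le> ennreal (2 * pi * b\<^sup>2)"
proof -
  note [measurable] = band_profileD(1)[OF f]
  have b: "b \<ge> 0" using w[of 1] by simp
  have wf: "cmod (f \<rho> * complex_of_real (w \<rho>)) \<le> b * cmod (f \<rho>)" for \<rho>
  proof (cases "\<rho> \<in> {1..2}")
    case True then show ?thesis using mult_right_mono[OF w[OF True], of "cmod (f \<rho>)"] by (simp add: norm_mult mult.commute)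
  qed (simp add: band_profileD(2)[OF f])
  have i: "integrable lborel (\<lambda>\<rho>. f \<rho> * complex_of_real (w \<rho>))"
    by (rule Bochner_Integration.integrable_bound[where f = "\<lambda>\<rho>. b * cmod (f \<rho>)"])
       (use wf band_profileD(5)[OF f] b in auto)
  have i': "integrable lborel (\<lambda>\<rho>. f \<rho> * complex_of_real (w \<rho>) * iexp (t * \<rho>\<^sup>2))"
    by (rule Bochner_Integration.integrable_bound[OF i]) (auto simp: norm_mult)
  have "ennreal (cmod (I t)) \<le> (\<integral>\<^sup>+\<rho>. ennreal (cmod (f \<rho> * complex_of_real (w \<rho>) * iexp (t * \<rho>\<^sup>2))) \<partial>lborel)"
    unfolding I_def by (rule integral_norm_bound_ennreal[OF i'])
  also have "\<dots> \<le> (\<integral>\<^sup>+\<rho>. ennreal b * ennreal (cmod (f \<rho>)) \<partial>lborel)"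
    using wf b by (intro nn_integral_mono) (simp add: ennreal_mult'[symmetric] norm_mult)
  also have "\<dots> = ennreal b * (\<integral>\<^sup>+\<rho>. ennreal (cmod (f \<rho>)) \<partial>lborel)"
    by (rule nn_integral_cmult) measurable
  also have "\<dots> \<le> ennreal b * 1"
    by (rule mult_left_mono[OF band_profileD(6)[OF f]]) simp
  finally show "cmod (I t) \<le> b" using b by simp
  have "(\<integral>\<^sup>+t. ennreal ((cmod (I t))\<^sup>2) \<partial>lborel) \<le> ennreal (2 * pi) * (\<integral>\<^sup>+\<rho>. ennreal ((cmod (f \<rho> * complex_of_real (w \<rho>)))\<^sup>2) \<partial>lborel)"
    unfolding I_def by (rule fourier_extension_square_L2[OF i]) (use band_profileD(2)[OF f] in auto)
  also have "\<dots> \<le> ennreal (2 * pi) * (\<integral>\<^sup>+\<rho>. ennreal (b\<^sup>2) * ennreal ((cmod (f \<rho>))\<^sup>2) \<partial>lborel)"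
  proof (intro mult_left_mono nn_integral_mono)
    fix \<rho>
    have "(cmod (f \<rho> * complex_of_real (w \<rho>)))\<^sup>2 \<le> (b * cmod (f \<rho>))\<^sup>2"
      by (rule power_mono[OF wf]) simp
    then show "ennreal ((cmod (f \<rho> * complex_of_real (w \<rho>)))\<^sup>2) \<le> ennreal (b\<^sup>2) * ennreal ((cmod (f \<rho>))\<^sup>2)"
      by (simp add: ennreal_mult'[symmetric] power_mult_distrib)
  qed simp
  also have "(\<integral>\<^sup>+\<rho>. ennreal (b\<^sup>2) * ennreal ((cmod (f \<rho>))\<^sup>2) \<partial>lborel) = ennreal (b\<^sup>2) * (\<integral>\<^sup>+\<rho>. ennreal ((cmod (f \<rho>))\<^sup>2) \<partial>lborel)"
    by (rule nn_integral_cmult) measurable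
  also have "ennreal (2 * pi) * \<dots> \<le> ennreal (2 * pi) * (ennreal (b\<^sup>2) * 1)"
    using f unfolding band_profile_def by (intro mult_left_mono) auto
  finally show "(\<integral>\<^sup>+t. ennreal ((cmod (I t))\<^sup>2) \<partial>lborel) \<le> ennreal (2 * pi * b\<^sup>2)"
    by (simp add: ennreal_mult)
qed

text \<open>In polar coordinates the data carry the measure \<rho>^m d\<rho>. Half of the power is
  put into \<open>f\<close>, so that the norm of the data is, up to a constant, the plain L^2 norm
  of \<open>f\<close>. The other half stays with the kernel, where together with r^(m/2) it forms
  the amplitude (r \<rho>)^(m/2) of the Bessel asymptotics.\<close>

definition radial_propagator :: "nat \<Rightarrow> (real \<Rightarrow> complex) \<Rightarrow> real \<times> real \<Rightarrow> complex" where
  "radial_propagator m f = (\<lambda>(t, r).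
     \<integral>\<rho>. f \<rho> * complex_of_real (\<rho> powr (m / 2) * bessel_kernel m (r * \<rho>)) * iexp (t * \<rho>\<^sup>2) \<partial>lborel)"

lemma borel_measurable_bessel_kernel [measurable]:
  assumes "m > 0"
  shows "bessel_kernel m \<in> borel_measurable borel"
  using has_derivative_bessel_kernel[OF assms]
  by (intro borel_measurable_continuous_onI continuous_at_imp_continuous_on ballI) (blast intro: DERIV_isCont)

lemma borel_measurable_radial_propagator:
  assumes m: "m > 0" and [measurable]: "f \<in> borel_measurable borel"
  shows "radial_propagator m f \<in> borel_measurable borel"
proof -
  note [measurable] = borel_measurable_bessel_kernel[OF m]
  show ?thesis unfolding radial_propagator_def borel_prod[symmetric] by measurable
qed

text \<open>No decay of the kernel enters: \<rho>^(m/2) <= 2^(m/2) on the band and the kernel is at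
  most pi. These bounds serve for r < 1; the uniform one also serves to raise the exponent q and for
  q = \<infinity>.\<close>

lemma
  assumes m: "m > 0" and f: "band_profile f"
  shows radial_propagator_bound: "cmod (radial_propagator m f z) \<le> 2 powr (m / 2) * pi"
    and radial_propagator_time_L2: "(\<integral>\<^sup>+t. ennreal ((cmod (radial_propagator m f (t, r)))\<^sup>2) \<partial>lborel) \<le> ennreal (2 * pi * (2 powr (m / 2) * pi)\<^sup>2)"
proof -
  note [measurable] = borel_measurable_bessel_kernel[OF m]
  have b: "\<bar>\<rho> powr (m / 2) * bessel_kernel m (r * \<rho>)\<bar> \<le> 2 powr (m / 2) * pi" if "\<rho> \<in> {1..2}" for \<rho> r
    unfolding abs_mult using that bessel_kernel_bound[of m "r * \<rho>"]
    by (intro mult_mono) (auto intro!: powr_mono2)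
  show "cmod (radial_propagator m f z) \<le> 2 powr (m / 2) * pi"
    by (cases z) (simp only: radial_propagator_def prod.case, rule weighted_profile_bounds(1)[OF f _ b], measurable)
  show "(\<integral>\<^sup>+t. ennreal ((cmod (radial_propagator m f (t, r)))\<^sup>2) \<partial>lborel) \<le> ennreal (2 * pi * (2 powr (m / 2) * pi)\<^sup>2)"
    unfolding radial_propagator_def prod.case by (rule weighted_profile_bounds(2)[OF f _ b]) measurable
qed

section \<open>Estimates for radii at least 1\<close>

lemma nn_integral_powr_atLeast_1:
  fixes \<alpha> :: real
  assumes "\<alpha> > 1"
  shows "(\<integral>\<^sup>+r. ennreal (r powr - \<alpha>) * indicator {1..} r \<partial>lborel) = ennreal (1 / (\<alpha> - 1))"
proof -
  have "((\<lambda>r. r powr (1 - \<alpha>)) \<longlongrightarrow> 0) at_top"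
    using assms by (intro tendsto_neg_powr filterlim_ident) auto
  then have "((\<lambda>r. (- 1 / (\<alpha> - 1)) * r powr (1 - \<alpha>)) \<longlongrightarrow> (- 1 / (\<alpha> - 1)) * 0) at_top"
    by (intro tendsto_intros)
  moreover have "((\<lambda>r. (- 1 / (\<alpha> - 1)) * r powr (1 - \<alpha>)) has_real_derivative r powr - \<alpha>) (at r)" if "r \<ge> 1" for r
  proof -
    have "((\<lambda>r. (- 1 / (\<alpha> - 1)) * r powr (1 - \<alpha>)) has_real_derivative (- 1 / (\<alpha> - 1)) * ((1 - \<alpha>) * r powr (1 - \<alpha> - 1))) (at r)"
      by (rule DERIV_cmult[OF has_real_derivative_powr]) (use that in simp)
    moreover have "(- 1 / (\<alpha> - 1)) * (1 - \<alpha>) = 1" using assms by (simp add: field_simps)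
    then have "(- 1 / (\<alpha> - 1)) * ((1 - \<alpha>) * r powr (1 - \<alpha> - 1)) = r powr - \<alpha>"
      by (simp only: mult.assoc[symmetric]) simp
    ultimately show ?thesis by (simp only:)
  qed
  ultimately have "(\<integral>\<^sup>+r. ennreal (r powr - \<alpha>) * indicator {1..} r \<partial>lborel) = ennreal ((- 1 / (\<alpha> - 1)) * 0 - (- 1 / (\<alpha> - 1)) * 1 powr (1 - \<alpha>))"
    by (intro nn_integral_FTC_atLeast) auto
  then show ?thesis by simp
qed

lemma add3_power6_le:
  fixes x y z :: real
  assumes "x \<ge> 0" "y \<ge> 0" "z \<ge> 0"
  shows "(x + y + z) ^ 6 \<le> 729 * (x ^ 6 + y ^ 6 + z ^ 6)"
proof -
  define u where "u = max x (max y z)"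
  \<comment> \<open>The sum is at most three times its largest term, and 3^6 = 729.\<close>
  have "(x + y + z) ^ 6 \<le> (3 * u) ^ 6" using assms by (intro power_mono) (auto simp: u_def)
  also have "\<dots> = 729 * u ^ 6" by (simp add: power_mult_distrib)
  also have "u ^ 6 \<le> x ^ 6 + y ^ 6 + z ^ 6"
    unfolding u_def max_def by simp
  finally show ?thesis by simp
qed

text \<open>With the factor r^(m/2) the kernel becomes \<phi>(r \<rho>), where \<phi>(s) = s^(m/2)
  J(s) is bounded; this gives the first bound. For the second, \<phi>(s) = Im (e^(is) A) +
  \<psi>(s). The main part yields parabola extensions at (t, r) and (t, -r), which are in L^6. The
  remainder is O(1 / r) both uniformly and in L^2 of time, so its sixth power is treated as sup^4
  times square.\<close>

lemma radial_propagator_far: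
  assumes m: "m > 0"
  obtains D :: real where "D \<ge> 0"
    "\<And>f r. \<lbrakk>band_profile f; r \<ge> 1\<rbrakk> \<Longrightarrow>
       (\<integral>\<^sup>+t. ennreal ((r powr (m / 2) * cmod (radial_propagator m f (t, r)))\<^sup>2) \<partial>lborel) \<le> ennreal D"
    "\<And>f. band_profile f \<Longrightarrow>
       (\<integral>\<^sup>+r. (\<integral>\<^sup>+t. ennreal ((r powr (m / 2) * cmod (radial_propagator m f (t, r))) ^ 6) \<partial>lborel) * indicator {1..} r \<partial>lborel) \<le> ennreal D"
proof -
  define a where "a = real m / 2"
  obtain A B where B: "B \<ge> 0" and JB: "\<And>s. s > 0 \<Longrightarrow> \<bar>bessel_kernel m s\<bar> * s powr a \<le> B"
    and JA: "\<And>s. s \<ge> 1 \<Longrightarrow> \<bar>s powr a * bessel_kernel m s - Im (cis s * A)\<bar> \<le> B / s"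
    by (rule bessel_kernel_asymptotics[OF m, folded a_def]) (rule that)
  note [measurable] = borel_measurable_bessel_kernel[OF m]
  define \<phi> where "\<phi> = (\<lambda>s. s powr a * bessel_kernel m s)"
  have [measurable]: "\<phi> \<in> borel_measurable borel" unfolding \<phi>_def by measurable
  have \<phi>B: "\<bar>\<phi> s\<bar> \<le> B" if "s > 0" for s using JB[OF that] by (simp add: \<phi>_def abs_mult mult.commute)
  define \<psi> where "\<psi> = (\<lambda>s. \<phi> s - Im (cis s * A))"
  have [measurable]: "\<psi> \<in> borel_measurable borel" unfolding \<psi>_def cis_conv_exp by measurable
  have \<psi>B: "\<bar>\<psi> s\<bar> \<le> B / s" if "s \<ge> 1" for s using JA[OF that] by (simp add: \<psi>_def \<phi>_def)
  have T: "complex_of_real (r powr a) * radial_propagator m f (t, r) = (\<integral>\<rho>. f \<rho> * complex_of_real (\<phi> (r * \<rho>)) * iexp (t * \<rho>\<^sup>2) \<partial>lborel)"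
    if f: "band_profile f" and r: "r \<ge> 1" for f t r
  proof -
    have "complex_of_real (r powr a) * radial_propagator m f (t, r) = (\<integral>\<rho>. complex_of_real (r powr a) * (f \<rho> * complex_of_real (\<rho> powr a * bessel_kernel m (r * \<rho>)) * iexp (t * \<rho>\<^sup>2)) \<partial>lborel)"
      unfolding radial_propagator_def a_def by simp
    also have "\<dots> = (\<integral>\<rho>. f \<rho> * complex_of_real (\<phi> (r * \<rho>)) * iexp (t * \<rho>\<^sup>2) \<partial>lborel)"
    proof (rule Bochner_Integration.integral_cong[OF refl])
      fix \<rho> :: real
      show "complex_of_real (r powr a) * (f \<rho> * complex_of_real (\<rho> powr a * bessel_kernel m (r * \<rho>)) * iexp (t * \<rho>\<^sup>2))
        = f \<rho> * complex_of_real (\<phi> (r * \<rho>)) * iexp (t * \<rho>\<^sup>2)"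
      proof (cases "\<rho> \<in> {1..2}")
        case True
        then have "\<phi> (r * \<rho>) = r powr a * (\<rho> powr a * bessel_kernel m (r * \<rho>))"
          using r by (simp add: \<phi>_def powr_mult)
        then show ?thesis by simp
      qed (simp add: band_profileD(2)[OF f])
    qed
    finally show ?thesis .
  qed
  define C6 where "C6 = (2 * pi)\<^sup>2 * pi"
  \<comment> \<open>The first summand is the L^2 constant; the second adds the two parabola terms
    and the remainder, with 729 from the sixth power of a sum of three terms.\<close>
  define D where "D = 2 * pi * B\<^sup>2 + 729 * (2 * (cmod A ^ 6 * C6) + 2 * pi * B ^ 6)"
  have C6: "C6 \<ge> 0" by (simp add: C6_def)
  have D: "D \<ge> 0" "2 * pi * B\<^sup>2 \<le> D" "729 * (2 * (cmod A ^ 6 * C6) + 2 * pi * B ^ 6) \<le> D"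
    using B C6 by (auto simp: D_def)
  show thesis
  proof (rule that[OF D(1)])
    fix f r assume f: "band_profile f" and r: "r \<ge> (1::real)"
    have "(\<integral>\<^sup>+t. ennreal ((r powr (m / 2) * cmod (radial_propagator m f (t, r)))\<^sup>2) \<partial>lborel)
      = (\<integral>\<^sup>+t. ennreal ((cmod (\<integral>\<rho>. f \<rho> * complex_of_real (\<phi> (r * \<rho>)) * iexp (t * \<rho>\<^sup>2) \<partial>lborel))\<^sup>2) \<partial>lborel)"
      unfolding T[OF f r, symmetric] by (simp add: norm_mult a_def)
    also have "\<dots> \<le> ennreal (2 * pi * B\<^sup>2)"
      by (rule weighted_profile_bounds(2)[OF f]) (use r in \<open>auto intro!: \<phi>B mult_pos_pos\<close>)
    also have "\<dots> \<le> ennreal D" by (rule ennreal_leI[OF D(2)])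
    finally show "(\<integral>\<^sup>+t. ennreal ((r powr (m / 2) * cmod (radial_propagator m f (t, r)))\<^sup>2) \<partial>lborel) \<le> ennreal D" .
  next
    fix f assume f: "band_profile f"
    note [measurable] = band_profileD(1)[OF f]
    define E where "E = parabola_extension f"
    have [measurable]: "E \<in> borel_measurable borel" unfolding E_def parabola_extension_def borel_prod[symmetric] by measurable
    let ?E = "\<lambda>r. \<integral>\<^sup>+t. ennreal (cmod (E (t, r)) ^ 6) \<partial>lborel" and ?a = "ennreal (729 * cmod A ^ 6)"
    let ?T = "\<lambda>t r. r powr a * cmod (radial_propagator m f (t, r))"
    define e where "e = (\<lambda>t r. \<integral>\<rho>. f \<rho> * complex_of_real (\<psi> (r * \<rho>)) * iexp (t * \<rho>\<^sup>2) \<partial>lborel)"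
    have [measurable]: "(\<lambda>(t, r). e t r) \<in> borel_measurable (borel \<Otimes>\<^sub>M borel)" unfolding e_def by measurable
    \<comment> \<open>On the band r \<rho> >= r >= 1, so the remainder estimate applies and is
      uniform in \<rho>.\<close>
    have \<psi>b: "\<bar>\<psi> (r * \<rho>)\<bar> \<le> B / r" if "r \<ge> 1" "\<rho> \<in> {1..2}" for r \<rho>
    proof -
      have 1: "r * \<rho> \<ge> 1 * 1" "r * \<rho> \<ge> r * 1" using that mult_mono[of 1 r 1 \<rho>] mult_left_mono[of 1 \<rho> r] by auto
      then have "\<bar>\<psi> (r * \<rho>)\<bar> \<le> B / (r * \<rho>)" using \<psi>B[of "r * \<rho>"] by simp
      also have "\<dots> \<le> B / r" using 1 that B by (intro divide_left_mono) auto
      finally show ?thesis .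
    qed
    have decomp: "complex_of_real (r powr a) * radial_propagator m f (t, r) = A / (2 * \<i>) * E (t, r) - cnj A / (2 * \<i>) * E (t, - r) + e t r"
      if r: "r \<ge> 1" for t r
    proof -
      have iE: "integrable lborel (\<lambda>\<rho>. f \<rho> * iexp (t * \<rho>\<^sup>2 + x * \<rho>))" for x
        by (rule Bochner_Integration.integrable_bound[OF band_profileD(5)[OF f]]) (auto simp: norm_mult)
      have ie: "integrable lborel (\<lambda>\<rho>. f \<rho> * complex_of_real (\<psi> (r * \<rho>)) * iexp (t * \<rho>\<^sup>2))"
      proof (rule Bochner_Integration.integrable_bound[where f = "\<lambda>\<rho>. B / r * cmod (f \<rho>)"])
        show "AE \<rho> in lborel. cmod (f \<rho> * complex_of_real (\<psi> (r * \<rho>)) * iexp (t * \<rho>\<^sup>2)) \<le> norm (B / r * cmod (f \<rho>))"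
        proof (intro AE_I2)
          fix \<rho> :: real
          show "cmod (f \<rho> * complex_of_real (\<psi> (r * \<rho>)) * iexp (t * \<rho>\<^sup>2)) \<le> norm (B / r * cmod (f \<rho>))"
          proof (cases "\<rho> \<in> {1..2}")
            case True
            have "\<bar>\<psi> (r * \<rho>)\<bar> \<le> \<bar>B / r\<bar>" using \<psi>b[OF r True] by linarith
            from mult_right_mono[OF this, of "cmod (f \<rho>)"] show ?thesis by (simp add: norm_mult abs_mult mult.commute)
          qed (simp add: band_profileD(2)[OF f])
        qed
      qed (use band_profileD(5)[OF f] in auto)
      have "f \<rho> * complex_of_real (\<phi> (r * \<rho>)) * iexp (t * \<rho>\<^sup>2) = A / (2 * \<i>) * (f \<rho> * iexp (t * \<rho>\<^sup>2 + r * \<rho>))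
          - cnj A / (2 * \<i>) * (f \<rho> * iexp (t * \<rho>\<^sup>2 + (- r) * \<rho>)) + f \<rho> * complex_of_real (\<psi> (r * \<rho>)) * iexp (t * \<rho>\<^sup>2)" for \<rho>
      proof -
        have "cis (r * \<rho>) * A - cnj (cis (r * \<rho>) * A) = complex_of_real (2 * Im (cis (r * \<rho>) * A)) * \<i>"
          by (rule complex_diff_cnj)
        then have im: "complex_of_real (Im (cis (r * \<rho>) * A)) = (cis (r * \<rho>) * A - cis (- (r * \<rho>)) * cnj A) / (2 * \<i>)"
          by (simp add: field_simps cis_cnj)
        have 1: "complex_of_real (\<phi> (r * \<rho>)) = (cis (r * \<rho>) * A - cis (- (r * \<rho>)) * cnj A) / (2 * \<i>) + complex_of_real (\<psi> (r * \<rho>))"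
          unfolding \<psi>_def of_real_diff im by simp
        have 2: "iexp (t * \<rho>\<^sup>2 + r * \<rho>) = iexp (t * \<rho>\<^sup>2) * cis (r * \<rho>)" "iexp (t * \<rho>\<^sup>2 + (- r) * \<rho>) = iexp (t * \<rho>\<^sup>2) * cis (- (r * \<rho>))"
          by (simp_all add: cis_conv_exp exp_add[symmetric] algebra_simps)
        have "F * ((p * A - q * A') / c + s) * z = A / c * (F * (z * p)) - A' / c * (F * (z * q)) + F * s * z"
          for F p q s z c A' :: complex by (simp add: divide_inverse algebra_simps)
        then show ?thesis unfolding 1 2 .
      qed
      then show ?thesis unfolding T[OF f r] E_def parabola_extension_def e_def prod.case
        using iE[of r] iE[of "- r"] ie by simp
    qed
    have pw: "ennreal (?T t r ^ 6)
        \<le> ?a * ennreal (cmod (E (t, r)) ^ 6) + ?a * ennreal (cmod (E (t, - r)) ^ 6)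
          + ennreal (729 * (B / r) ^ 4) * ennreal ((cmod (e t r))\<^sup>2)" if r: "r \<ge> 1" for t r
    proof -
      have "?T t r = cmod (A / (2 * \<i>) * E (t, r) - cnj A / (2 * \<i>) * E (t, - r) + e t r)"
        unfolding decomp[OF r, symmetric] by (simp add: norm_mult)
      also have "\<dots> \<le> cmod (A / (2 * \<i>) * E (t, r)) + cmod (cnj A / (2 * \<i>) * E (t, - r)) + cmod (e t r)"
        by (meson add_right_mono norm_triangle_ineq norm_triangle_ineq4 order_trans)
      also have "\<dots> \<le> cmod A * cmod (E (t, r)) + cmod A * cmod (E (t, - r)) + cmod (e t r)"
        by (intro add_mono) (auto simp: norm_mult norm_divide)
      finally have "?T t r ^ 6 \<le> (cmod A * cmod (E (t, r)) + cmod A * cmod (E (t, - r)) + cmod (e t r)) ^ 6"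
        by (intro power_mono) auto
      also have "\<dots> \<le> 729 * ((cmod A * cmod (E (t, r))) ^ 6 + (cmod A * cmod (E (t, - r))) ^ 6 + cmod (e t r) ^ 6)"
        by (rule add3_power6_le) auto
      also have "cmod (e t r) ^ 6 \<le> (B / r) ^ 4 * (cmod (e t r))\<^sup>2"
      proof -
        have "cmod (e t r) \<le> B / r" unfolding e_def
          by (rule weighted_profile_bounds(1)[OF f]) (use r \<psi>b in auto)
        then have "cmod (e t r) ^ 4 * (cmod (e t r))\<^sup>2 \<le> (B / r) ^ 4 * (cmod (e t r))\<^sup>2"
          by (intro mult_right_mono power_mono) auto
        then show ?thesis by (simp flip: power_add)
      qed
      finally have "?T t r ^ 6 \<le>
         729 * cmod A ^ 6 * cmod (E (t, r)) ^ 6 + 729 * cmod A ^ 6 * cmod (E (t, - r)) ^ 6 + 729 * (B / r) ^ 4 * (cmod (e t r))\<^sup>2"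
        by (simp add: power_mult_distrib algebra_simps)
      then show ?thesis using B r
        by (simp add: ennreal_mult'[symmetric] ennreal_plus[symmetric] del: ennreal_plus)
    qed
    have E6: "(\<integral>\<^sup>+r. ?E r \<partial>lborel) \<le> ennreal C6"
    proof -
      have "(\<integral>\<^sup>+r. ?E r \<partial>lborel) = (\<integral>\<^sup>+z. ennreal (cmod (E z) ^ 6) \<partial>lborel)"
        by (subst lborel_prod[symmetric], subst lborel_pair.nn_integral_snd[symmetric]) (auto simp: lborel_prod)
      also have "\<dots> \<le> ennreal (C6 * (\<integral>\<rho>. (cmod (f \<rho>))\<^sup>2 \<partial>lborel) ^ 3)"
        unfolding E_def C6_def by (rule parabola_extension_L6) (use band_profileD[OF f] in auto)
      also have "\<dots> \<le> ennreal C6"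
        using band_profileD(4)[OF f] C6 by (intro ennreal_leI mult_left_le power_le_one) auto
      finally show ?thesis .
    qed
    have E6': "(\<integral>\<^sup>+r. ?E (- r) \<partial>lborel) = (\<integral>\<^sup>+r. ?E r \<partial>lborel)"
      by (subst (2) nn_integral_real_affine[of _ "-1" 0]) auto
    have e6: "(\<integral>\<^sup>+t. ennreal (729 * (B / r) ^ 4) * ennreal ((cmod (e t r))\<^sup>2) \<partial>lborel) \<le> ennreal (729 * 2 * pi * B ^ 6) * ennreal (r powr - 2)"
      if r: "r \<ge> 1" for r
    proof -
      have "(\<integral>\<^sup>+t. ennreal (729 * (B / r) ^ 4) * ennreal ((cmod (e t r))\<^sup>2) \<partial>lborel) = ennreal (729 * (B / r) ^ 4) * (\<integral>\<^sup>+t. ennreal ((cmod (e t r))\<^sup>2) \<partial>lborel)"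
        by (rule nn_integral_cmult) measurable
      also have "(\<integral>\<^sup>+t. ennreal ((cmod (e t r))\<^sup>2) \<partial>lborel) \<le> ennreal (2 * pi * (B / r)\<^sup>2)"
        unfolding e_def by (rule weighted_profile_bounds(2)[OF f]) (use r \<psi>b in auto)
      also have "ennreal (729 * (B / r) ^ 4) * ennreal (2 * pi * (B / r)\<^sup>2) = ennreal (729 * 2 * pi * (B / r) ^ 6)"
        using B r by (simp add: ennreal_mult'[symmetric] power_add[symmetric] mult_ac)
      \<comment> \<open>For r >= 1 the decay r^(-6) is weakened to r^(-2), whose integral over r >=
        1 is exactly 1.\<close>
      also have "\<dots> \<le> ennreal (729 * 2 * pi * B ^ 6 * r powr - 2)"
      proof (intro ennreal_leI)
        have "B ^ 6 / r ^ 6 \<le> B ^ 6 / r ^ 2" using r B by (intro divide_left_mono power_increasing) auto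
        also have "\<dots> = B ^ 6 * r powr - 2" using r by (simp add: powr_minus field_simps)
        finally have "B ^ 6 / r ^ 6 \<le> B ^ 6 * r powr - 2" .
        from mult_left_mono[OF this, of "729 * 2 * pi"]
        show "729 * 2 * pi * (B / r) ^ 6 \<le> 729 * 2 * pi * B ^ 6 * r powr - 2" by (simp add: power_divide mult.assoc)
      qed
      finally show ?thesis using B by (simp add: mult_left_mono ennreal_mult)
    qed
    have "(\<integral>\<^sup>+r. (\<integral>\<^sup>+t. ennreal (?T t r ^ 6) \<partial>lborel) * indicator {1..} r \<partial>lborel)
      \<le> (\<integral>\<^sup>+r. ?a * ?E r
           + ?a * ?E (- r)
           + ennreal (729 * 2 * pi * B ^ 6) * (ennreal (r powr - 2) * indicator {1..} r) \<partial>lborel)"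
    proof (rule nn_integral_mono)
      fix r :: real
      show "(\<integral>\<^sup>+t. ennreal (?T t r ^ 6) \<partial>lborel) * indicator {1..} r
        \<le> ?a * ?E r
           + ?a * ?E (- r)
           + ennreal (729 * 2 * pi * B ^ 6) * (ennreal (r powr - 2) * indicator {1..} r)"
      proof (cases "r \<ge> 1")
        case True
        have "(\<integral>\<^sup>+t. ennreal (?T t r ^ 6) \<partial>lborel)
          \<le> (\<integral>\<^sup>+t. ?a * ennreal (cmod (E (t, r)) ^ 6) + ?a * ennreal (cmod (E (t, - r)) ^ 6)
          + ennreal (729 * (B / r) ^ 4) * ennreal ((cmod (e t r))\<^sup>2) \<partial>lborel)"
          by (intro nn_integral_mono pw True)
        also have "\<dots> = ?a * ?E r
           + ?a * ?E (- r)
           + (\<integral>\<^sup>+t. ennreal (729 * (B / r) ^ 4) * ennreal ((cmod (e t r))\<^sup>2) \<partial>lborel)"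
          by (simp add: nn_integral_add nn_integral_cmult)
        also have "\<dots> \<le> ?a * ?E r
           + ?a * ?E (- r)
           + ennreal (729 * 2 * pi * B ^ 6) * ennreal (r powr - 2)"
          by (intro add_left_mono e6 True)
        finally show ?thesis using True by simp
      qed simp
    qed
    also have "\<dots> = ?a * (\<integral>\<^sup>+r. ?E r \<partial>lborel)
           + ?a * (\<integral>\<^sup>+r. ?E (- r) \<partial>lborel)
           + ennreal (729 * 2 * pi * B ^ 6) * (\<integral>\<^sup>+r. ennreal (r powr - 2) * indicator {1..} r \<partial>lborel)"
      by (simp add: nn_integral_add nn_integral_cmult)
    also have "\<dots> \<le> ?a * ennreal C6 + ?a * ennreal C6 + ennreal (729 * 2 * pi * B ^ 6) * ennreal 1"
      unfolding E6' using E6 nn_integral_powr_atLeast_1[of 2] by (intro add_mono mult_left_mono) auto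
    also have "\<dots> = ennreal (729 * (2 * (cmod A ^ 6 * C6) + 2 * pi * B ^ 6))"
      using B C6 by (simp add: ennreal_mult'[symmetric] ennreal_plus[symmetric] algebra_simps del: ennreal_plus)
    also have "\<dots> \<le> ennreal D" by (rule ennreal_leI[OF D(3)])
    finally show "(\<integral>\<^sup>+r. (\<integral>\<^sup>+t. ennreal ((r powr (m / 2) * cmod (radial_propagator m f (t, r))) ^ 6) \<partial>lborel) * indicator {1..} r \<partial>lborel) \<le> ennreal D"
      unfolding a_def .
  qed
qed

section \<open>Interpolation between L^2 and L^6\<close>

lemma powr_split_square:
  fixes x q :: real
  assumes "x \<ge> 0"
  shows "x powr q = x powr (q - 2) * x\<^sup>2"
proof (cases "x = 0")
  case False
  then have "x powr q = x powr (q - 2) * x powr 2" by (simp only: powr_add[symmetric]) simp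
  then show ?thesis using assms False by simp
qed simp

lemma powr_half_square:
  fixes x :: real
  assumes "x > 0"
  shows "(x powr (real m / 2))\<^sup>2 = x ^ m"
proof -
  have "(x powr (real m / 2))\<^sup>2 = x powr (real m)" unfolding power2_eq_square powr_add[symmetric] by simp
  then show ?thesis using powr_realpow[OF assms] by simp
qed

text \<open>If x^(q-2) <= r^(-\<alpha>), the quadratic term dominates. Otherwise the relation
  \<alpha> (6 - q) = 2 m (q - 2) turns the opposite inequality into x^(6-q) >= r^(-2m), and the
  sextic term dominates. Both terms equal x^q at the same value of x, which is where \<alpha> comes
  from.\<close>

lemma powr_interpolation:
  fixes x r q :: real
  assumes q: "2 < q" "q < 6" and x: "x \<ge> 0" and r: "r \<ge> 1"
  shows "x powr q \<le> r powr - (2 * m * (q - 2) / (6 - q)) * x\<^sup>2 + r powr (2 * m) * x ^ 6"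
proof (cases "x = 0")
  case False
  define \<alpha> where "\<alpha> = 2 * m * (q - 2) / (6 - q)"
  have \<alpha>: "\<alpha> * (6 - q) = 2 * m * (q - 2)" using q by (simp add: \<alpha>_def)
  have x0: "x > 0" using x False by simp
  show ?thesis
  proof (cases "x powr (q - 2) \<le> r powr - \<alpha>")
    case True
    have "x powr q = x powr (q - 2) * x\<^sup>2" using x by (rule powr_split_square)
    also have "\<dots> \<le> r powr - \<alpha> * x\<^sup>2" by (rule mult_right_mono[OF True]) simp
    finally show ?thesis by (simp add: \<alpha>_def add_increasing2)
  next
    case False
    then have "- \<alpha> * ln r < (q - 2) * ln x" using r x0 by (simp add: powr_def)
    then have "(- \<alpha> * ln r) * (6 - q) \<le> ((q - 2) * ln x) * (6 - q)" using q by (intro mult_right_mono) auto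
    also have "(- \<alpha> * ln r) * (6 - q) = - (\<alpha> * (6 - q)) * ln r" by simp
    also have "\<dots> = (q - 2) * (- 2 * m * ln r)" unfolding \<alpha> by simp
    also have "((q - 2) * ln x) * (6 - q) = (q - 2) * ((6 - q) * ln x)" by simp
    finally have "(q - 2) * (- 2 * m * ln r) \<le> (q - 2) * ((6 - q) * ln x)" .
    then have "- 2 * m * ln r \<le> (6 - q) * ln x" by (rule mult_left_le_imp_le) (use q in simp)
    then have "q * ln x \<le> 2 * m * ln r + 6 * ln x" by (simp add: algebra_simps)
    then have "x powr q \<le> r powr (2 * m) * x powr 6" using r x0 by (simp add: powr_def flip: exp_add)
    also have "x powr 6 = x ^ 6" using x0 by simp
    finally show ?thesis by (simp add: add_increasing)
  qed
qed simp

text \<open>The volume factor r^m is absorbed exactly: r^m x^2 = (r^(m/2) x)^2 and r^m r^(2m) x^6 =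
  (r^(m/2) x)^6. For fixed r >= 1 the quadratic term has bounded time integral and keeps the factor
  r^(-\<alpha>). For r < 1 the power q - 2 is estimated by the uniform bound.\<close>

lemma radial_propagator_Lq_small:
  fixes q :: real
  assumes m: "m > 0" and q: "2 + 4 / (2 * real m + 1) < q" "q < 6"
  obtains C :: real where "C \<ge> 0"
    "\<And>f. band_profile f \<Longrightarrow>
       (\<integral>\<^sup>+r. \<integral>\<^sup>+t. ennreal (cmod (radial_propagator m f (t, r)) powr q * r ^ m) * indicator {0<..} r \<partial>lborel \<partial>lborel) \<le> ennreal C"
proof -
  obtain D where D: "D \<ge> 0"
    and D2: "\<And>f r. \<lbrakk>band_profile f; r \<ge> 1\<rbrakk> \<Longrightarrow>
       (\<integral>\<^sup>+t. ennreal ((r powr (m / 2) * cmod (radial_propagator m f (t, r)))\<^sup>2) \<partial>lborel) \<le> ennreal D"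
    and D6: "\<And>f. band_profile f \<Longrightarrow>
       (\<integral>\<^sup>+r. (\<integral>\<^sup>+t. ennreal ((r powr (m / 2) * cmod (radial_propagator m f (t, r))) ^ 6) \<partial>lborel) * indicator {1..} r \<partial>lborel) \<le> ennreal D"
    by (rule radial_propagator_far[OF m]) (rule that)
  define K where "K = 2 powr (m / 2) * pi"
  have K: "K \<ge> 0" by (simp add: K_def)
  have q2: "q > 2" using q(1) by (smt (verit) divide_nonneg_nonneg of_nat_0_le_iff)
  define \<alpha> where "\<alpha> = 2 * real m * (q - 2) / (6 - q)"
  have \<alpha>: "\<alpha> > 1"
  proof -
    \<comment> \<open>The hypothesis on q, cleared of its denominator, is 6 - q < 2 m (q - 2), that
      is \<alpha> > 1.\<close>
    have "4 / (2 * real m + 1) < q - 2" using q(1) by simp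
    then have "4 < (q - 2) * (2 * real m + 1)" by (subst (asm) pos_divide_less_eq) auto
    then have "6 - q < 2 * real m * (q - 2)" by (simp add: algebra_simps)
    then show ?thesis using q(2) by (simp add: \<alpha>_def)
  qed
  define N where "N = K powr (q - 2) * (2 * pi * K\<^sup>2)"
  have N: "N \<ge> 0" by (simp add: N_def)
  \<comment> \<open>The summands come from r < 1, from the quadratic term with the integral of
    r^(-\<alpha>), and from the sextic term.\<close>
  define C where "C = N + D * (1 / (\<alpha> - 1)) + D"
  have C: "C \<ge> 0" using N D \<alpha> by (simp add: C_def)
  show thesis
  proof (rule that[OF C])
    fix f assume f: "band_profile f"
    note [measurable] = borel_measurable_radial_propagator[OF m band_profileD(1)[OF f]]
    let ?T = "\<lambda>t r. cmod (radial_propagator m f (t, r))"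
    let ?S = "\<lambda>r. \<integral>\<^sup>+t. ennreal ((r powr (m / 2) * ?T t r) ^ 6) \<partial>lborel"
    have TK: "?T t r \<le> K" for t r unfolding K_def by (rule radial_propagator_bound[OF m f])
    have TL2: "(\<integral>\<^sup>+t. ennreal ((?T t r)\<^sup>2) \<partial>lborel) \<le> ennreal (2 * pi * K\<^sup>2)" for r
      unfolding K_def by (rule radial_propagator_time_L2[OF m f])
    have "(\<integral>\<^sup>+t. ennreal (?T t r powr q * r ^ m) * indicator {0<..} r \<partial>lborel)
      \<le> ennreal N * indicator {0..1} r + ennreal D * (ennreal (r powr - \<alpha>) * indicator {1..} r)
        + ?S r * indicator {1..} r" (is "?L \<le> ?R") for r :: real
    proof -
      consider "r \<le> 0" | "0 < r" "r < 1" | "1 \<le> r" by linarith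
      then show ?thesis
      proof cases
        case 1
        then show ?thesis by simp
      next
        case 2
        have "?L \<le> (\<integral>\<^sup>+t. ennreal (K powr (q - 2)) * ennreal ((?T t r)\<^sup>2) \<partial>lborel)"
        proof (intro nn_integral_mono)
          fix t :: real
          have "?T t r powr q * r ^ m \<le> ?T t r powr q * 1"
            using 2 by (intro mult_left_mono power_le_one) auto
          also have "\<dots> = ?T t r powr (q - 2) * (?T t r)\<^sup>2"
            using powr_split_square[of "?T t r" q] by simp
          also have "\<dots> \<le> K powr (q - 2) * (?T t r)\<^sup>2"
            using q2 TK by (intro mult_right_mono powr_mono2) auto
          finally show "ennreal (?T t r powr q * r ^ m) * indicator {0<..} r \<le> ennreal (K powr (q - 2)) * ennreal ((?T t r)\<^sup>2)"
            using 2 by (simp add: ennreal_mult'[symmetric])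
        qed
        also have "\<dots> = ennreal (K powr (q - 2)) * (\<integral>\<^sup>+t. ennreal ((?T t r)\<^sup>2) \<partial>lborel)"
          by (rule nn_integral_cmult) measurable
        also have "\<dots> \<le> ennreal (K powr (q - 2)) * ennreal (2 * pi * K\<^sup>2)"
          by (intro mult_left_mono TL2) simp
        also have "\<dots> = ennreal N" by (simp add: N_def ennreal_mult'[symmetric])
        finally show ?thesis using 2 by simp
      next
        case 3
        have "?L \<le> (\<integral>\<^sup>+t. ennreal (r powr - \<alpha>) * ennreal ((r powr (m / 2) * ?T t r)\<^sup>2) + ennreal ((r powr (m / 2) * ?T t r) ^ 6) \<partial>lborel)"
        proof (intro nn_integral_mono)
          fix t :: real
          have r2: "(r powr (m / 2))\<^sup>2 = r ^ m"
            using 3 by (intro powr_half_square) simp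
          have "r powr (2 * real m) = r ^ (2 * m)" using 3 powr_realpow[of r "2 * m"] by simp
          then have r6: "(r powr (m / 2)) ^ 6 = r powr (2 * real m) * r ^ m"
            using power_mult[of "r powr (m / 2)" 2 3] unfolding r2 by (simp add: mult.commute flip: power_mult power_add)
          have "?T t r powr q * r ^ m \<le> (r powr - \<alpha> * (?T t r)\<^sup>2 + r powr (2 * real m) * ?T t r ^ 6) * r ^ m"
            unfolding \<alpha>_def using 3 by (intro mult_right_mono powr_interpolation q2 q(2)) auto
          also have "\<dots> = r powr - \<alpha> * (r powr (m / 2) * ?T t r)\<^sup>2 + (r powr (m / 2) * ?T t r) ^ 6"
            unfolding power_mult_distrib r2 r6 by (simp add: algebra_simps)
          finally show "ennreal (?T t r powr q * r ^ m) * indicator {0<..} r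
             \<le> ennreal (r powr - \<alpha>) * ennreal ((r powr (m / 2) * ?T t r)\<^sup>2) + ennreal ((r powr (m / 2) * ?T t r) ^ 6)"
            using 3 by (simp add: ennreal_mult'[symmetric] ennreal_plus[symmetric] del: ennreal_plus)
        qed
        also have "\<dots> = ennreal (r powr - \<alpha>) * (\<integral>\<^sup>+t. ennreal ((r powr (m / 2) * ?T t r)\<^sup>2) \<partial>lborel) + ?S r"
          by (simp add: nn_integral_add nn_integral_cmult)
        also have "\<dots> \<le> ennreal (r powr - \<alpha>) * ennreal D + ?S r"
          by (intro add_right_mono mult_left_mono D2[OF f 3]) simp
        finally show ?thesis using 3 by (simp add: mult.commute add_increasing add.assoc)
      qed
    qed
    then have "(\<integral>\<^sup>+r. \<integral>\<^sup>+t. ennreal (?T t r powr q * r ^ m) * indicator {0<..} r \<partial>lborel \<partial>lborel)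
      \<le> (\<integral>\<^sup>+r. ennreal N * indicator {0..1} r + ennreal D * (ennreal (r powr - \<alpha>) * indicator {1..} r)
        + ?S r * indicator {1..} r \<partial>lborel)"
      by (intro nn_integral_mono)
    also have "\<dots> = ennreal N * 1 + ennreal D * (\<integral>\<^sup>+r. ennreal (r powr - \<alpha>) * indicator {1..} r \<partial>lborel)
        + (\<integral>\<^sup>+r. ?S r * indicator {1..} r \<partial>lborel)"
      by (simp add: nn_integral_add nn_integral_cmult nn_integral_cmult_indicator)
    also have "\<dots> \<le> ennreal N * 1 + ennreal D * ennreal (1 / (\<alpha> - 1)) + ennreal D"
      unfolding nn_integral_powr_atLeast_1[OF \<alpha>] by (intro add_left_mono D6[OF f])
    also have "\<dots> = ennreal C"
      using D N \<alpha> by (simp add: C_def ennreal_mult'[symmetric] ennreal_plus[symmetric] del: ennreal_plus)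
    finally show "(\<integral>\<^sup>+r. \<integral>\<^sup>+t. ennreal (?T t r powr q * r ^ m) * indicator {0<..} r \<partial>lborel \<partial>lborel) \<le> ennreal C" .
  qed
qed

lemma radial_propagator_Lq:
  fixes q :: real
  assumes m: "m > 0" and q: "2 + 4 / (2 * real m + 1) < q"
  obtains C :: real where "C \<ge> 0"
    "\<And>f. band_profile f \<Longrightarrow>
       (\<integral>\<^sup>+r. \<integral>\<^sup>+t. ennreal (cmod (radial_propagator m f (t, r)) powr q * r ^ m) * indicator {0<..} r \<partial>lborel \<partial>lborel) \<le> ennreal C"
proof -
  \<comment> \<open>The value 5 lies below 6 and above the threshold, which is at most 2 + 4/3 since
    m >= 1. The excess q - p is paid for by the uniform bound.\<close>
  define p where "p = min q 5"
  have "4 / (2 * real m + 1) \<le> 4 / 3" using m by (intro divide_left_mono) auto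
  then have p: "2 + 4 / (2 * real m + 1) < p" "p < 6" "p \<le> q" using q by (auto simp: p_def)
  obtain C where C: "C \<ge> 0" and CB: "\<And>f. band_profile f \<Longrightarrow>
       (\<integral>\<^sup>+r. \<integral>\<^sup>+t. ennreal (cmod (radial_propagator m f (t, r)) powr p * r ^ m) * indicator {0<..} r \<partial>lborel \<partial>lborel) \<le> ennreal C"
    by (rule radial_propagator_Lq_small[OF m p(1,2)]) (rule that)
  define K where "K = 2 powr (m / 2) * pi"
  show thesis
  proof (rule that[of "K powr (q - p) * C"])
    fix f assume f: "band_profile f"
    note [measurable] = borel_measurable_radial_propagator[OF m band_profileD(1)[OF f]]
    let ?T = "\<lambda>t r. cmod (radial_propagator m f (t, r))"
    let ?I = "\<lambda>q. \<integral>\<^sup>+r. \<integral>\<^sup>+t. ennreal (?T t r powr q * r ^ m) * indicator {0<..} r \<partial>lborel \<partial>lborel"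
    have TK: "?T t r \<le> K" for t r unfolding K_def by (rule radial_propagator_bound[OF m f])
    have "?I q
      \<le> (\<integral>\<^sup>+r. \<integral>\<^sup>+t. ennreal (K powr (q - p)) * (ennreal (?T t r powr p * r ^ m) * indicator {0<..} r) \<partial>lborel \<partial>lborel)"
    proof (intro nn_integral_mono)
      fix r t :: real
      have "?T t r powr q * r ^ m \<le> K powr (q - p) * (?T t r powr p * r ^ m)" if "r > 0"
      proof -
        have "?T t r powr q = ?T t r powr (q - p) * ?T t r powr p" by (simp flip: powr_add)
        also have "\<dots> \<le> K powr (q - p) * ?T t r powr p" using TK p by (intro mult_right_mono powr_mono2) auto
        finally have "?T t r powr q * r ^ m \<le> K powr (q - p) * ?T t r powr p * r ^ m" using that by (intro mult_right_mono) auto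
        then show ?thesis by (simp add: mult.assoc)
      qed
      then show "ennreal (?T t r powr q * r ^ m) * indicator {0<..} r \<le> ennreal (K powr (q - p)) * (ennreal (?T t r powr p * r ^ m) * indicator {0<..} r)"
        by (auto simp: indicator_def ennreal_mult'[symmetric])
    qed
    also have "\<dots> = ennreal (K powr (q - p)) * ?I p"
      by (simp add: nn_integral_cmult)
    also have "\<dots> \<le> ennreal (K powr (q - p)) * ennreal C" by (intro mult_left_mono CB f) simp
    finally show "?I q \<le> ennreal (K powr (q - p) * C)"
      using C by (simp add: ennreal_mult)
  qed (use C in simp)
qed

text \<open>With f(\<sigma>) = k (M \<sigma>)^(m/2) h(M \<sigma>), the change of variables gives the
  squared norm k^2 / M times that of h in \<rho>^m d\<rho>. Hence k^2 = M / N normalises it to at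
  most 1. The prefactor M^((m+1)/2) sqrt N undoes k, using half of the power (M \<sigma>)^m and the
  Jacobian M.\<close>

lemma radial_profile_rescale:
  fixes h :: "real \<Rightarrow> complex" and M N :: real
  assumes m: "m > 0" and M: "M > 0" and N: "N > 0"
    and h [measurable]: "h \<in> borel_measurable borel" and supp: "\<And>\<rho>. \<rho> \<notin> {M..2 * M} \<Longrightarrow> h \<rho> = 0"
    and L2: "(\<integral>\<^sup>+\<rho>. ennreal ((cmod (h \<rho>))\<^sup>2 * \<rho> ^ m) * indicator {0<..} \<rho> \<partial>lborel) \<le> ennreal N"
  obtains f where "band_profile f"
    "\<And>t r. (\<integral>\<rho>. h \<rho> * complex_of_real (\<rho> ^ m * bessel_kernel m (r * \<rho>)) * iexp (t * \<rho>\<^sup>2) \<partial>lborel)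
       = complex_of_real (M powr ((real m + 1) / 2) * sqrt N) * radial_propagator m f (M\<^sup>2 * t, M * r)"
proof -
  define a where "a = real m / 2"
  define k where "k = sqrt (M / N)"
  let ?h = "\<lambda>\<rho>. ennreal ((cmod (h \<rho>))\<^sup>2 * \<rho> ^ m) * indicator {0<..} \<rho>"
  let ?\<kappa> = "complex_of_real (M powr ((real m + 1) / 2) * sqrt N)"
  have k: "k > 0" "k\<^sup>2 = M / N" using M N by (auto simp: k_def)
  define f where "f = (\<lambda>\<sigma>. complex_of_real (k * (M * \<sigma>) powr a) * h (M * \<sigma>))"
  have [measurable]: "f \<in> borel_measurable borel" unfolding f_def by measurable
  have z: "f \<sigma> = 0" if "\<sigma> \<notin> {1..2}" for \<sigma>
  proof -
    have "M * \<sigma> \<notin> {M..2 * M}" using that M by auto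
    then show ?thesis by (simp add: f_def supp)
  qed
  have "(\<integral>\<^sup>+\<sigma>. ennreal ((cmod (f \<sigma>))\<^sup>2) \<partial>lborel)
     = (\<integral>\<^sup>+\<sigma>. ennreal (M / N) * ?h (M * \<sigma>) \<partial>lborel)"
  proof (rule nn_integral_cong)
    fix \<sigma> :: real
    show "ennreal ((cmod (f \<sigma>))\<^sup>2) = ennreal (M / N) * ?h (M * \<sigma>)"
    proof (cases "\<sigma> \<in> {1..2}")
      case True
      then have p: "M * \<sigma> > 0" using M by simp
      have "((M * \<sigma>) powr a)\<^sup>2 = (M * \<sigma>) ^ m"
        unfolding a_def by (rule powr_half_square[OF p])
      then have "(cmod (f \<sigma>))\<^sup>2 = M / N * ((cmod (h (M * \<sigma>)))\<^sup>2 * (M * \<sigma>) ^ m)"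
        by (simp add: f_def norm_mult power_mult_distrib k mult_ac)
      then show ?thesis using p M N by (simp add: ennreal_mult'[symmetric])
    next
      case False
      then have "M * \<sigma> \<notin> {M..2 * M}" using M by auto
      then show ?thesis using z[OF False] by (simp add: supp)
    qed
  qed
  also have "\<dots> = ennreal (M / N) * (\<integral>\<^sup>+\<sigma>. ?h (M * \<sigma>) \<partial>lborel)"
    by (rule nn_integral_cmult) measurable
  also have "\<dots> = ennreal (1 / N) * (ennreal M * (\<integral>\<^sup>+\<sigma>. ?h (M * \<sigma>) \<partial>lborel))"
    using M N by (simp add: mult.assoc[symmetric] ennreal_mult'[symmetric])
  also have "ennreal M * (\<integral>\<^sup>+\<sigma>. ?h (M * \<sigma>) \<partial>lborel)
     = (\<integral>\<^sup>+\<rho>. ennreal ((cmod (h \<rho>))\<^sup>2 * \<rho> ^ m) * indicator {0<..} \<rho> \<partial>lborel)"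
    using M by (subst (2) nn_integral_real_affine[of _ M 0]) auto
  also have "ennreal (1 / N) * \<dots> \<le> ennreal (1 / N) * ennreal N" by (intro mult_left_mono L2) simp
  also have "\<dots> = 1" using N by (simp add: ennreal_mult'[symmetric])
  finally have bp: "band_profile f" using z unfolding band_profile_def by simp
  show thesis
  proof (rule that[OF bp])
    fix t r :: real
    have "(\<integral>\<rho>. h \<rho> * complex_of_real (\<rho> ^ m * bessel_kernel m (r * \<rho>)) * iexp (t * \<rho>\<^sup>2) \<partial>lborel)
      = M *\<^sub>R (\<integral>\<sigma>. h (M * \<sigma>) * complex_of_real ((M * \<sigma>) ^ m * bessel_kernel m (r * (M * \<sigma>))) * iexp (t * (M * \<sigma>)\<^sup>2) \<partial>lborel)"
      using M by (subst lborel_integral_real_affine[where c = M and t = 0]) auto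
    also have "\<dots> = (\<integral>\<sigma>. complex_of_real M * (h (M * \<sigma>) * complex_of_real ((M * \<sigma>) ^ m * bessel_kernel m (r * (M * \<sigma>))) * iexp (t * (M * \<sigma>)\<^sup>2)) \<partial>lborel)"
      by (simp add: scaleR_conv_of_real)
    also have "\<dots> = (\<integral>\<sigma>. ?\<kappa> * (f \<sigma> * complex_of_real (\<sigma> powr (m / 2) * bessel_kernel m (M * r * \<sigma>)) * iexp (M\<^sup>2 * t * \<sigma>\<^sup>2)) \<partial>lborel)"
    proof (rule Bochner_Integration.integral_cong[OF refl])
      fix \<sigma> :: real
      show "complex_of_real M * (h (M * \<sigma>) * complex_of_real ((M * \<sigma>) ^ m * bessel_kernel m (r * (M * \<sigma>))) * iexp (t * (M * \<sigma>)\<^sup>2))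
        = ?\<kappa> * (f \<sigma> * complex_of_real (\<sigma> powr (m / 2) * bessel_kernel m (M * r * \<sigma>)) * iexp (M\<^sup>2 * t * \<sigma>\<^sup>2))"
      proof (cases "\<sigma> \<in> {1..2}")
        case True
        then have \<sigma>: "\<sigma> > 0" by simp
        have "M powr ((real m + 1) / 2) * sqrt N * (k * (M * \<sigma>) powr a) * \<sigma> powr a = M * (M * \<sigma>) ^ m"
        proof -
          have "sqrt N * k = M powr (1 / 2)" using M N by (simp add: k_def powr_half_sqrt flip: real_sqrt_mult)
          moreover have "M powr ((real m + 1) / 2) * M powr (1 / 2) = M * M powr a"
            using M by (simp add: a_def powr_mult_base add_divide_distrib flip: powr_add) 
          moreover have "(M * \<sigma>) ^ m = ((M * \<sigma>) powr a)\<^sup>2"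
            unfolding a_def using M \<sigma> by (intro powr_half_square[symmetric]) simp
          moreover have "(M * \<sigma>) powr a = M powr a * \<sigma> powr a" using M \<sigma> by (simp add: powr_mult)
          moreover have "M powr ((real m + 1) / 2) * sqrt N * (k * (M * \<sigma>) powr a) * \<sigma> powr a
            = (M powr ((real m + 1) / 2) * (sqrt N * k)) * ((M * \<sigma>) powr a * \<sigma> powr a)" by (simp only: mult_ac)
          ultimately show ?thesis by (simp only: power2_eq_square mult_ac)
        qed
        then have 1: "?\<kappa> * (complex_of_real (k * (M * \<sigma>) powr a) * complex_of_real (\<sigma> powr (m / 2)))
          = complex_of_real M * complex_of_real ((M * \<sigma>) ^ m)"
          unfolding of_real_mult[symmetric] of_real_eq_iff a_def by (simp add: mult.assoc)
        have 2: "r * (M * \<sigma>) = M * r * \<sigma>" "t * (M * \<sigma>)\<^sup>2 = M\<^sup>2 * t * \<sigma>\<^sup>2"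
          by (simp_all add: power_mult_distrib)
        have "Q * (h (M * \<sigma>) * (P * J) * E) = X * (Y * h (M * \<sigma>) * (Z * J) * E)" if "X * (Y * Z) = Q * P" for X Y Z Q P J E :: complex
        proof -
          have "Q * (h (M * \<sigma>) * (P * J) * E) = (Q * P) * (h (M * \<sigma>) * J * E)" by (simp only: mult_ac)
          also have "\<dots> = X * (Y * h (M * \<sigma>) * (Z * J) * E)" unfolding that[symmetric] by (simp only: mult_ac)
          finally show ?thesis .
        qed
        from this[OF 1] show ?thesis unfolding 2 f_def of_real_mult[of "_ ^ m"] of_real_mult[of "\<sigma> powr _"] .
      next
        case False
        then have "M * \<sigma> \<notin> {M..2 * M}" using M by auto
        then show ?thesis using z[OF False] by (simp add: supp)
      qed
    qed
    also have "\<dots> = ?\<kappa> * radial_propagator m f (M\<^sup>2 * t, M * r)"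
      unfolding radial_propagator_def by simp
    finally show "(\<integral>\<rho>. h \<rho> * complex_of_real (\<rho> ^ m * bessel_kernel m (r * \<rho>)) * iexp (t * \<rho>\<^sup>2) \<partial>lborel)
       = ?\<kappa> * radial_propagator m f (M\<^sup>2 * t, M * r)" .
  qed
qed

text \<open>The exponent m + 3 counts 1 for dr, 2 for dt because time scales like the square of
  length, and m for the volume factor.\<close>

lemma nn_integral_rescale_radius_time:
  fixes G :: "real \<times> real \<Rightarrow> real"
  assumes M: "M > 0" and [measurable]: "G \<in> borel_measurable borel" and G: "\<And>z. G z \<ge> 0"
  shows "(\<integral>\<^sup>+r. \<integral>\<^sup>+t. ennreal (G (M\<^sup>2 * t, M * r) * r ^ m) * indicator {0<..} r \<partial>lborel \<partial>lborel)
    = ennreal (M powr - (real m + 3)) * (\<integral>\<^sup>+r. \<integral>\<^sup>+t. ennreal (G (t, r) * r ^ m) * indicator {0<..} r \<partial>lborel \<partial>lborel)"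
proof -
  let ?I = "\<integral>\<^sup>+r. \<integral>\<^sup>+t. ennreal (G (M\<^sup>2 * t, M * r) * r ^ m) * indicator {0<..} r \<partial>lborel \<partial>lborel"
  let ?J = "\<integral>\<^sup>+r. \<integral>\<^sup>+t. ennreal (G (t, r) * r ^ m) * indicator {0<..} r \<partial>lborel \<partial>lborel"
  have "?J
    = ennreal M * (\<integral>\<^sup>+r. \<integral>\<^sup>+t. ennreal (G (t, M * r) * (M * r) ^ m) * indicator {0<..} (M * r) \<partial>lborel \<partial>lborel)"
    using M by (subst nn_integral_real_affine[of _ M 0]) auto
  also have "\<dots> = ennreal M * (\<integral>\<^sup>+r. ennreal (M\<^sup>2) * (\<integral>\<^sup>+t. ennreal (G (M\<^sup>2 * t, M * r) * (M * r) ^ m) * indicator {0<..} (M * r) \<partial>lborel) \<partial>lborel)"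
    using M by (subst (2) nn_integral_real_affine[of _ "M\<^sup>2" 0]) auto
  also have "\<dots> = ennreal M * (\<integral>\<^sup>+r. ennreal (M\<^sup>2) * (\<integral>\<^sup>+t. ennreal (M ^ m) * (ennreal (G (M\<^sup>2 * t, M * r) * r ^ m) * indicator {0<..} r) \<partial>lborel) \<partial>lborel)"
  proof (intro arg_cong[where f = "\<lambda>x. ennreal M * x"] nn_integral_cong arg_cong[where f = "\<lambda>x. ennreal (M\<^sup>2) * x"])
    fix r t :: real
    show "ennreal (G (M\<^sup>2 * t, M * r) * (M * r) ^ m) * indicator {0<..} (M * r) = ennreal (M ^ m) * (ennreal (G (M\<^sup>2 * t, M * r) * r ^ m) * indicator {0<..} r)"
      using M G by (auto simp: indicator_def zero_less_mult_iff power_mult_distrib ennreal_mult'[symmetric] mult_ac)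
  qed
  also have "\<dots> = ennreal M * (ennreal (M\<^sup>2) * (ennreal (M ^ m) * ?I))"
    by (simp add: nn_integral_cmult)
  also have "\<dots> = ennreal (M powr (real m + 3)) * ?I"
  proof -
    have "M powr (real m + 3) = M * (M\<^sup>2 * M ^ m)"
      using M by (simp add: powr_add powr_realpow power2_eq_square power3_eq_cube)
    then show ?thesis using M by (simp add: ennreal_mult mult.assoc)
  qed
  finally have *: "?J
    = ennreal (M powr (real m + 3)) * ?I" .
  have "M powr - (real m + 3) * M powr (real m + 3) = 1"
    unfolding powr_add[symmetric] using M by simp
  then have "ennreal (M powr - (real m + 3)) * ennreal (M powr (real m + 3)) = 1"
    by (simp only: ennreal_mult'[symmetric] powr_ge_zero ennreal_1)
  then show ?thesis unfolding * mult.assoc[symmetric] by (simp only: mult_1)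
qed

subsection \<open>Radial Fourier integrals and profiles\<close>

text \<open>The reflection \<theta> to pi - \<theta> changes the sign of cos \<theta> and keeps sin
  \<theta>, so the imaginary part cancels and the cosine integral remains.\<close>

lemma integral_sphere_eq_bessel_kernel:
  assumes m: "m > 0"
  shows "(\<integral>\<theta>. indicator {0..pi} \<theta> *\<^sub>R (complex_of_real (sin \<theta> ^ (m - 1)) * iexp (- (r * cos \<theta>))) \<partial>lborel)
    = complex_of_real (bessel_kernel m r)"
proof -
  define S where "S = (\<lambda>\<theta>. indicator {0..pi} \<theta> * (sin (r * cos \<theta>) * sin \<theta> ^ (m - 1)))"
  define D where "D = (\<lambda>\<theta>. indicator {0..pi} \<theta> * (cos (r * cos \<theta>) * sin \<theta> ^ (m - 1)))"
  have "continuous_on {0..pi} (\<lambda>\<theta>. sin (r * cos \<theta>) * sin \<theta> ^ (m - 1))" by (intro continuous_intros)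
  from borel_integrable_atLeastAtMost'[OF this] have Si: "integrable lborel S"
    unfolding S_def set_integrable_def by simp
  have "continuous_on {0..pi} (\<lambda>\<theta>. cos (r * cos \<theta>) * sin \<theta> ^ (m - 1))" by (intro continuous_intros)
  note Di' = borel_integrable_atLeastAtMost'[OF this]
  then have Di: "integrable lborel D" unfolding D_def set_integrable_def by simp
  have "integral\<^sup>L lborel S = (\<integral>\<theta>. S (pi + (- 1) * \<theta>) \<partial>lborel)"
    by (subst lborel_integral_real_affine[of "-1" _ pi]) auto
  also have "\<dots> = (\<integral>\<theta>. - S \<theta> \<partial>lborel)"
    by (intro Bochner_Integration.integral_cong refl)
       (auto simp: S_def indicator_def cos_diff sin_diff)
  finally have S0: "integral\<^sup>L lborel S = 0" by simp
  have D0: "integral\<^sup>L lborel D = bessel_kernel m r"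
    using set_borel_integral_eq_integral(2)[OF Di']
    by (simp add: D_def set_lebesgue_integral_def bessel_kernel_def)
  have "(\<integral>\<theta>. indicator {0..pi} \<theta> *\<^sub>R (complex_of_real (sin \<theta> ^ (m - 1)) * iexp (- (r * cos \<theta>))) \<partial>lborel)
    = (\<integral>\<theta>. complex_of_real (D \<theta>) - \<i> * complex_of_real (S \<theta>) \<partial>lborel)"
  proof (rule Bochner_Integration.integral_cong[OF refl])
    fix \<theta> :: real
    have 1: "iexp (- (r * cos \<theta>)) = complex_of_real (cos (r * cos \<theta>)) - \<i> * complex_of_real (sin (r * cos \<theta>))"
      unfolding cis_conv_exp[symmetric] by (simp add: complex_eq_iff)
    show "indicator {0..pi} \<theta> *\<^sub>R (complex_of_real (sin \<theta> ^ (m - 1)) * iexp (- (r * cos \<theta>)))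
      = complex_of_real (D \<theta>) - \<i> * complex_of_real (S \<theta>)"
      unfolding 1 by (auto simp: S_def D_def indicator_def algebra_simps)
  qed
  also have "\<dots> = complex_of_real (integral\<^sup>L lborel D) - \<i> * complex_of_real (integral\<^sup>L lborel S)"
    using Si Di by simp
  finally show ?thesis using S0 D0 by simp
qed

text \<open>The slicing formula concerns nonnegative integrands. It is transferred to oscillating
  ones by reading it on indicators as an equality of two image measures on the plane of pairs
  (\<open>\<xi> \<bullet> e\<close>, norm), after which Bochner integrals and integrability carry
  over. Vanishing of \<open>k\<close> for s <= 0 matches the half-line s > 0 of the slices with the
  full line on the right.\<close>

lemma integral_radial_iexp_axis:
  fixes e :: "'a::euclidean_space" and k :: "real \<Rightarrow> complex"
  assumes e: "e \<in> Basis" and d: "DIM('a) = Suc m" "m > 0"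
    and [measurable]: "k \<in> borel_measurable borel" and k0: "\<And>s. s \<le> 0 \<Longrightarrow> k s = 0"
    and int: "integrable lborel (\<lambda>\<xi>::'a. k (norm \<xi>))"
  shows "(\<integral>\<xi>. iexp (r * (\<xi> \<bullet> e)) * k (norm \<xi>) \<partial>lborel)
    = complex_of_real (unit_ball_vol m * m) * (\<integral>s. k s * complex_of_real (s ^ m * bessel_kernel m (r * s)) \<partial>lborel)"
proof -
  define V where "V = unit_ball_vol (real m) * real m"
  have V: "V \<ge> 0" by (simp add: V_def)
  define w where "w = (\<lambda>(s, \<theta>). V * s ^ m * sin \<theta> ^ (m - 1) * indicator {0..pi} \<theta> * indicator {0<..} s)"
  have [measurable]: "w \<in> borel_measurable (lborel \<Otimes>\<^sub>M lborel)" unfolding w_def by measurable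
  have w0: "w p \<ge> 0" for p
    using V by (cases p) (auto simp: w_def indicator_def intro!: mult_nonneg_nonneg zero_le_power sin_ge_zero)
  define \<Phi> where "\<Phi> = (\<lambda>(s, \<theta>). (- s * cos \<theta>, s :: real))"
  have \<Phi> [measurable]: "\<Phi> \<in> (lborel \<Otimes>\<^sub>M lborel) \<rightarrow>\<^sub>M (borel \<Otimes>\<^sub>M borel)" unfolding \<Phi>_def by measurable
  have \<Phi>d: "\<Phi> \<in> density (lborel \<Otimes>\<^sub>M lborel) (\<lambda>p. ennreal (w p)) \<rightarrow>\<^sub>M (borel \<Otimes>\<^sub>M borel)"
    by (subst measurable_cong_sets[OF sets_density refl]) (rule \<Phi>)
  define \<Psi> where "\<Psi> = (\<lambda>\<xi>::'a. (\<xi> \<bullet> e, norm \<xi>))"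
  have [measurable]: "\<Psi> \<in> borel \<rightarrow>\<^sub>M (borel \<Otimes>\<^sub>M borel)" unfolding \<Psi>_def by measurable
  let ?N = "distr lborel (borel \<Otimes>\<^sub>M borel) \<Psi>" and ?W = "density (lborel \<Otimes>\<^sub>M lborel) (\<lambda>p. ennreal (w p))"
  have eq: "?N = distr ?W (borel \<Otimes>\<^sub>M borel) \<Phi>"
  proof (rule measure_eqI)
    fix X assume "X \<in> sets ?N"
    then have X: "X \<in> sets (borel \<Otimes>\<^sub>M borel)" by simp
    have [measurable]: "(\<lambda>p. indicator X (\<Phi> p) :: ennreal) \<in> borel_measurable (lborel \<Otimes>\<^sub>M lborel)"
      by (rule measurable_compose[OF \<Phi> borel_measurable_indicator[OF X]])
    from X have Xb [measurable]: "X \<in> sets borel" by (subst (asm) borel_prod)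
    have "emeasure ?N X = (\<integral>\<^sup>+y. indicator X y \<partial>?N)"
      using X by simp
    also have "\<dots> = (\<integral>\<^sup>+\<xi>. indicator X (\<xi> \<bullet> e, norm \<xi>) \<partial>lborel)"
      using X by (subst nn_integral_distr) (auto simp: \<Psi>_def)
    also have "\<dots> = (\<integral>\<^sup>+s. \<integral>\<^sup>+\<theta>. indicator X (- s * cos \<theta>, s) * (ennreal (unit_ball_vol m * m * s ^ m * sin \<theta> ^ (m - 1)) * indicator {0..pi} \<theta> * indicator {0<..} s) \<partial>lborel \<partial>lborel)"
      by (rule nn_integral_slice_angle[OF _ e d]) simp
    also have "\<dots> = (\<integral>\<^sup>+s. \<integral>\<^sup>+\<theta>. ennreal (w (s, \<theta>)) * indicator X (\<Phi> (s, \<theta>)) \<partial>lborel \<partial>lborel)"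
      by (intro nn_integral_cong) (auto simp: w_def V_def \<Phi>_def indicator_def)
    also have "\<dots> = (\<integral>\<^sup>+p. ennreal (w p) * indicator X (\<Phi> p) \<partial>(lborel \<Otimes>\<^sub>M lborel))"
      by (intro lborel.nn_integral_fst) measurable
    also have "\<dots> = (\<integral>\<^sup>+p. indicator X (\<Phi> p) \<partial>?W)"
      by (intro nn_integral_density[symmetric]) measurable
    also have "\<dots> = (\<integral>\<^sup>+y. indicator X y \<partial>distr ?W (borel \<Otimes>\<^sub>M borel) \<Phi>)"
      by (subst nn_integral_distr[OF \<Phi>d]) (use X in simp_all)
    finally show "emeasure ?N X = emeasure (distr ?W (borel \<Otimes>\<^sub>M borel) \<Phi>) X"
      using X by simp
  qed simp
  define F where "F = (\<lambda>(u, s). iexp (r * u) * k s)"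
  have [measurable]: "F \<in> borel_measurable (borel \<Otimes>\<^sub>M borel)" unfolding F_def by measurable
  have "integrable lborel (\<lambda>\<xi>. F (\<Psi> \<xi>))"
    by (rule Bochner_Integration.integrable_bound[OF int]) (auto simp: F_def \<Psi>_def norm_mult)
  then have "integrable ?N F"
    by (subst integrable_distr_eq) auto
  then have "integrable ?W (\<lambda>p. F (\<Phi> p))"
    unfolding eq by (subst (asm) integrable_distr_eq) auto
  then have wi: "integrable (lborel \<Otimes>\<^sub>M lborel) (\<lambda>p. w p *\<^sub>R F (\<Phi> p))"
    by (subst (asm) integrable_density) (auto simp: w0)
  have "(\<integral>\<xi>. iexp (r * (\<xi> \<bullet> e)) * k (norm \<xi>) \<partial>lborel) = (\<integral>\<xi>. F (\<Psi> \<xi>) \<partial>lborel)"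
    by (simp add: F_def \<Psi>_def)
  also have "\<dots> = integral\<^sup>L ?N F"
    by (subst integral_distr) auto
  also have "\<dots> = (\<integral>p. F (\<Phi> p) \<partial>?W)"
    unfolding eq by (subst integral_distr) auto
  also have "\<dots> = (\<integral>p. w p *\<^sub>R F (\<Phi> p) \<partial>(lborel \<Otimes>\<^sub>M lborel))"
    by (subst integral_density) (auto simp: w0)
  also have "\<dots> = (\<integral>s. \<integral>\<theta>. w (s, \<theta>) *\<^sub>R F (\<Phi> (s, \<theta>)) \<partial>lborel \<partial>lborel)"
    by (rule lborel_pair.integral_fst'[OF wi, symmetric])
  also have "\<dots> = (\<integral>s. complex_of_real V * (k s * complex_of_real (s ^ m * bessel_kernel m (r * s))) \<partial>lborel)"
  proof (rule Bochner_Integration.integral_cong[OF refl])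
    fix s :: real
    show "(\<integral>\<theta>. w (s, \<theta>) *\<^sub>R F (\<Phi> (s, \<theta>)) \<partial>lborel) = complex_of_real V * (k s * complex_of_real (s ^ m * bessel_kernel m (r * s)))"
    proof (cases "s > 0")
      case True
      have eqw: "w (s, \<theta>) *\<^sub>R F (\<Phi> (s, \<theta>)) = complex_of_real V * (k s * complex_of_real (s ^ m)) *
         (indicator {0..pi} \<theta> *\<^sub>R (complex_of_real (sin \<theta> ^ (m - 1)) * iexp (- ((r * s) * cos \<theta>))))" for \<theta>
        using True by (auto simp: w_def F_def \<Phi>_def scaleR_conv_of_real indicator_def mult_ac)
      show ?thesis
        unfolding eqw integral_mult_right_zero integral_sphere_eq_bessel_kernel[OF d(2)] by simp
    next
      case False
      then show ?thesis by (simp add: w_def k0)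
    qed
  qed
  also have "\<dots> = complex_of_real V * (\<integral>s. k s * complex_of_real (s ^ m * bessel_kernel m (r * s)) \<partial>lborel)"
    by simp
  finally show ?thesis unfolding V_def .
qed

text \<open>A rotation carrying the axis to the direction of \<open>x\<close> preserves Lebesgue
  measure and the radial factor, so the axis case suffices.\<close>

lemma integral_radial_iexp:
  fixes x :: "real ^ 'd" and k :: "real \<Rightarrow> complex"
  assumes d: "CARD('d) = Suc m" "m > 0"
    and [measurable]: "k \<in> borel_measurable borel" and k0: "\<And>s. s \<le> 0 \<Longrightarrow> k s = 0"
    and int: "integrable lborel (\<lambda>\<xi>::real ^ 'd. k (norm \<xi>))"
  shows "(\<integral>\<xi>. iexp (x \<bullet> \<xi>) * k (norm \<xi>) \<partial>lborel)
    = complex_of_real (unit_ball_vol m * m) * (\<integral>s. k s * complex_of_real (s ^ m * bessel_kernel m (norm x * s)) \<partial>lborel)"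
proof -
  define e :: "real ^ 'd" where "e = axis undefined 1"
  have e: "e \<in> Basis" "norm e = 1" by (auto simp: e_def axis_in_Basis_iff norm_axis_1)
  obtain T where T: "orthogonal_transformation T" "T (norm x *\<^sub>R e) = x"
    by (rule orthogonal_transformation_exists[of "norm x *\<^sub>R e" x]) (use e in auto)
  have [measurable]: "T \<in> borel_measurable borel"
    using T(1) by (intro borel_measurable_continuous_onI linear_continuous_on linear_conv_bounded_linear[THEN iffD1] orthogonal_transformation_linear)
  have Tx: "x \<bullet> T \<xi> = norm x * (\<xi> \<bullet> e)" for \<xi>
  proof -
    have "x \<bullet> T \<xi> = T (norm x *\<^sub>R e) \<bullet> T \<xi>" by (simp add: T)
    also have "\<dots> = (norm x *\<^sub>R e) \<bullet> \<xi>" using T(1) by (auto simp: orthogonal_transformation_def)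
    finally show ?thesis by (simp add: inner_commute)
  qed
  have "(\<integral>\<xi>. iexp (x \<bullet> \<xi>) * k (norm \<xi>) \<partial>lborel) = (\<integral>\<xi>. iexp (norm x * (\<xi> \<bullet> e)) * k (norm \<xi>) \<partial>lborel)"
    by (subst distr_lborel_orthogonal[OF T(1), symmetric], subst integral_distr)
       (auto simp: Tx orthogonal_transformation_norm[OF T(1)])
  also have "\<dots> = complex_of_real (unit_ball_vol m * m) * (\<integral>s. k s * complex_of_real (s ^ m * bessel_kernel m (norm x * s)) \<partial>lborel)"
    by (rule integral_radial_iexp_axis[OF e(1) _ d(2) _ k0 int]) (use d in auto)
  finally show ?thesis .
qed

section \<open>Borel profiles of radial functions\<close>

lemma completion_ex_borel_measurable_complex:
  fixes g :: "'a \<Rightarrow> complex"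
  assumes [measurable]: "g \<in> borel_measurable (completion M)"
  shows "\<exists>g'\<in>borel_measurable M. AE x in M. g x = g' x"
proof -
  obtain a where a [measurable]: "a \<in> borel_measurable M" "AE x in M. Re (g x) = a x"
    using completion_ex_borel_measurable_real[of "\<lambda>x. Re (g x)" M] by auto
  obtain b where b [measurable]: "b \<in> borel_measurable M" "AE x in M. Im (g x) = b x"
    using completion_ex_borel_measurable_real[of "\<lambda>x. Im (g x)" M] by auto
  have "(\<lambda>x. complex_of_real (a x) + \<i> * complex_of_real (b x)) \<in> borel_measurable M" by measurable
  moreover have "AE x in M. g x = complex_of_real (a x) + \<i> * complex_of_real (b x)"
    using a(2) b(2) by eventually_elim (simp add: complex_eq_iff)
  ultimately show ?thesis
    by (intro bexI[where x = "\<lambda>x. complex_of_real (a x) + \<i> * complex_of_real (b x)"])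
qed

text \<open>A Lebesgue measurable set is a countable union of compact sets up to a null set, and the image
  of a compact set under the norm is compact. Hence a radial Lebesgue measurable function has a Borel
  measurable radial profile, although the given profile need not be measurable.\<close>

lemma norm_vimage_lebesgue_inner:
  fixes E :: "real set"
  assumes "(norm :: 'a::euclidean_space \<Rightarrow> real) -` E \<in> sets lebesgue"
  obtains E1 where "E1 \<in> sets borel" "E1 \<subseteq> E" "(norm :: 'a \<Rightarrow> real) -` (E - E1) \<in> null_sets lebesgue"
proof -
  obtain C T where C: "fsigma C" "T \<in> null_sets lebesgue" "C \<union> T = (norm :: 'a \<Rightarrow> real) -` E" "disjnt C T"
    by (rule lebesgue_set_almost_fsigma[OF assms])
  then obtain F :: "nat \<Rightarrow> 'a set" where F: "range F \<subseteq> Collect compact" "C = \<Union> (range F)"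
    unfolding fsigma_Union_compact by blast
  define E1 where "E1 = (\<Union>n. norm ` F n)"
  have "compact (norm ` F n)" for n
    using F(1) by (intro compact_continuous_image continuous_intros) auto
  then have "E1 \<in> sets borel" unfolding E1_def
    by (intro sets.countable_UN) (auto intro: borel_compact)
  moreover have "E1 \<subseteq> E" unfolding E1_def using C(3) F(2) by auto
  moreover have "(norm :: 'a \<Rightarrow> real) -` (E - E1) \<subseteq> T"
    unfolding E1_def using C(3) F(2) by blast
  then have "(norm :: 'a \<Rightarrow> real) -` (E - E1) \<in> null_sets lebesgue"
    using C(2) by (meson null_sets_completion_subset)
  ultimately show thesis by (rule that)
qed

text \<open>Let \<nu> be the image of Lebesgue measure under the norm. Inner approximation of a
  preimage of \<open>h\<close> and of its complement encloses it between two Borel sets with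
  \<nu>-null difference. Hence \<open>h\<close> is measurable for the completion of \<nu> and agrees
  \<nu>-almost everywhere with a Borel function.\<close>

lemma radial_borel_profile:
  fixes g :: "'a::euclidean_space \<Rightarrow> complex"
  assumes g [measurable]: "g \<in> borel_measurable lebesgue" and h: "AE \<xi> in lebesgue. g \<xi> = h (norm \<xi>)"
  obtains k where "k \<in> borel_measurable borel" "AE \<xi> in lebesgue. g \<xi> = k (norm \<xi>)"
proof -
  define \<nu> where "\<nu> = distr lborel borel (norm :: 'a \<Rightarrow> real)"
  have [measurable_cong, simp]: "sets \<nu> = sets borel" and [simp]: "space \<nu> = UNIV" by (simp_all add: \<nu>_def)
  have norm_meas: "(norm :: 'a \<Rightarrow> real) \<in> borel \<rightarrow>\<^sub>M borel" by measurable
  have leb: "(norm :: 'a \<Rightarrow> real) -` (h -` B) \<in> sets lebesgue" if [measurable]: "B \<in> sets borel" for B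
  proof -
    \<comment> \<open>Only \<open>g\<close> is known to be measurable. Completeness of Lebesgue
      measure passes measurability to the composite of \<open>h\<close> with the norm, which differs
      from \<open>g\<close> on a null set.\<close>
    have "AE \<xi> in lborel. (g \<xi> \<in> B) = (h (norm \<xi>) \<in> B)"
      using h unfolding AE_completion_iff by eventually_elim simp
    then have "AE \<xi> in lborel. \<not> ((g \<xi> \<in> B) \<noteq> (h (norm \<xi>) \<in> B))" by simp
    then have [measurable]: "Measurable.pred lebesgue (\<lambda>\<xi>. (g \<xi> \<in> B) \<noteq> (h (norm \<xi>) \<in> B))"
      by (rule sets_completion_AE)
    have "Measurable.pred lebesgue (\<lambda>\<xi>. (g \<xi> \<in> B) \<noteq> ((g \<xi> \<in> B) \<noteq> (h (norm \<xi>) \<in> B)))"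
      by measurable
    moreover have "(\<lambda>\<xi>. (g \<xi> \<in> B) \<noteq> ((g \<xi> \<in> B) \<noteq> (h (norm \<xi>) \<in> B))) = (\<lambda>\<xi>. h (norm \<xi>) \<in> B)" by auto
    ultimately have "Measurable.pred lebesgue (\<lambda>\<xi>::'a. h (norm \<xi>) \<in> B)" by simp
    then show ?thesis by (simp add: pred_def vimage_def)
  qed
  have "h \<in> borel_measurable (completion \<nu>)"
  proof (rule measurableI)
    fix B :: "complex set" assume B: "B \<in> sets borel"
    define E where "E = h -` B"
    obtain E1 where E1: "E1 \<in> sets borel" "E1 \<subseteq> E" "(norm :: 'a \<Rightarrow> real) -` (E - E1) \<in> null_sets lebesgue"
      unfolding E_def by (rule norm_vimage_lebesgue_inner[OF leb[OF B]])
    have "- E = h -` (- B)" by (auto simp: E_def)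
    then have "(norm :: 'a \<Rightarrow> real) -` (- E) \<in> sets lebesgue" using leb[of "- B"] B by simp
    then obtain E2 where E2: "E2 \<in> sets borel" "E2 \<subseteq> - E" "(norm :: 'a \<Rightarrow> real) -` (- E - E2) \<in> null_sets lebesgue"
      by (rule norm_vimage_lebesgue_inner)
    have m: "- E2 - E1 \<in> sets borel" using E1 E2 by auto
    have "(norm :: 'a \<Rightarrow> real) -` (- E2 - E1) \<subseteq> norm -` (E - E1) \<union> norm -` (- E - E2)" by auto
    moreover have "(norm :: 'a \<Rightarrow> real) -` (E - E1) \<union> norm -` (- E - E2) \<in> null_sets lebesgue"
      using E1 E2 by auto
    ultimately have "(norm :: 'a \<Rightarrow> real) -` (- E2 - E1) \<in> null_sets lebesgue"
      by (meson null_sets_completion_subset)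
    moreover have "(norm :: 'a \<Rightarrow> real) -` (- E2 - E1) \<in> sets lborel"
      using measurable_sets[OF norm_meas, of "- E2 - E1"] m by simp
    ultimately have "(norm :: 'a \<Rightarrow> real) -` (- E2 - E1) \<in> null_sets lborel"
      by (simp add: null_sets_completion_iff)
    then have "- E2 - E1 \<in> null_sets \<nu>"
      using m by (auto simp: \<nu>_def null_sets_def emeasure_distr)
    \<comment> \<open>\<open>E1\<close> is the Borel part, and the rest of \<open>E\<close> lies in
      the null gap between \<open>E1\<close> and the complement of \<open>E2\<close>.\<close>
    moreover have "E = E1 \<union> (E - E1)" "E - E1 \<subseteq> - E2 - E1" using E1 E2 by auto
    ultimately have "E \<in> { S \<union> N |S N N'. S \<in> sets \<nu> \<and> N' \<in> null_sets \<nu> \<and> N \<subseteq> N' }"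
      using E1 by (intro completionI[of E E1 "E - E1" "- E2 - E1"]) auto
    then have "E \<in> sets (completion \<nu>)" by (simp add: sets_completion)
    then show "h -` B \<inter> space (completion \<nu>) \<in> sets (completion \<nu>)" by (simp add: E_def)
  qed simp
  then obtain k where k [measurable]: "k \<in> borel_measurable \<nu>" and kh: "AE s in \<nu>. h s = k s"
    using completion_ex_borel_measurable_complex by blast
  have "AE \<xi> in lborel. h (norm (\<xi> :: 'a)) = k (norm \<xi>)"
  proof -
    obtain N where N: "{s \<in> space \<nu>. h s \<noteq> k s} \<subseteq> N" "emeasure \<nu> N = 0" "N \<in> sets \<nu>"
      using kh by (auto elim: AE_E)
    have "emeasure lborel ((norm :: 'a \<Rightarrow> real) -` N) = 0" using N(2,3) by (simp add: \<nu>_def emeasure_distr)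
    moreover have "(norm :: 'a \<Rightarrow> real) -` N \<in> sets borel"
      using measurable_sets[OF norm_meas, of N] N(3) by simp
    ultimately show ?thesis using N(1) by (intro AE_I[of _ _ "(norm :: 'a \<Rightarrow> real) -` N"]) auto
  qed
  then have "AE \<xi> in lebesgue. h (norm (\<xi> :: 'a)) = k (norm \<xi>)" by (rule AE_completion)
  with h have "AE \<xi> in lebesgue. g \<xi> = k (norm \<xi>)" by eventually_elim simp
  moreover have "k \<in> borel_measurable borel" using k by simp
  ultimately show thesis using that by blast
qed

section \<open>Plancherel's inequality for the L^2 Fourier transform\<close>

lemma Lp_norm_2_less_imp:
  assumes "Lp_norm 2 \<mu> f < ennreal \<epsilon>"
  shows "(\<integral>\<^sup>+x. ennreal ((norm (f x))\<^sup>2) \<partial>\<mu>) \<le> ennreal (\<epsilon>\<^sup>2)"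
proof -
  have \<epsilon>: "\<epsilon> > 0" using assms by (intro ccontr[of "\<epsilon> > 0"]) (simp add: ennreal_neg)
  define I where "I = (\<integral>\<^sup>+x. ennreal ((norm (f x))\<^sup>2) \<partial>\<mu>)"
  have e: "Lp_norm 2 \<mu> f = (if I = \<infinity> then \<infinity> else ennreal (enn2real I powr (1 / 2)))"
    by (simp add: Lp_norm_def I_def powr_numeral)
  then have I: "I \<noteq> \<infinity>" using assms by auto
  then have "enn2real I powr (1 / 2) < \<epsilon>" using assms e \<epsilon> by (simp add: ennreal_less_iff)
  then have "sqrt (enn2real I) < \<epsilon>" by (simp add: powr_half_sqrt)
  then have "enn2real I \<le> \<epsilon>\<^sup>2" using \<epsilon> real_sqrt_le_iff[of "enn2real I" "\<epsilon>\<^sup>2"] by simp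
  then have *: "ennreal (enn2real I) \<le> ennreal (\<epsilon>\<^sup>2)" by (rule ennreal_leI)
  have "ennreal (enn2real I) = I" using I by (intro ennreal_enn2real) (simp add: less_top)
  then show ?thesis using * unfolding I_def[symmetric] by (simp only:)
qed

text \<open>On a ball |w| <= 1 + |w|^2 makes the truncation integrable, so the extension principle
  applies, with \<Theta>(x) = - x because of the sign in the Fourier integral. The constant does not
  depend on \<open>R\<close>.\<close>

lemma fourier_truncation_L2:
  fixes u :: "'a::euclidean_space \<Rightarrow> complex" and R :: real
  assumes u: "u \<in> borel_measurable lebesgue" and fin: "(\<integral>\<^sup>+x. ennreal ((cmod (u x))\<^sup>2) \<partial>lebesgue) < \<infinity>"
  defines "v \<equiv> \<lambda>\<xi>. fourier_integral (\<lambda>x. indicator (cball 0 R) x * u x) \<xi>"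
  shows "v \<in> borel_measurable borel"
    and "(\<integral>\<^sup>+\<xi>. ennreal ((cmod (v \<xi>))\<^sup>2) \<partial>lborel) \<le> ennreal ((2 * pi) ^ DIM('a)) * (\<integral>\<^sup>+x. ennreal ((cmod (u x))\<^sup>2) \<partial>lebesgue)"
proof -
  define B where "B = cball (0 :: 'a) R"
  have [measurable]: "B \<in> sets borel" by (simp add: B_def)
  note v_def' = v_def[folded B_def]
  obtain w where w [measurable]: "w \<in> borel_measurable borel" and uw: "AE x in lborel. u x = w x"
    using completion_ex_borel_measurable_complex[OF u] by auto
  have uw': "AE x in lebesgue. u x = w x" using uw by (rule AE_completion)
  have L2: "(\<integral>\<^sup>+x. ennreal ((cmod (u x))\<^sup>2) \<partial>lebesgue) = (\<integral>\<^sup>+x. ennreal ((cmod (w x))\<^sup>2) \<partial>lborel)"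
    unfolding nn_integral_completion using uw by (intro nn_integral_cong_AE) auto
  define F where "F = (\<lambda>x. indicator (B) x * w x)"
  have [measurable]: "F \<in> borel_measurable borel" unfolding F_def by measurable
  have v: "v \<xi> = (\<integral>x. F x * iexp (\<xi> \<bullet> (- x)) \<partial>lborel)" for \<xi>
  proof -
    have "v \<xi> = (\<integral>x. F x * iexp (\<xi> \<bullet> (- x)) \<partial>lebesgue)"
      unfolding v_def' fourier_integral_def
    proof (rule integral_cong_AE)
      have [measurable]: "u \<in> borel_measurable lebesgue" by (rule u)
      show "(\<lambda>x. indicator (B) x * u x * exp (- \<i> * complex_of_real (x \<bullet> \<xi>))) \<in> borel_measurable lebesgue"
        by (intro borel_measurable_times u measurable_completion) auto
      show "(\<lambda>x. F x * iexp (\<xi> \<bullet> (- x))) \<in> borel_measurable lebesgue"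
        by (intro measurable_completion) measurable
      show "AE x in lebesgue. indicator (B) x * u x * exp (- \<i> * complex_of_real (x \<bullet> \<xi>)) = F x * iexp (\<xi> \<bullet> (- x))"
        using uw' by eventually_elim (simp add: F_def inner_commute)
    qed
    also have "\<dots> = (\<integral>x. F x * iexp (\<xi> \<bullet> (- x)) \<partial>lborel)"
      by (rule integral_completion) measurable
    finally show ?thesis .
  qed
  show "v \<in> borel_measurable borel" unfolding v by measurable
  have i2: "integrable lborel (\<lambda>x. (cmod (w x))\<^sup>2)"
    using fin unfolding L2 by (intro integrableI_bounded) auto
  have ib: "integrable lborel (\<lambda>x. indicator (B) x :: real)"
    using emeasure_lborel_cball_finite[of "0::'a" R] by (intro integrable_real_indicator) (auto simp: B_def)
  have Fi: "integrable lborel F"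
  proof (rule Bochner_Integration.integrable_bound[OF Bochner_Integration.integrable_add[OF ib i2]])
    show "AE x in lborel. norm (F x) \<le> norm (indicator (B) x + (cmod (w x))\<^sup>2)"
    proof (intro AE_I2)
      fix x
      have "cmod (w x) \<le> 1 + (cmod (w x))\<^sup>2"
      proof -
        have "2 * cmod (w x) \<le> (cmod (w x))\<^sup>2 + 1" using sum_squares_bound[of "cmod (w x)" 1] by simp
        then show ?thesis using norm_ge_zero[of "w x"] by linarith
      qed
      then show "norm (F x) \<le> norm (indicator (B) x + (cmod (w x))\<^sup>2)"
        by (auto simp: F_def indicator_def)
    qed
  qed simp
  have "(\<integral>\<^sup>+\<xi>. ennreal ((cmod (\<integral>x. F x * iexp (\<xi> \<bullet> (- x)) \<partial>lborel))\<^sup>2) \<partial>lborel)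
    \<le> ennreal ((2 * pi) ^ DIM('a)) * 1 * (\<integral>\<^sup>+x. ennreal ((cmod (F x))\<^sup>2) \<partial>lborel)"
  proof (rule fourier_extension_L2[where S = UNIV])
    fix \<phi> :: "'a \<Rightarrow> ennreal" assume [measurable]: "\<phi> \<in> borel_measurable borel"
    have "orthogonal_transformation (\<lambda>x::'a. - x)"
      using orthogonal_transformation_neg[of "\<lambda>x::'a. x"] by simp
    from distr_lborel_orthogonal[OF this]
    have "(\<integral>\<^sup>+x. \<phi> (- x) \<partial>lborel) = (\<integral>\<^sup>+y. \<phi> y \<partial>lborel)"
      using nn_integral_distr[of "\<lambda>x::'a. - x" lborel borel \<phi>] by simp
    then show "(\<integral>\<^sup>+x. \<phi> (- x) * indicator UNIV x \<partial>lborel) \<le> 1 * (\<integral>\<^sup>+y. \<phi> y \<partial>lborel)" by simp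
  qed (use Fi in \<open>auto intro: lborel.sigma_finite_measure_axioms\<close>)
  also have "\<dots> \<le> ennreal ((2 * pi) ^ DIM('a)) * 1 * (\<integral>\<^sup>+x. ennreal ((cmod (w x))\<^sup>2) \<partial>lborel)"
    by (intro mult_left_mono nn_integral_mono) (auto simp: F_def indicator_def)
  finally show "(\<integral>\<^sup>+\<xi>. ennreal ((cmod (v \<xi>))\<^sup>2) \<partial>lborel) \<le> ennreal ((2 * pi) ^ DIM('a)) * (\<integral>\<^sup>+x. ennreal ((cmod (u x))\<^sup>2) \<partial>lebesgue)"
    unfolding v L2 by simp
qed

text \<open>For a truncated transform v close to g in L^2, |g|^2 <= 2 |v - g|^2 + 2 |v|^2: the first
  term is made at most \<epsilon> by the choice of \<open>R\<close>, the second is bounded uniformly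
  in \<open>R\<close>. The factor 2 in the constant is the price of this splitting.\<close>

lemma has_fourier_L2_bound:
  fixes u g :: "'a::euclidean_space \<Rightarrow> complex"
  assumes ug: "has_fourier_L2 u g" and fin: "(\<integral>\<^sup>+x. ennreal ((cmod (u x))\<^sup>2) \<partial>lebesgue) < \<infinity>"
  shows "(\<integral>\<^sup>+\<xi>. ennreal ((cmod (g \<xi>))\<^sup>2) \<partial>lebesgue)
    \<le> ennreal (2 * (2 * pi) ^ DIM('a)) * (\<integral>\<^sup>+x. ennreal ((cmod (u x))\<^sup>2) \<partial>lebesgue)" (is "?L \<le> ?K")
proof (rule ennreal_le_epsilon)
  fix \<epsilon> :: real assume \<epsilon>: "\<epsilon> > 0"
  have u: "u \<in> borel_measurable lebesgue" and g [measurable]: "g \<in> borel_measurable lebesgue"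
    using ug by (auto simp: has_fourier_L2_def mem_Lp_def)
  let ?D = "\<lambda>R. Lp_norm 2 lebesgue (\<lambda>\<xi>. fourier_integral (\<lambda>x. indicator (cball 0 R) x * u x) \<xi> - g \<xi>)"
  define \<delta> where "\<delta> = sqrt (\<epsilon> / 2)"
  have \<delta>: "\<delta> > 0" "2 * \<delta>\<^sup>2 = \<epsilon>" using \<epsilon> by (auto simp: \<delta>_def)
  have "(?D \<longlongrightarrow> 0) at_top"
    using ug by (simp add: has_fourier_L2_def)
  then have "\<forall>\<^sub>F R in at_top. ?D R < ennreal \<delta>"
    by (rule order_tendstoD(2)) (use \<delta> in simp)
  then obtain R where R: "?D R < ennreal \<delta>"
    by (meson eventually_happens' trivial_limit_at_top_linorder)
  define v where "v = (\<lambda>\<xi>. fourier_integral (\<lambda>x. indicator (cball 0 R) x * u x) \<xi>)"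
  have [measurable]: "v \<in> borel_measurable lebesgue"
    unfolding v_def by (intro measurable_completion) (use fourier_truncation_L2(1)[OF u fin, of R] in simp)
  have "?L \<le> (\<integral>\<^sup>+\<xi>. 2 * ennreal ((cmod (v \<xi> - g \<xi>))\<^sup>2) + 2 * ennreal ((cmod (v \<xi>))\<^sup>2) \<partial>lebesgue)"
  proof (intro nn_integral_mono)
    fix \<xi>
    have "cmod (g \<xi>) \<le> cmod (v \<xi> - g \<xi>) + cmod (v \<xi>)"
      using norm_triangle_sub[of "g \<xi>" "v \<xi>"] by (simp add: norm_minus_commute add.commute)
    then have "(cmod (g \<xi>))\<^sup>2 \<le> (cmod (v \<xi> - g \<xi>) + cmod (v \<xi>))\<^sup>2" by (intro power_mono) auto
    also have "\<dots> \<le> 2 * (cmod (v \<xi> - g \<xi>))\<^sup>2 + 2 * (cmod (v \<xi>))\<^sup>2"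
      using sum_squares_bound[of "cmod (v \<xi> - g \<xi>)" "cmod (v \<xi>)"] by (simp add: power2_sum)
    finally have "ennreal ((cmod (g \<xi>))\<^sup>2) \<le> ennreal (2 * (cmod (v \<xi> - g \<xi>))\<^sup>2 + 2 * (cmod (v \<xi>))\<^sup>2)" by (rule ennreal_leI)
    then show "ennreal ((cmod (g \<xi>))\<^sup>2) \<le> 2 * ennreal ((cmod (v \<xi> - g \<xi>))\<^sup>2) + 2 * ennreal ((cmod (v \<xi>))\<^sup>2)"
      by (simp add: ennreal_mult')
  qed
  also have "\<dots> = 2 * (\<integral>\<^sup>+\<xi>. ennreal ((cmod (v \<xi> - g \<xi>))\<^sup>2) \<partial>lebesgue) + 2 * (\<integral>\<^sup>+\<xi>. ennreal ((cmod (v \<xi>))\<^sup>2) \<partial>lebesgue)"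
    by (simp add: nn_integral_add nn_integral_cmult)
  also have "\<dots> \<le> 2 * ennreal (\<delta>\<^sup>2) + 2 * (ennreal ((2 * pi) ^ DIM('a)) * (\<integral>\<^sup>+x. ennreal ((cmod (u x))\<^sup>2) \<partial>lebesgue))"
    using Lp_norm_2_less_imp[OF R] fourier_truncation_L2(2)[OF u fin, of R]
    by (intro add_mono mult_left_mono) (auto simp: v_def nn_integral_completion)
  also have "\<dots> = ?K + ennreal \<epsilon>"
    unfolding \<delta>(2)[symmetric] by (simp add: ennreal_mult' mult.assoc add.commute)
  finally show "?L \<le> ?K + ennreal \<epsilon>" .
qed

subsection \<open>The radial Strichartz estimate\<close>

lemma Lp_norm_le_powr:
  assumes r: "r > 0" and Z: "Z \<ge> 0" and le: "(\<integral>\<^sup>+x. ennreal (norm (f x) powr r) \<partial>\<mu>) \<le> ennreal Z"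
  shows "Lp_norm (ennreal r) \<mu> f \<le> ennreal (Z powr (1 / r))"
proof -
  define I where "I = (\<integral>\<^sup>+x. ennreal (norm (f x) powr r) \<partial>\<mu>)"
  have I: "I \<noteq> \<infinity>" "enn2real I \<le> Z"
    using le Z unfolding I_def[symmetric] by (auto simp: top_unique enn2real_leI)
  have "Lp_norm (ennreal r) \<mu> f = ennreal (enn2real I powr (1 / r))"
    using r I(1) by (simp add: Lp_norm_def I_def)
  also have "\<dots> \<le> ennreal (Z powr (1 / r))"
    using I(2) r by (intro ennreal_leI powr_mono2) auto
  finally show ?thesis .
qed

lemma Lp_norm_2_eq:
  assumes "mem_Lp 2 \<mu> f"
  shows "(\<integral>\<^sup>+x. ennreal ((norm (f x))\<^sup>2) \<partial>\<mu>) < \<infinity>"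
    and "Lp_norm 2 \<mu> f = ennreal (sqrt (enn2real (\<integral>\<^sup>+x. ennreal ((norm (f x))\<^sup>2) \<partial>\<mu>)))"
proof -
  define I where "I = (\<integral>\<^sup>+x. ennreal ((norm (f x))\<^sup>2) \<partial>\<mu>)"
  have e: "Lp_norm 2 \<mu> f = (if I = \<infinity> then \<infinity> else ennreal (enn2real I powr (1 / 2)))"
    by (simp add: Lp_norm_def I_def)
  then have "I \<noteq> \<infinity>" using assms by (auto simp: mem_Lp_def)
  then show "(\<integral>\<^sup>+x. ennreal ((norm (f x))\<^sup>2) \<partial>\<mu>) < \<infinity>"
    and "Lp_norm 2 \<mu> f = ennreal (sqrt (enn2real (\<integral>\<^sup>+x. ennreal ((norm (f x))\<^sup>2) \<partial>\<mu>)))"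
    using e unfolding I_def[symmetric] by (auto simp: less_top powr_half_sqrt)
qed

text \<open>The time phase depends on the norm of \<xi> alone, so it is absorbed into the profile
  and the formula at time 0 applies to the new profile.\<close>

lemma schroedinger_radial:
  fixes g :: "real ^ 'd \<Rightarrow> complex" and k :: "real \<Rightarrow> complex"
  assumes d: "CARD('d) = Suc m" "m > 0" and g: "g \<in> borel_measurable lebesgue"
    and gk: "AE \<xi> in lebesgue. g \<xi> = k (norm \<xi>)"
    and [measurable]: "k \<in> borel_measurable borel" and k0: "\<And>s. s \<le> 0 \<Longrightarrow> k s = 0"
    and int: "integrable lborel (\<lambda>\<xi>::real ^ 'd. k (norm \<xi>))"
  shows "schroedinger g (t, x) = complex_of_real (unit_ball_vol m * m) *
    (\<integral>s. k s * complex_of_real (s ^ m * bessel_kernel m (norm x * s)) * iexp (t * s\<^sup>2) \<partial>lborel)"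
proof -
  define k' where "k' = (\<lambda>s. k s * iexp (t * s\<^sup>2))"
  have [measurable]: "k' \<in> borel_measurable borel" unfolding k'_def by measurable
  have int': "integrable lborel (\<lambda>\<xi>::real ^ 'd. k' (norm \<xi>))"
    by (rule Bochner_Integration.integrable_bound[OF int]) (auto simp: k'_def norm_mult)
  have "schroedinger g (t, x) = (\<integral>\<xi>. iexp (x \<bullet> \<xi>) * k' (norm \<xi>) \<partial>lebesgue)"
    unfolding schroedinger_def prod.case
  proof (rule integral_cong_AE)
    show "(\<lambda>\<xi>. exp (\<i> * complex_of_real (x \<bullet> \<xi> + t * (norm \<xi>)\<^sup>2)) * g \<xi>) \<in> borel_measurable lebesgue"
      by (intro borel_measurable_times g measurable_completion) measurable
    show "(\<lambda>\<xi>. iexp (x \<bullet> \<xi>) * k' (norm \<xi>)) \<in> borel_measurable lebesgue"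
      by (intro measurable_completion) measurable
    show "AE \<xi> in lebesgue. exp (\<i> * complex_of_real (x \<bullet> \<xi> + t * (norm \<xi>)\<^sup>2)) * g \<xi> = iexp (x \<bullet> \<xi>) * k' (norm \<xi>)"
      using gk by eventually_elim (simp add: k'_def distrib_left exp_add)
  qed
  also have "\<dots> = (\<integral>\<xi>. iexp (x \<bullet> \<xi>) * k' (norm \<xi>) \<partial>lborel)"
    by (rule integral_completion) measurable
  also have "\<dots> = complex_of_real (unit_ball_vol m * m) * (\<integral>s. k' s * complex_of_real (s ^ m * bessel_kernel m (norm x * s)) \<partial>lborel)"
    by (rule integral_radial_iexp[OF d _ _ int']) (auto simp: k'_def k0)
  also have "(\<integral>s. k' s * complex_of_real (s ^ m * bessel_kernel m (norm x * s)) \<partial>lborel)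
    = (\<integral>s. k s * complex_of_real (s ^ m * bessel_kernel m (norm x * s)) * iexp (t * s\<^sup>2) \<partial>lborel)"
    by (intro Bochner_Integration.integral_cong refl) (simp only: k'_def mult_ac)
  finally show ?thesis .
qed

text \<open>The radius is moved to the outer integral because the propagator estimates integrate
  over time at a fixed radius.\<close>

lemma nn_integral_time_radial:
  fixes G :: "real \<times> real \<Rightarrow> real"
  assumes d: "DIM('a::euclidean_space) = Suc m" and [measurable]: "G \<in> borel_measurable borel" and G: "\<And>z. G z \<ge> 0"
  shows "(\<integral>\<^sup>+z. ennreal (G (fst z, norm (snd z))) \<partial>(lebesgue :: (real \<times> 'a) measure))
    = ennreal (unit_ball_vol (Suc m) * Suc m) * (\<integral>\<^sup>+r. \<integral>\<^sup>+t. ennreal (G (t, r) * r ^ m) * indicator {0<..} r \<partial>lborel \<partial>lborel)"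
proof -
  define V where "V = unit_ball_vol (real (Suc m)) * real (Suc m)"
  have V: "V \<ge> 0" by (simp add: V_def)
  have "(\<integral>\<^sup>+z. ennreal (G (fst z, norm (snd z))) \<partial>(lebesgue :: (real \<times> 'a) measure))
    = (\<integral>\<^sup>+z. ennreal (G (fst z, norm (snd z))) \<partial>(lborel \<Otimes>\<^sub>M (lborel :: 'a measure)))"
    by (simp add: nn_integral_completion lborel_prod)
  also have "\<dots> = (\<integral>\<^sup>+t. \<integral>\<^sup>+x. ennreal (G (t, norm x)) \<partial>(lborel :: 'a measure) \<partial>lborel)"
    by (subst lborel.nn_integral_fst[symmetric]) auto
  also have "\<dots> = (\<integral>\<^sup>+t. \<integral>\<^sup>+r. ennreal V * (ennreal (G (t, r) * r ^ m) * indicator {0<..} r) \<partial>lborel \<partial>lborel)"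
  proof (rule nn_integral_cong)
    fix t :: real
    have "(\<integral>\<^sup>+x. ennreal (G (t, norm x)) \<partial>(lborel :: 'a measure))
      = (\<integral>\<^sup>+r. ennreal (G (t, r)) * (ennreal (unit_ball_vol DIM('a) * DIM('a) * r ^ (DIM('a) - 1)) * indicator {0<..} r) \<partial>lborel)"
      by (rule nn_integral_polar) measurable
    also have "\<dots> = (\<integral>\<^sup>+r. ennreal V * (ennreal (G (t, r) * r ^ m) * indicator {0<..} r) \<partial>lborel)"
    proof (rule nn_integral_cong)
      fix r :: real
      show "ennreal (G (t, r)) * (ennreal (unit_ball_vol DIM('a) * DIM('a) * r ^ (DIM('a) - 1)) * indicator {0<..} r)
        = ennreal V * (ennreal (G (t, r) * r ^ m) * indicator {0<..} r)"
        unfolding d V_def[symmetric] diff_Suc_1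
        using V G by (cases "r > 0") (simp_all add: ennreal_mult'[symmetric] mult_ac)
    qed
    finally show "(\<integral>\<^sup>+x. ennreal (G (t, norm x)) \<partial>(lborel :: 'a measure))
      = (\<integral>\<^sup>+r. ennreal V * (ennreal (G (t, r) * r ^ m) * indicator {0<..} r) \<partial>lborel)" .
  qed
  also have "\<dots> = (\<integral>\<^sup>+r. \<integral>\<^sup>+t. ennreal V * (ennreal (G (t, r) * r ^ m) * indicator {0<..} r) \<partial>lborel \<partial>lborel)"
    by (rule lborel_pair.Fubini') measurable
  also have "\<dots> = ennreal V * (\<integral>\<^sup>+r. \<integral>\<^sup>+t. ennreal (G (t, r) * r ^ m) * indicator {0<..} r \<partial>lborel \<partial>lborel)"
    by (simp add: nn_integral_cmult)
  finally show ?thesis unfolding V_def .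
qed

text \<open>The constant \<open>c\<close> is the Fourier bound 2 (2 pi)^(m+1) divided by the area of
  the unit sphere of R^(m+1), so that c U bounds the squared norm of the profile in s^m ds.
  Normalising divides by c U, and the case U = 0 is split off as the vanishing alternative.\<close>

lemma schroedinger_radial_band:
  fixes u g :: "real ^ 'd \<Rightarrow> complex" and M :: real
  assumes d: "CARD('d) = Suc m" "m > 0" and M: "M > 0"
    and u: "mem_Lp 2 lebesgue u" and ug: "has_fourier_L2 u g" and rad: "radial_ae g"
    and supp: "supported_in_ae g {\<xi>. M \<le> norm \<xi> \<and> norm \<xi> \<le> 2 * M}"
  defines "U \<equiv> enn2real (\<integral>\<^sup>+x. ennreal ((cmod (u x))\<^sup>2) \<partial>lebesgue)"
  defines "c \<equiv> 2 * (2 * pi) ^ Suc m / (unit_ball_vol (Suc m) * Suc m)"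
  obtains "\<And>z. schroedinger g z = 0"
  | f where "band_profile f"
    "\<And>z. schroedinger g z = complex_of_real (unit_ball_vol m * m * (M powr ((real m + 1) / 2) * sqrt (c * U)))
       * radial_propagator m f (M\<^sup>2 * fst z, M * norm (snd z))"
proof -
  have g [measurable]: "g \<in> borel_measurable lebesgue" using ug by (auto simp: has_fourier_L2_def mem_Lp_def)
  define V' where "V' = unit_ball_vol (real (Suc m)) * real (Suc m)"
  have V': "V' > 0" by (simp add: V'_def)
  have U: "(\<integral>\<^sup>+x. ennreal ((cmod (u x))\<^sup>2) \<partial>lebesgue) = ennreal U"
    using Lp_norm_2_eq(1)[OF u] unfolding U_def by simp
  have c: "c > 0" using V' by (simp add: c_def V'_def)
  have U0: "U \<ge> 0" by (simp add: U_def)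
  obtain h where "AE \<xi> in lebesgue. g \<xi> = h (norm \<xi>)" using rad by (auto simp: radial_ae_def)
  then obtain k0 where k0 [measurable]: "k0 \<in> borel_measurable borel" and gk0: "AE \<xi> in lebesgue. g \<xi> = k0 (norm \<xi>)"
    by (rule radial_borel_profile[OF g])
  \<comment> \<open>The cutoff makes the profile vanish everywhere outside the band, as a band
    profile must; the support hypothesis yields this only almost everywhere.\<close>
  define k where "k = (\<lambda>s. indicator {M..2 * M} s * k0 s)"
  have k [measurable]: "k \<in> borel_measurable borel" unfolding k_def by measurable
  have ks: "k s = 0" if "s \<notin> {M..2 * M}" for s using that by (simp add: k_def)
  have gk: "AE \<xi> in lebesgue. g \<xi> = k (norm \<xi>)"
    using gk0 supp unfolding supported_in_ae_def
  proof eventually_elim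
    case (elim \<xi>)
    then show ?case by (cases "norm \<xi> \<in> {M..2 * M}") (auto simp: k_def)
  qed
  have gL2: "(\<integral>\<^sup>+\<xi>. ennreal ((cmod (g \<xi>))\<^sup>2) \<partial>lebesgue) \<le> ennreal (V' * (c * U))"
  proof -
    have "(\<integral>\<^sup>+\<xi>. ennreal ((cmod (g \<xi>))\<^sup>2) \<partial>lebesgue) \<le> ennreal (2 * (2 * pi) ^ DIM(real ^ 'd)) * ennreal U"
      using has_fourier_L2_bound[OF ug Lp_norm_2_eq(1)[OF u]] unfolding U .
    also have "2 * (2 * pi) ^ DIM(real ^ 'd) = V' * c"
      using V' d unfolding c_def V'_def[symmetric] by simp
    also have "ennreal (V' * c) * ennreal U = ennreal (V' * (c * U))"
      using U0 by (simp only: mult.assoc[symmetric] ennreal_mult''[symmetric])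
    finally show ?thesis .
  qed
  have kL2: "(\<integral>\<^sup>+\<xi>. ennreal ((cmod (k (norm \<xi>)))\<^sup>2) \<partial>(lborel :: (real ^ 'd) measure)) \<le> ennreal (V' * (c * U))"
  proof -
    have "(\<integral>\<^sup>+\<xi>. ennreal ((cmod (g \<xi>))\<^sup>2) \<partial>lebesgue) = (\<integral>\<^sup>+\<xi>. ennreal ((cmod (k (norm (\<xi> :: real ^ 'd))))\<^sup>2) \<partial>lebesgue)"
      using gk by (intro nn_integral_cong_AE) auto
    then show ?thesis using gL2 by (simp add: nn_integral_completion)
  qed
  have int: "integrable lborel (\<lambda>\<xi>::real ^ 'd. k (norm \<xi>))"
  proof (rule Bochner_Integration.integrable_bound)
    have 1: "integrable lborel (\<lambda>\<xi>::real ^ 'd. (cmod (k (norm \<xi>)))\<^sup>2)"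
      using kL2 by (intro integrableI_bounded) (auto intro: le_less_trans)
    have 2: "integrable lborel (indicator (cball 0 (2 * M)) :: real ^ 'd \<Rightarrow> real)"
      using emeasure_lborel_cball_finite[of "0 :: real ^ 'd" "2 * M"] by (intro integrable_real_indicator) auto
    show "integrable lborel (\<lambda>\<xi>::real ^ 'd. indicator (cball 0 (2 * M)) \<xi> + (cmod (k (norm \<xi>)))\<^sup>2)"
      by (rule Bochner_Integration.integrable_add[OF 2 1])
    show "AE \<xi> in lborel. norm (k (norm (\<xi> :: real ^ 'd))) \<le> norm (indicator (cball 0 (2 * M)) \<xi> + (cmod (k (norm \<xi>)))\<^sup>2)"
    proof (intro AE_I2)
      fix \<xi> :: "real ^ 'd"
      have "2 * cmod (k (norm \<xi>)) \<le> (cmod (k (norm \<xi>)))\<^sup>2 + 1" using sum_squares_bound[of "cmod (k (norm \<xi>))" 1] by simp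
      then have "cmod (k (norm \<xi>)) \<le> 1 + (cmod (k (norm \<xi>)))\<^sup>2" using norm_ge_zero[of "k (norm \<xi>)"] by linarith
      then show "norm (k (norm \<xi>)) \<le> norm (indicator (cball 0 (2 * M)) \<xi> + (cmod (k (norm \<xi>)))\<^sup>2)"
        using ks[of "norm \<xi>"] by (cases "norm \<xi> \<in> {M..2 * M}") auto
    qed
  qed measurable
  have kpos: "k s = 0" if "s \<le> 0" for s using ks[of s] that M by auto
  note S = schroedinger_radial[OF d g gk k kpos int]
  show thesis
  proof (cases "U = 0")
    case True
    then have "(\<integral>\<^sup>+\<xi>. ennreal ((cmod (k (norm \<xi>)))\<^sup>2) \<partial>(lborel :: (real ^ 'd) measure)) = 0" using kL2 by simp
    then have "AE \<xi> in lborel. k (norm (\<xi> :: real ^ 'd)) = 0" by (subst (asm) nn_integral_0_iff_AE) auto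
    then have "AE \<xi> in lebesgue. g \<xi> = 0" using gk AE_completion by fastforce
    then have "schroedinger g z = 0" for z
      unfolding schroedinger_def by (cases z) (auto intro!: integral_eq_zero_AE)
    then show thesis by (rule that(1))
  next
    case False
    then have N: "c * U > 0" using U0 c by simp
    have L2: "(\<integral>\<^sup>+s. ennreal ((cmod (k s))\<^sup>2 * s ^ m) * indicator {0<..} s \<partial>lborel) \<le> ennreal (c * U)"
    proof -
      define X where "X = (\<integral>\<^sup>+s. ennreal ((cmod (k s))\<^sup>2 * s ^ m) * indicator {0<..} s \<partial>lborel)"
      have "(\<integral>\<^sup>+\<xi>. ennreal ((cmod (k (norm \<xi>)))\<^sup>2) \<partial>(lborel :: (real ^ 'd) measure))
        = (\<integral>\<^sup>+s. ennreal ((cmod (k s))\<^sup>2) * (ennreal (unit_ball_vol DIM(real ^ 'd) * DIM(real ^ 'd) * s ^ (DIM(real ^ 'd) - 1)) * indicator {0<..} s) \<partial>lborel)"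
        by (rule nn_integral_polar) measurable
      also have "\<dots> = (\<integral>\<^sup>+s. ennreal V' * (ennreal ((cmod (k s))\<^sup>2 * s ^ m) * indicator {0<..} s) \<partial>lborel)"
      proof (rule nn_integral_cong)
        fix s :: real
        have D: "DIM(real ^ 'd) = Suc m" using d by simp
        show "ennreal ((cmod (k s))\<^sup>2) * (ennreal (unit_ball_vol DIM(real ^ 'd) * DIM(real ^ 'd) * s ^ (DIM(real ^ 'd) - 1)) * indicator {0<..} s)
          = ennreal V' * (ennreal ((cmod (k s))\<^sup>2 * s ^ m) * indicator {0<..} s)"
          unfolding D V'_def[symmetric] diff_Suc_1
          using V' by (cases "s > 0") (simp_all add: ennreal_mult'[symmetric] mult_ac)
      qed
      also have "\<dots> = ennreal V' * X" unfolding X_def by (rule nn_integral_cmult) measurable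
      finally have "ennreal V' * X \<le> ennreal (V' * (c * U))" using kL2 by simp
      then have "ennreal (1 / V') * (ennreal V' * X) \<le> ennreal (1 / V') * ennreal (V' * (c * U))"
        by (rule mult_left_mono) simp
      then show ?thesis unfolding X_def[symmetric]
        using V' N by (simp add: mult.assoc[symmetric] ennreal_mult'[symmetric])
    qed
    obtain f where f: "band_profile f" and fk:
      "\<And>t r. (\<integral>s. k s * complex_of_real (s ^ m * bessel_kernel m (r * s)) * iexp (t * s\<^sup>2) \<partial>lborel)
       = complex_of_real (M powr ((real m + 1) / 2) * sqrt (c * U)) * radial_propagator m f (M\<^sup>2 * t, M * r)"
      by (rule radial_profile_rescale[OF d(2) M N k ks L2]) (assumption, rule that)
    show thesis
    proof (rule that(2)[OF f])
      fix z :: "real \<times> (real ^ 'd)"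
      show "schroedinger g z = complex_of_real (unit_ball_vol m * m * (M powr ((real m + 1) / 2) * sqrt (c * U)))
       * radial_propagator m f (M\<^sup>2 * fst z, M * norm (snd z))"
        using S[of "fst z" "snd z"] unfolding fk by (simp add: mult.assoc)
    qed
  qed
qed

lemma borel_measurable_rescaled_time_radial:
  fixes F :: "real \<times> real \<Rightarrow> 'b::topological_space"
  assumes "F \<in> borel_measurable borel"
  shows "(\<lambda>z :: real \<times> 'a::euclidean_space. F (M\<^sup>2 * fst z, M * norm (snd z))) \<in> borel_measurable borel"
proof -
  have "(\<lambda>z :: real \<times> 'a. (M\<^sup>2 * fst z, M * norm (snd z))) \<in> borel_measurable borel"
    by (intro borel_measurable_continuous_onI continuous_intros)
  from measurable_compose[OF this assms] show ?thesis .
qed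

text \<open>The space is R^(m+1) with m = n - 2. The power (n - 1) / 2 of M is the one that
  normalises the profile, and - (n + 1) / q comes from rescaling time and space.\<close>

theorem corollary6p2:
  fixes n :: nat and q :: ennreal
  assumes "n \<ge> 3"
    and "CARD('d::finite) = n - 1"
    and "q > ennreal ((4 * real n - 2) / (2 * real n - 3))"
  shows "\<exists>C::real. C > 0 \<and>
    (\<forall>(M::real) (u0 :: real ^ 'd \<Rightarrow> complex) (u0_hat :: real ^ 'd \<Rightarrow> complex).
       dyadic M \<longrightarrow>
       mem_Lp 2 lebesgue u0 \<longrightarrow>
       has_fourier_L2 u0 u0_hat \<longrightarrow>
       radial_ae u0_hat \<longrightarrow>
       supported_in_ae u0_hat {\<xi>. M \<le> norm \<xi> \<and> norm \<xi> \<le> 2 * M} \<longrightarrow>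
       Lp_norm q lebesgue (schroedinger u0_hat)
         \<le> ennreal (C * M powr ((real n - 1) / 2 - (real n + 1) * enn2real (1 / q)))
             * Lp_norm 2 lebesgue u0)"
proof -
  define m where "m = n - 2"
  have n: "n = m + 2" and m: "m > 0" using assms(1) by (auto simp: m_def)
  have d: "CARD('d) = Suc m" using assms(2) n by simp
  define V where "V = unit_ball_vol (real m) * real m"
  define V' where "V' = unit_ball_vol (real (Suc m)) * real (Suc m)"
  define c where "c = 2 * (2 * pi) ^ Suc m / (unit_ball_vol (Suc m) * Suc m)"
  have V: "V \<ge> 0" and V': "V' \<ge> 0" and c: "c \<ge> 0" by (simp_all add: V_def V'_def c_def)
  \<comment> \<open>In terms of m the critical exponent is (4 m + 6) / (2 m + 1), the value of q at
    which \<alpha> = 1.\<close>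
  have q0: "(4 * real n - 2) / (2 * real n - 3) = 2 + 4 / (2 * real m + 1)"
    unfolding n by (simp add: field_simps)
  \<comment> \<open>The bound is stated so as to cover both cases: for q = \<infinity> the
    reciprocal \<open>enn2real (1 / q)\<close> is 0 and the power of M is 1.\<close>
  obtain B where B: "B \<ge> 0" and bound: "\<And>f M \<kappa> G. \<lbrakk>band_profile f; M > 0; \<kappa> \<ge> 0;
      \<And>z. G z = complex_of_real \<kappa> * radial_propagator m f (M\<^sup>2 * fst z, M * norm (snd (z :: real \<times> (real ^ 'd))))\<rbrakk>
      \<Longrightarrow> Lp_norm q lebesgue G \<le> ennreal (\<kappa> * B * M powr (- (real m + 3) * enn2real (1 / q)))"
  proof (cases q)
    case (real p)
    then have p: "2 + 4 / (2 * real m + 1) < p"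
      using assms(3) ennreal_less_iff[of "2 + 4 / (2 * real m + 1)" p]
      unfolding q0 by (simp del: ennreal_plus)
    have p0: "p > 0" using p by (smt (verit) divide_nonneg_nonneg of_nat_0_le_iff)
    have ip: "enn2real (1 / q) = 1 / p"
      using real p0 by (simp add: divide_ennreal flip: ennreal_1)
    obtain C1 where C1: "C1 \<ge> 0" and C1B: "\<And>f. band_profile f \<Longrightarrow>
       (\<integral>\<^sup>+r. \<integral>\<^sup>+t. ennreal (cmod (radial_propagator m f (t, r)) powr p * r ^ m) * indicator {0<..} r \<partial>lborel \<partial>lborel) \<le> ennreal C1"
      by (rule radial_propagator_Lq[OF m p]) (rule that)
    show thesis
    proof (rule that[of "(V' * C1) powr (1 / p)"])
      fix f M \<kappa> and G :: "real \<times> (real ^ 'd) \<Rightarrow> complex"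
      assume f: "band_profile f" and M: "M > (0::real)" and \<kappa>: "\<kappa> \<ge> (0::real)"
        and G: "\<And>z. G z = complex_of_real \<kappa> * radial_propagator m f (M\<^sup>2 * fst z, M * norm (snd z))"
      note [measurable] = borel_measurable_radial_propagator[OF m band_profileD(1)[OF f]]
      define H where "H = (\<lambda>z. cmod (radial_propagator m f z) powr p)"
      have [measurable]: "H \<in> borel_measurable borel" unfolding H_def by measurable
      have H0: "H z \<ge> 0" for z by (simp add: H_def)
      have "(\<integral>\<^sup>+z. ennreal (norm (G z) powr p) \<partial>lebesgue)
        = (\<integral>\<^sup>+z. ennreal (\<kappa> powr p) * ennreal (H (M\<^sup>2 * fst z, M * norm (snd z))) \<partial>(lebesgue :: (real \<times> (real ^ 'd)) measure))"
        using \<kappa> by (intro nn_integral_cong) (simp add: G H_def norm_mult powr_mult ennreal_mult)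
      also have "\<dots> = ennreal (\<kappa> powr p) * (\<integral>\<^sup>+z. ennreal (H (M\<^sup>2 * fst z, M * norm (snd z))) \<partial>(lebesgue :: (real \<times> (real ^ 'd)) measure))"
      proof (rule nn_integral_cmult)
        have "(\<lambda>z :: real \<times> (real ^ 'd). ennreal (H (M\<^sup>2 * fst z, M * norm (snd z)))) \<in> borel_measurable borel"
          by (rule borel_measurable_rescaled_time_radial) measurable
        then show "(\<lambda>z :: real \<times> (real ^ 'd). ennreal (H (M\<^sup>2 * fst z, M * norm (snd z)))) \<in> borel_measurable lebesgue"
          by (intro measurable_completion) simp
      qed
      also have "(\<integral>\<^sup>+z. ennreal (H (M\<^sup>2 * fst z, M * norm (snd z))) \<partial>(lebesgue :: (real \<times> (real ^ 'd)) measure))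
        = ennreal V' * (\<integral>\<^sup>+r. \<integral>\<^sup>+t. ennreal (H (M\<^sup>2 * t, M * r) * r ^ m) * indicator {0<..} r \<partial>lborel \<partial>lborel)"
      proof -
        have [measurable]: "(\<lambda>z. H (M\<^sup>2 * fst z, M * snd z)) \<in> borel_measurable borel"
          unfolding borel_prod[symmetric] by measurable
        show ?thesis
          using nn_integral_time_radial[where 'a = "real ^ 'd" and m = m and G = "\<lambda>z. H (M\<^sup>2 * fst z, M * snd z)"] d H0
          unfolding V'_def by simp
      qed
      also have "\<dots> = ennreal V' * (ennreal (M powr - (real m + 3)) * (\<integral>\<^sup>+r. \<integral>\<^sup>+t. ennreal (H (t, r) * r ^ m) * indicator {0<..} r \<partial>lborel \<partial>lborel))"
        by (subst nn_integral_rescale_radius_time[OF M _ H0]) auto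
      also have "ennreal (\<kappa> powr p) * \<dots> \<le> ennreal (\<kappa> powr p) * (ennreal V' * (ennreal (M powr - (real m + 3)) * ennreal C1))"
        unfolding H_def by (intro mult_left_mono C1B[OF f]) auto
      also have "\<dots> = ennreal (\<kappa> powr p * (V' * C1) * M powr - (real m + 3))"
        using V' C1 by (simp add: ennreal_mult'[symmetric] mult_ac)
      finally have "Lp_norm (ennreal p) lebesgue G \<le> ennreal ((\<kappa> powr p * (V' * C1) * M powr - (real m + 3)) powr (1 / p))"
        using V' C1 by (intro Lp_norm_le_powr p0) auto
      also have "(\<kappa> powr p * (V' * C1) * M powr - (real m + 3)) powr (1 / p)
        = (\<kappa> powr p) powr (1 / p) * (V' * C1) powr (1 / p) * (M powr - (real m + 3)) powr (1 / p)"
        using V' C1 by (simp add: powr_mult)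
      also have "\<dots> = \<kappa> * (V' * C1) powr (1 / p) * M powr (- (real m + 3) * enn2real (1 / q))"
        unfolding ip powr_powr using p0 \<kappa> by simp
      finally show "Lp_norm q lebesgue G \<le> ennreal (\<kappa> * (V' * C1) powr (1 / p) * M powr (- (real m + 3) * enn2real (1 / q)))"
        using real by simp
    qed simp
  next
    case top
    show thesis
    proof (rule that[of "2 powr (m / 2) * pi"])
      fix f M \<kappa> and G :: "real \<times> (real ^ 'd) \<Rightarrow> complex"
      assume f: "band_profile f" and M: "M > (0::real)" and \<kappa>: "\<kappa> \<ge> (0::real)"
        and G: "\<And>z. G z = complex_of_real \<kappa> * radial_propagator m f (M\<^sup>2 * fst z, M * norm (snd z))"
      have "(\<lambda>z. complex_of_real \<kappa> * radial_propagator m f (M\<^sup>2 * fst z, M * norm (snd (z :: real \<times> (real ^ 'd))))) \<in> borel_measurable borel"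
        by (intro borel_measurable_times borel_measurable_const,
            rule borel_measurable_rescaled_time_radial[OF borel_measurable_radial_propagator[OF m band_profileD(1)[OF f]]])
      then have "G \<in> borel_measurable borel" unfolding G[symmetric] .
      then have "(\<lambda>z. ennreal (norm (G z))) \<in> borel_measurable lebesgue" by (intro measurable_completion) simp
      moreover have "norm (G z) \<le> \<kappa> * (2 powr (m / 2) * pi)" for z
        unfolding G norm_mult using \<kappa> by (simp only: norm_of_real abs_of_nonneg) (intro mult_left_mono radial_propagator_bound m f)
      then have "AE z in lebesgue. ennreal (norm (G z)) \<le> ennreal (\<kappa> * (2 powr (m / 2) * pi))"
        by (intro AE_I2 ennreal_leI)
      ultimately have "esssup lebesgue (\<lambda>z. ennreal (norm (G z))) \<le> ennreal (\<kappa> * (2 powr (m / 2) * pi))"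
        by (rule esssup_I)
      then show "Lp_norm q lebesgue G \<le> ennreal (\<kappa> * (2 powr (m / 2) * pi) * M powr (- (real m + 3) * enn2real (1 / q)))"
        using M top by (simp add: Lp_norm_def)
    qed simp
  qed
  \<comment> \<open>The summand 1 makes the constant positive even if the product is 0.\<close>
  define C where "C = V * sqrt c * B + 1"
  have C: "C > 0" "V * sqrt c * B \<le> C" using V c B by (auto simp: C_def intro!: add_nonneg_pos)
  show ?thesis
  proof (intro exI[of _ C] conjI C(1) allI impI)
    fix M :: real and u g :: "real ^ 'd \<Rightarrow> complex"
    assume dM: "dyadic M" and u: "mem_Lp 2 lebesgue u" and ug: "has_fourier_L2 u g" and rad: "radial_ae g"
      and supp: "supported_in_ae g {\<xi>. M \<le> norm \<xi> \<and> norm \<xi> \<le> 2 * M}"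
    have M: "M > 0" using dM by (auto simp: dyadic_def)
    define U where "U = enn2real (\<integral>\<^sup>+x. ennreal ((cmod (u x))\<^sup>2) \<partial>lebesgue)"
    have U0: "U \<ge> 0" by (simp add: U_def)
    show "Lp_norm q lebesgue (schroedinger g)
         \<le> ennreal (C * M powr ((real n - 1) / 2 - (real n + 1) * enn2real (1 / q))) * Lp_norm 2 lebesgue u"
    proof (rule schroedinger_radial_band[OF d m M u ug rad supp])
      assume zero: "\<And>z. schroedinger g z = 0"
      \<comment> \<open>The zero function is a band profile, so the general bound with factor 0
        settles the vanishing evolution.\<close>
      obtain f :: "real \<Rightarrow> complex" where f: "band_profile f"
        using that[of "\<lambda>_. 0"] by (simp add: band_profile_def)
      have "Lp_norm q lebesgue (schroedinger g) \<le> ennreal (0 * B * M powr (- (real m + 3) * enn2real (1 / q)))"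
        by (rule bound[OF f M]) (simp_all add: zero)
      then show ?thesis by simp
    next
      fix f
      assume f: "band_profile f" and S: "\<And>z. schroedinger g z = complex_of_real (unit_ball_vol m * m * (M powr ((real m + 1) / 2)
          * sqrt (2 * (2 * pi) ^ Suc m / (unit_ball_vol (Suc m) * Suc m) * enn2real (\<integral>\<^sup>+x. ennreal ((cmod (u x))\<^sup>2) \<partial>lebesgue))))
          * radial_propagator m f (M\<^sup>2 * fst z, M * norm (snd z))"
      define \<kappa> where "\<kappa> = V * (M powr ((real m + 1) / 2) * sqrt (c * U))"
      have \<kappa>: "\<kappa> \<ge> 0" using V c by (simp add: \<kappa>_def U_def)
      have "Lp_norm q lebesgue (schroedinger g) \<le> ennreal (\<kappa> * B * M powr (- (real m + 3) * enn2real (1 / q)))"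
        by (rule bound[OF f M \<kappa>]) (simp only: S \<kappa>_def V_def c_def U_def)
      also have "\<kappa> * B * M powr (- (real m + 3) * enn2real (1 / q))
        = V * sqrt c * B * (M powr ((real m + 1) / 2) * M powr (- (real m + 3) * enn2real (1 / q))) * sqrt U"
        unfolding \<kappa>_def real_sqrt_mult by (simp only: mult_ac)
      \<comment> \<open>The exponents match since m + 1 = n - 1 and m + 3 = n + 1.\<close>
      also have "M powr ((real m + 1) / 2) * M powr (- (real m + 3) * enn2real (1 / q))
        = M powr ((real n - 1) / 2 - (real n + 1) * enn2real (1 / q))"
        unfolding powr_add[symmetric] n by (simp add: algebra_simps)
      also have "ennreal (V * sqrt c * B * M powr ((real n - 1) / 2 - (real n + 1) * enn2real (1 / q)) * sqrt U)
        \<le> ennreal (C * M powr ((real n - 1) / 2 - (real n + 1) * enn2real (1 / q)) * sqrt U)"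
        by (intro ennreal_leI mult_right_mono C(2)) (auto simp: U_def)
      also have "\<dots> = ennreal (C * M powr ((real n - 1) / 2 - (real n + 1) * enn2real (1 / q))) * Lp_norm 2 lebesgue u"
        unfolding Lp_norm_2_eq(2)[OF u] U_def[symmetric] using C(1) U0 by (simp add: ennreal_mult)
      finally show ?thesis .
    qed
  qed
qed

end
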